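(* Let $\pi_1:V_1\to X_1$, $\pi_1':V_1'\to X_1$ and $\pi_2:V_2\to X_2$, $\pi_2':V_2'\to X_2$ be two pairs of finite-dimensional diffeological vector pseudo-bundles. Let $f:X_1\supset Y\to f(Y)\subset X_2$ be a smooth map that is a diffeomorphism with its image, and let $\tilde f:V_1\supset\pi_1^{-1}(Y)\to\pi_2^{-1}(f(Y))\subset V_2$ and $\tilde f':V_1'\supset(\pi_1')^{-1}(Y)\to(\pi_2')^{-1}(f(Y))\subset V_2'$ be two smooth lifts of $f$ that are linear on all fibres in their respective domains of definition. Then there exists a diffeomorphism $$\Psi:(V_1\cup_{\tilde f}V_2)\otimes(V_1'\cup_{\tilde f'}V_2')\to(V_1\otimes V_1')\cup_{\tilde f\otimes\tilde f'}(V_2\otimes V_2')$$ such that $$(\pi_1\cup_{(\tilde f,f)}\pi_2)\otimes(\pi_1'\cup_{(\tilde f',f)}\pi_2')=\left((\pi_1\otimes\pi_1')\cup_{(\tilde f\otimes\tilde f',f)}(\pi_2\otimes\pi_2')\right)\circ\Psi.$$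
   Context: A diffeological space is a set $X$ with a collection of maps (plots) $U\to X$, $U$ open in $\mathbb{R}^n$, $n\in\mathbb{N}$, that contains all constant maps, is closed under precomposition with usual smooth maps, and satisfies the sheaf condition (a map that is locally a plot is a plot). A map of diffeological spaces is smooth if its composition with every plot is a plot; a diffeomorphism is a smooth bijection with smooth inverse. Subsets carry the subset diffeology (plots with image in the subset), quotients the quotient diffeology (maps locally lifting to plots), disjoint unions the disjoint union diffeology (maps locally equal to plots of one component), products the product diffeology (componentwise plots). A (finite-dimensional) diffeological vector pseudo-bundle is a smooth surjection $\pi:V\to X$ of diffeological spaces with a (finite-dimensional real) vector space structure on every fibre $\pi^{-1}(x)$, such that fibrewise addition $V\times_XV\to V$, scalar multiplication $\mathbb{R}\times V\to V$ and the zero section $X\to V$ are smooth. No local triviality is required. Gluing: for a smooth map $f:X_1\supset Y\to X_2$ ($Y$ with the subset diffeology), $X_1\cup_fX_2=(X_1\sqcup X_2)/\sim$, where $\sim$ is the equivalence relation generated by $y\sim f(y)$ for $y\in Y$, with the quotient diffeology of the disjoint union diffeology. If $\pi_i:V_i\to X_i$ are pseudo-bundles and $\tilde f:\pi_1^{-1}(Y)\to\pi_2^{-1}(f(Y))$ is a smooth lift of $f$ (that is, $\pi_2\circ\tilde f=f\circ\pi_1$), linear on fibres, then $\pi_1$ and $\pi_2$ induce a pseudo-bundle $\pi_1\cup_{(\tilde f,f)}\pi_2:V_1\cup_{\tilde f}V_2\to X_1\cup_fX_2$; its fibre over a point coming from $X_1\setminus Y$ is the fibre of $V_1$, and over a point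 coming from $X_2$ it is the fibre of $V_2$. Tensor product of pseudo-bundles $\pi:V\to X$ and $\pi':V'\to X$: the set $V\otimes V'=\bigcup_{x\in X}\pi^{-1}(x)\otimes(\pi')^{-1}(x)$, with its obvious projection $\pi\otimes\pi'$ to $X$, endowed with the smallest pseudo-bundle diffeology for which the universal map $V\times_XV'\to V\otimes V'$ is smooth; its plots are locally finite sums $\sum_iq_i\otimes q_i'$ with $q_i$, $q_i'$ plots of $V$, $V'$ all lying over one common plot of $X$. The map $\tilde f\otimes\tilde f'$ is defined fibrewise. *)

theory Defs
  imports "HOL-Analysis.Analysis" "HOL-Algebra.Module" "HOL-Library.Poly_Mapping"
begin

section \<open>Smooth maps between open subsets of Euclidean spaces\<close>

text \<open>
  The dimension of the domain of a plot varies, so \<open>\<real>^n\<close> is \<^term>\<open>Euclidean_space n\<close>: sequences that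
  vanish from index \<open>n\<close> on. For open \<open>U\<close>, \<open>x(i := t)\<close> with \<open>i < n\<close> moves along the \<open>i\<close>-th axis.
\<close>

primrec Ck_on :: "nat \<Rightarrow> nat \<Rightarrow> (nat \<Rightarrow> real) set \<Rightarrow> ((nat \<Rightarrow> real) \<Rightarrow> real) \<Rightarrow> bool" where
  "Ck_on 0 n U f \<longleftrightarrow> continuous_map (subtopology (Euclidean_space n) U) euclideanreal f"
| "Ck_on (Suc k) n U f \<longleftrightarrow>
     continuous_map (subtopology (Euclidean_space n) U) euclideanreal f \<and>
     (\<forall>i<n. \<exists>g. Ck_on k n U g \<and>
        (\<forall>x\<in>U. ((\<lambda>t. f (x(i := t))) has_real_derivative g x) (at (x i))))"

definition Cinf_on :: "nat \<Rightarrow> (nat \<Rightarrow> real) set \<Rightarrow> ((nat \<Rightarrow> real) \<Rightarrow> real) \<Rightarrow> bool" where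
  "Cinf_on n U f \<longleftrightarrow> (\<forall>k. Ck_on k n U f)"

definition Cinf_map ::
    "nat \<Rightarrow> (nat \<Rightarrow> real) set \<Rightarrow> nat \<Rightarrow> (nat \<Rightarrow> real) set \<Rightarrow> ((nat \<Rightarrow> real) \<Rightarrow> nat \<Rightarrow> real) \<Rightarrow> bool" where
  "Cinf_map m W n U g \<longleftrightarrow> g ` W \<subseteq> U \<and> (\<forall>i<n. Cinf_on m W (\<lambda>x. g x i))"

text \<open>\<open>U\<close> is open in \<open>\<real>^n\<close> and every point of \<open>U\<close> has an open neighbourhood \<open>W \<subseteq> U\<close> with \<open>P W\<close>.\<close>

definition locally_in :: "nat \<Rightarrow> (nat \<Rightarrow> real) set \<Rightarrow> ((nat \<Rightarrow> real) set \<Rightarrow> bool) \<Rightarrow> bool" where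
  "locally_in n U P \<longleftrightarrow> openin (Euclidean_space n) U \<and>
     (\<forall>u\<in>U. \<exists>W. openin (Euclidean_space n) W \<and> u \<in> W \<and> W \<subseteq> U \<and> P W)"


section \<open>Diffeological spaces\<close>

text \<open>
  \<open>plot X n U p\<close>: the restriction of \<open>p\<close> to the open set \<open>U\<close> of \<open>\<real>^n\<close> is a plot of \<open>X\<close>. HOL functions
  being total, the values of \<open>p\<close> outside \<open>U\<close> must not matter; this is the second condition below.
\<close>

record 'a diff_space = "'a partial_object" +
  plot :: "nat \<Rightarrow> (nat \<Rightarrow> real) set \<Rightarrow> ((nat \<Rightarrow> real) \<Rightarrow> 'a) \<Rightarrow> bool"

definition diffeological_space :: "'a diff_space \<Rightarrow> bool" where
  "diffeological_space X \<longleftrightarrow>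
     (\<forall>n U p. plot X n U p \<longrightarrow> openin (Euclidean_space n) U \<and> p ` U \<subseteq> carrier X) \<and>
     (\<forall>n U p q. plot X n U p \<longrightarrow> (\<forall>u\<in>U. q u = p u) \<longrightarrow> plot X n U q) \<and>
     (\<forall>n U. \<forall>x\<in>carrier X. openin (Euclidean_space n) U \<longrightarrow> plot X n U (\<lambda>_. x)) \<and>
     (\<forall>m W n U p g. plot X n U p \<longrightarrow> openin (Euclidean_space m) W \<longrightarrow> Cinf_map m W n U g \<longrightarrow>
        plot X m W (p \<circ> g)) \<and>
     (\<forall>n U p. locally_in n U (\<lambda>W. plot X n W p) \<longrightarrow> plot X n U p)"

definition smooth :: "'a diff_space \<Rightarrow> 'b diff_space \<Rightarrow> ('a \<Rightarrow> 'b) \<Rightarrow> bool" where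
  "smooth X Y f \<longleftrightarrow> f ` carrier X \<subseteq> carrier Y \<and>
     (\<forall>n U p. plot X n U p \<longrightarrow> plot Y n U (f \<circ> p))"

definition diffeomorphism :: "'a diff_space \<Rightarrow> 'b diff_space \<Rightarrow> ('a \<Rightarrow> 'b) \<Rightarrow> bool" where
  "diffeomorphism X Y f \<longleftrightarrow> bij_betw f (carrier X) (carrier Y) \<and>
     smooth X Y f \<and> smooth Y X (inv_into (carrier X) f)"

definition subset_space :: "'a diff_space \<Rightarrow> 'a set \<Rightarrow> 'a diff_space" where
  "subset_space X A = \<lparr>carrier = A, plot = (\<lambda>n U p. plot X n U p \<and> p ` U \<subseteq> A)\<rparr>"

definition sum_space :: "'a diff_space \<Rightarrow> 'b diff_space \<Rightarrow> ('a + 'b) diff_space" where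
  "sum_space X Y =
     \<lparr>carrier = carrier X <+> carrier Y,
      plot = (\<lambda>n U p. locally_in n U (\<lambda>W.
        (\<exists>q. plot X n W q \<and> (\<forall>w\<in>W. p w = Inl (q w))) \<or>
        (\<exists>q. plot Y n W q \<and> (\<forall>w\<in>W. p w = Inr (q w)))))\<rparr>"

definition quotient_space :: "'a diff_space \<Rightarrow> ('a \<times> 'a) set \<Rightarrow> 'a set diff_space" where
  "quotient_space X r =
     \<lparr>carrier = carrier X // r,
      plot = (\<lambda>n U p. locally_in n U (\<lambda>W. \<exists>q. plot X n W q \<and> (\<forall>w\<in>W. p w = r `` {q w})))\<rparr>"

definition prod_space :: "'a diff_space \<Rightarrow> 'b diff_space \<Rightarrow> ('a \<times> 'b) diff_space" where
  "prod_space X Y =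
     \<lparr>carrier = carrier X \<times> carrier Y,
      plot = (\<lambda>n U p. plot X n U (fst \<circ> p) \<and> plot Y n U (snd \<circ> p))\<rparr>"

definition real_space :: "real diff_space" where
  "real_space =
     \<lparr>carrier = UNIV, plot = (\<lambda>n U p. openin (Euclidean_space n) U \<and> Cinf_on n U p)\<rparr>"


section \<open>Diffeological vector pseudo-bundles\<close>

text \<open>
  The base space is a separate argument throughout, so that two pseudo-bundles can share it.
  \<open>vadd\<close> matters only on pairs of points of the same fibre.
\<close>

record ('x, 'v) vbundle =
  total :: "'v diff_space"
  proj :: "'v \<Rightarrow> 'x"
  vadd :: "'v \<Rightarrow> 'v \<Rightarrow> 'v"
  vscale :: "real \<Rightarrow> 'v \<Rightarrow> 'v"
  vzero :: "'x \<Rightarrow> 'v"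

definition points_over :: "('x, 'v) vbundle \<Rightarrow> 'x set \<Rightarrow> 'v set" where
  "points_over V A = {v \<in> carrier (total V). proj V v \<in> A}"

definition real_field :: "real ring" where
  "real_field = \<lparr>carrier = UNIV, mult = (*), one = 1, zero = 0, add = (+)\<rparr>"

text \<open>The fields \<open>mult\<close> and \<open>one\<close> of a record of type \<open>module\<close> play no role in a vector space.\<close>

definition fibre :: "('x, 'v) vbundle \<Rightarrow> 'x \<Rightarrow> (real, 'v) module" where
  "fibre V x =
     \<lparr>carrier = points_over V {x}, mult = undefined, one = undefined,
      zero = vzero V x, add = vadd V, smult = vscale V\<rparr>"

definition fibre_product :: "('x, 'v) vbundle \<Rightarrow> ('x, 'w) vbundle \<Rightarrow> ('v \<times> 'w) diff_space" where
  "fibre_product V W =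
     subset_space (prod_space (total V) (total W))
       {(v, w). v \<in> carrier (total V) \<and> w \<in> carrier (total W) \<and> proj V v = proj W w}"

definition pseudo_bundle :: "'x diff_space \<Rightarrow> ('x, 'v) vbundle \<Rightarrow> bool" where
  "pseudo_bundle X V \<longleftrightarrow>
     diffeological_space X \<and> diffeological_space (total V) \<and>
     smooth (total V) X (proj V) \<and> proj V ` carrier (total V) = carrier X \<and>
     (\<forall>x\<in>carrier X. Module.module real_field (fibre V x)) \<and>
     smooth (fibre_product V V) (total V) (\<lambda>(v, w). vadd V v w) \<and>
     smooth (prod_space real_space (total V)) (total V) (\<lambda>(c, v). vscale V c v) \<and>
     smooth X (total V) (vzero V)"

definition finite_dimensional :: "(real, 'v) module \<Rightarrow> bool" where
  "finite_dimensional M \<longleftrightarrow>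
     (\<exists>A. finite A \<and> A \<subseteq> carrier M \<and>
       (\<forall>v\<in>carrier M. \<exists>c. v = (\<Oplus>\<^bsub>M\<^esub>a\<in>A. c a \<odot>\<^bsub>M\<^esub> a)))"

definition fd_pseudo_bundle :: "'x diff_space \<Rightarrow> ('x, 'v) vbundle \<Rightarrow> bool" where
  "fd_pseudo_bundle X V \<longleftrightarrow>
     pseudo_bundle X V \<and> (\<forall>x\<in>carrier X. finite_dimensional (fibre V x))"

definition linear_on_fibres ::
    "('x, 'v) vbundle \<Rightarrow> 'x set \<Rightarrow> ('y, 'w) vbundle \<Rightarrow> ('v \<Rightarrow> 'w) \<Rightarrow> bool" where
  "linear_on_fibres V Y W h \<longleftrightarrow>
     (\<forall>y\<in>Y. (\<forall>v\<in>points_over V {y}. \<forall>w\<in>points_over V {y}. h (vadd V v w) = vadd W (h v) (h w)) \<and>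
            (\<forall>c. \<forall>v\<in>points_over V {y}. h (vscale V c v) = vscale W c (h v)))"

text \<open>\<open>h\<close> is a smooth lift of \<open>f\<close>, defined over \<open>Y\<close> and linear on fibres.\<close>

definition smooth_linear_lift ::
    "('x, 'v) vbundle \<Rightarrow> 'x set \<Rightarrow> ('x \<Rightarrow> 'y) \<Rightarrow> ('y, 'w) vbundle \<Rightarrow> ('v \<Rightarrow> 'w) \<Rightarrow> bool" where
  "smooth_linear_lift V Y f W h \<longleftrightarrow>
     smooth (subset_space (total V) (points_over V Y)) (subset_space (total W) (points_over W (f ` Y))) h \<and>
     (\<forall>v\<in>points_over V Y. proj W (h v) = f (proj V v)) \<and>
     linear_on_fibres V Y W h"


section \<open>Gluing\<close>

definition equiv_gen :: "'a set \<Rightarrow> ('a \<times> 'a) set \<Rightarrow> ('a \<times> 'a) set" where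
  "equiv_gen A R = \<Inter>{r. equiv A r \<and> R \<subseteq> r}"

definition glue_rel ::
    "'a diff_space \<Rightarrow> 'a set \<Rightarrow> ('a \<Rightarrow> 'b) \<Rightarrow> 'b diff_space \<Rightarrow> (('a + 'b) \<times> ('a + 'b)) set" where
  "glue_rel X1 Y f X2 =
     equiv_gen (carrier X1 <+> carrier X2) {(Inl y, Inr (f y)) | y. y \<in> Y}"

definition glue_space ::
    "'a diff_space \<Rightarrow> 'a set \<Rightarrow> ('a \<Rightarrow> 'b) \<Rightarrow> 'b diff_space \<Rightarrow> ('a + 'b) set diff_space" where
  "glue_space X1 Y f X2 = quotient_space (sum_space X1 X2) (glue_rel X1 Y f X2)"

text \<open>
  A point of \<open>glue_space X1 Y f X2\<close> contains at most one point of \<open>X2\<close>; if it contains none, it is a single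
  point of \<open>X1 - Y\<close>. The canonical representative lies in \<open>X2\<close> if possible. Computing with these
  representatives makes the fibres over points of \<open>X2\<close> those of \<open>V2\<close>, and the fibres over points
  of \<open>X1 - Y\<close> those of \<open>V1\<close>.
\<close>

definition glue_rep :: "('a + 'b) set \<Rightarrow> 'a + 'b" where
  "glue_rep C =
     (if \<exists>b. Inr b \<in> C then Inr (THE b. Inr b \<in> C) else Inl (THE a. Inl a \<in> C))"

text \<open>
  \<open>proj\<close> sends the class of \<open>c\<close> to the class of the image of \<open>c\<close>: for an equivalence relation
  \<open>r\<close>, the set \<open>r `` A\<close> is the common class of the elements of \<open>A\<close>.
\<close>

definition glue_bundle ::
    "'x diff_space \<Rightarrow> 'x set \<Rightarrow> ('x \<Rightarrow> 'y) \<Rightarrow> 'y diff_space \<Rightarrow>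
     ('x, 'v) vbundle \<Rightarrow> ('v \<Rightarrow> 'w) \<Rightarrow> ('y, 'w) vbundle \<Rightarrow> (('x + 'y) set, ('v + 'w) set) vbundle" where
  "glue_bundle X1 Y f X2 V1 h V2 =
     (let rX = glue_rel X1 Y f X2; rV = glue_rel (total V1) (points_over V1 Y) h (total V2) in
      \<lparr>total = glue_space (total V1) (points_over V1 Y) h (total V2),
       proj = (\<lambda>C. rX `` (map_sum (proj V1) (proj V2) ` C)),
       vadd = (\<lambda>C D. rV `` {case (glue_rep C, glue_rep D) of
                 (Inl v, Inl w) \<Rightarrow> Inl (vadd V1 v w)
               | (Inr v, Inr w) \<Rightarrow> Inr (vadd V2 v w)
               | _ \<Rightarrow> undefined}),
       vscale = (\<lambda>c C. rV `` {map_sum (vscale V1 c) (vscale V2 c) (glue_rep C)}),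
       vzero = (\<lambda>x. rV `` {map_sum (vzero V1) (vzero V2) (glue_rep x)})\<rparr>)"


section \<open>Tensor products\<close>

text \<open>The free real vector space on a type: formal finite linear combinations.\<close>

instantiation poly_mapping :: (type, real_vector) real_vector
begin

definition scaleR_poly_mapping :: "real \<Rightarrow> ('a \<Rightarrow>\<^sub>0 'b) \<Rightarrow> 'a \<Rightarrow>\<^sub>0 'b" where
  "scaleR_poly_mapping c p = Poly_Mapping.map ((*\<^sub>R) c) p"

instance
proof
  have lookup_scaleR: "Poly_Mapping.lookup (c *\<^sub>R p) k = c *\<^sub>R Poly_Mapping.lookup p k"
    for c :: real and p :: "'a \<Rightarrow>\<^sub>0 'b" and k
    by (simp add: scaleR_poly_mapping_def Poly_Mapping.map.rep_eq when_def)
  fix a b :: real and x y :: "'a \<Rightarrow>\<^sub>0 'b"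
  show "a *\<^sub>R (x + y) = a *\<^sub>R x + a *\<^sub>R y"
    by (rule poly_mapping_eqI) (simp add: lookup_scaleR lookup_add scaleR_right_distrib)
  show "(a + b) *\<^sub>R x = a *\<^sub>R x + b *\<^sub>R x"
    by (rule poly_mapping_eqI) (simp add: lookup_scaleR lookup_add scaleR_left_distrib)
  show "a *\<^sub>R b *\<^sub>R x = (a * b) *\<^sub>R x"
    by (rule poly_mapping_eqI) (simp add: lookup_scaleR)
  show "1 *\<^sub>R x = x"
    by (rule poly_mapping_eqI) (simp add: lookup_scaleR)
qed

end

abbreviation gen :: "'a \<Rightarrow> ('a \<Rightarrow>\<^sub>0 real)" where
  "gen a \<equiv> Poly_Mapping.single a 1"

definition free_vs :: "'a set \<Rightarrow> ('a \<Rightarrow>\<^sub>0 real) set" where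
  "free_vs A = {p. Poly_Mapping.keys p \<subseteq> A}"

text \<open>The linear map of free vector spaces induced by a map of generators.\<close>

definition free_map :: "('a \<Rightarrow> 'b) \<Rightarrow> ('a \<Rightarrow>\<^sub>0 real) \<Rightarrow> ('b \<Rightarrow>\<^sub>0 real)" where
  "free_map h p = (\<Sum>a\<in>Poly_Mapping.keys p. Poly_Mapping.lookup p a *\<^sub>R gen (h a))"

definition bilinear_relators ::
    "('x, 'v) vbundle \<Rightarrow> ('x, 'w) vbundle \<Rightarrow> 'x \<Rightarrow> ('v \<times> 'w \<Rightarrow>\<^sub>0 real) set" where
  "bilinear_relators V W x =
     {gen (vadd V v v', w) - gen (v, w) - gen (v', w) | v v' w.
        v \<in> points_over V {x} \<and> v' \<in> points_over V {x} \<and> w \<in> points_over W {x}} \<union>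
     {gen (v, vadd W w w') - gen (v, w) - gen (v, w') | v w w'.
        v \<in> points_over V {x} \<and> w \<in> points_over W {x} \<and> w' \<in> points_over W {x}} \<union>
     {gen (vscale V c v, w) - c *\<^sub>R gen (v, w) | c v w. v \<in> points_over V {x} \<and> w \<in> points_over W {x}} \<union>
     {gen (v, vscale W c w) - c *\<^sub>R gen (v, w) | c v w. v \<in> points_over V {x} \<and> w \<in> points_over W {x}}"

definition tensor_rel ::
    "('x, 'v) vbundle \<Rightarrow> ('x, 'w) vbundle \<Rightarrow> 'x \<Rightarrow> (('v \<times> 'w \<Rightarrow>\<^sub>0 real) \<times> ('v \<times> 'w \<Rightarrow>\<^sub>0 real)) set" where
  "tensor_rel V W x =
     {(p, q). p \<in> free_vs (points_over V {x} \<times> points_over W {x}) \<and> q \<in> free_vs (points_over V {x} \<times> points_over W {x}) \<and>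
              p - q \<in> span (bilinear_relators V W x)}"

text \<open>Elements of the tensor product over \<open>x\<close> are tagged with \<open>x\<close>, which makes the union disjoint.\<close>

type_synonym ('x, 'v, 'w) tensor = "'x \<times> ('v \<times> 'w \<Rightarrow>\<^sub>0 real) set"

definition tensor_points ::
    "'x diff_space \<Rightarrow> ('x, 'v) vbundle \<Rightarrow> ('x, 'w) vbundle \<Rightarrow> ('x, 'v, 'w) tensor set" where
  "tensor_points X V W =
     (SIGMA x : carrier X. free_vs (points_over V {x} \<times> points_over W {x}) // tensor_rel V W x)"

definition universal_map ::
    "('x, 'v) vbundle \<Rightarrow> ('x, 'w) vbundle \<Rightarrow> 'v \<times> 'w \<Rightarrow> ('x, 'v, 'w) tensor" where
  "universal_map V W =
     (\<lambda>(v, w). (proj V v, tensor_rel V W (proj V v) `` {gen (v, w)}))"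

text \<open>The algebraic tensor product, carrying an arbitrary total space \<open>T\<close>.\<close>

definition tensor_with ::
    "('x, 'v) vbundle \<Rightarrow> ('x, 'w) vbundle \<Rightarrow> ('x, 'v, 'w) tensor diff_space \<Rightarrow>
     ('x, ('x, 'v, 'w) tensor) vbundle" where
  "tensor_with V W T =
     \<lparr>total = T,
      proj = fst,
      vadd = (\<lambda>(x, C) (_, D). (x, tensor_rel V W x `` {p + q | p q. p \<in> C \<and> q \<in> D})),
      vscale = (\<lambda>c (x, C). (x, tensor_rel V W x `` ((*\<^sub>R) c ` C))),
      vzero = (\<lambda>x. (x, tensor_rel V W x `` {0}))\<rparr>"

text \<open>
  The smallest pseudo-bundle diffeology for which the universal map is smooth, as the
  intersection of all of them.
\<close>

definition tensor_space ::
    "'x diff_space \<Rightarrow> ('x, 'v) vbundle \<Rightarrow> ('x, 'w) vbundle \<Rightarrow> ('x, 'v, 'w) tensor diff_space" where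
  "tensor_space X V W =
     \<lparr>carrier = tensor_points X V W,
      plot = (\<lambda>n U p. \<forall>T. carrier T = tensor_points X V W \<longrightarrow>
                pseudo_bundle X (tensor_with V W T) \<longrightarrow>
                smooth (fibre_product V W) T (universal_map V W) \<longrightarrow> plot T n U p)\<rparr>"

definition tensor_bundle ::
    "'x diff_space \<Rightarrow> ('x, 'v) vbundle \<Rightarrow> ('x, 'w) vbundle \<Rightarrow> ('x, ('x, 'v, 'w) tensor) vbundle" where
  "tensor_bundle X V W = tensor_with V W (tensor_space X V W)"

text \<open>
  The fibrewise tensor product of lifts \<open>h\<close>, \<open>h'\<close> of \<open>f\<close>; \<open>V2\<close> and \<open>V2'\<close> are the pseudo-bundles
  into which \<open>h\<close> and \<open>h'\<close> map.
\<close>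

definition tensor_map ::
    "('x \<Rightarrow> 'y) \<Rightarrow> ('y, 'v2) vbundle \<Rightarrow> ('y, 'w2) vbundle \<Rightarrow> ('v1 \<Rightarrow> 'v2) \<Rightarrow> ('w1 \<Rightarrow> 'w2) \<Rightarrow>
     ('x, 'v1, 'w1) tensor \<Rightarrow> ('y, 'v2, 'w2) tensor" where
  "tensor_map f V2 V2' h h' =
     (\<lambda>(x, C). (f x, tensor_rel V2 V2' (f x) `` (free_map (map_prod h h') ` C)))"

end

theory Submission
  imports Defs
begin

text \<open>
Write \<open>X\<close> for the glued base, \<open>V\<close> and \<open>V'\<close> for the two glued bundles over it. Over a point of
\<open>X1 - Y\<close> the fibres of \<open>V\<close> and \<open>V'\<close> are those of \<open>V1\<close> and \<open>V1'\<close>, and over a point of \<open>X2\<close> they are those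
of \<open>V2\<close> and \<open>V2'\<close>. So both sides of the theorem have the same fibres, and the question is whether the
two diffeologies agree.

The maps of \<open>V1\<close>, \<open>V1'\<close>, \<open>V2\<close> and \<open>V2'\<close> into the glued bundles are smooth and linear on fibres. Their
tensor products send \<open>V1 \<otimes> V1'\<close> and \<open>V2 \<otimes> V2'\<close> smoothly to \<open>V \<otimes> V'\<close>; together they form one map
\<open>\<Phi>\<close> (called \<open>glue_tensors\<close>) on the disjoint union of these two tensor products. It is onto
(\<open>glue_tensors_onto\<close>), and it identifies exactly the points that gluing along \<open>ft \<otimes> ft'\<close> identifies
(\<open>glue_rel_eq_kernel_glue_tensors\<close>). The diffeomorphism \<open>\<Psi>\<close> sends \<open>t\<close> to the class \<open>{s. \<Phi> s = t}\<close>. The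
inverse of \<open>\<Psi>\<close> is smooth because \<open>\<Phi>\<close> is; \<open>\<Psi>\<close> itself is smooth once every plot of \<open>V \<otimes> V'\<close>
lifts locally through \<open>\<Phi>\<close> (\<open>quotient_by_kernel_diffeomorphism\<close>).

For the lifting one has to know the plots of a tensor product, whose diffeology is given only as an
intersection. They are the maps that are locally finite sums \<open>\<Sum>i. q i \<otimes> q' i\<close> with all \<open>q i\<close> and
\<open>q' i\<close> over one plot \<open>r\<close> of the base (\<open>plot_tensor_space_iff\<close>): these maps form a pseudo-bundle diffeology
with smooth universal map, and every other one contains them.

Take such a sum for \<open>V \<otimes> V'\<close>. A plot of a glued space lifts locally to one of the two pieces, but
different factors may lift to different pieces. The base plot decides. If \<open>r\<close> lifts to \<open>X2\<close> near the
given point, a factor that lifts to \<open>V1\<close> lies over \<open>Y\<close>, and \<open>ft\<close> or \<open>ft'\<close> moves it to the second piece.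
If \<open>r\<close> does not lift to \<open>X2\<close> near the point, then it lifts to \<open>X1\<close>, and no factor can lift to the second
piece, since the projection of the lift would be a lift of \<open>r\<close>. The lifted factors lie over one common
plot of \<open>X1\<close>, because the injectivity of \<open>f\<close> makes the map from \<open>X1\<close> to \<open>X\<close> injective. In both cases
the sum of the products of the lifted factors is the required lift.
\<close>

section \<open>Smooth maps and local properties\<close>

lemma Ck_on_const: "Ck_on k n U (\<lambda>x. c)"
proof (induction k arbitrary: c)
  case (Suc k)
  then show ?case by (auto intro!: exI[of _ "\<lambda>x. 0"])
qed simp

lemma continuous_map_Euclidean_coordinate:
  "continuous_map (subtopology (Euclidean_space n) U) euclideanreal (\<lambda>x. x i)"
  unfolding Euclidean_space_def
  by (intro continuous_map_from_subtopology continuous_map_product_projection) simp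

lemma Ck_on_coordinate: "Ck_on k n U (\<lambda>x. x i)"
proof (cases k)
  case (Suc k)
  have "\<exists>g. Ck_on k n U g \<and>
      (\<forall>x\<in>U. ((\<lambda>t. (x(j := t)) i) has_real_derivative g x) (at (x j)))" for j
    by (rule exI[of _ "\<lambda>x. if i = j then 1 else 0"]) (auto simp: Ck_on_const)
  then show ?thesis
    using Suc by (simp add: continuous_map_Euclidean_coordinate)
qed (simp add: continuous_map_Euclidean_coordinate)

lemma Ck_on_subset: "Ck_on k n U f \<Longrightarrow> W \<subseteq> U \<Longrightarrow> Ck_on k n W f"
proof (induction k arbitrary: f)
  case 0
  then show ?case by (auto intro: continuous_map_from_subtopology_mono)
next
  case (Suc k)
  have "\<exists>g. Ck_on k n W g \<and> (\<forall>x\<in>W. ((\<lambda>t. f (x(i := t))) has_real_derivative g x) (at (x i)))"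
    if i: "i < n" for i
  proof -
    obtain g where "Ck_on k n U g"
      "\<forall>x\<in>U. ((\<lambda>t. f (x(i := t))) has_real_derivative g x) (at (x i))"
      using Suc.prems(1) i unfolding Ck_on.simps by blast
    then show ?thesis using Suc.IH[of g] Suc.prems(2) by (intro exI[of _ g]) blast
  qed
  then show ?case
    using Suc.prems continuous_map_from_subtopology_mono by auto
qed

lemma Cinf_on_subset: "Cinf_on n U f \<Longrightarrow> W \<subseteq> U \<Longrightarrow> Cinf_on n W f"
  unfolding Cinf_on_def using Ck_on_subset by blast

lemma Cinf_map_inclusion: "W \<subseteq> U \<Longrightarrow> Cinf_map n W n U (\<lambda>x. x)"
  by (auto simp: Cinf_map_def Cinf_on_def Ck_on_coordinate)

lemma Cinf_map_subset: "Cinf_map m W n U g \<Longrightarrow> W' \<subseteq> W \<Longrightarrow> g ` W' \<subseteq> U' \<Longrightarrow> Cinf_map m W' n U' g"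
  by (auto simp: Cinf_map_def intro: Cinf_on_subset)

text \<open>
Restricting a local property along a smooth change of parameters needs continuity of the latter. The
coordinates are continuous by definition, and the topology of the target is induced from a product.
\<close>

lemma openin_Cinf_map_preimage:
  assumes "Cinf_map m W n U g" "openin (Euclidean_space m) W" "openin (Euclidean_space n) U"
    and N: "openin (Euclidean_space n) N"
  shows "openin (Euclidean_space m) {w \<in> W. g w \<in> N}"
proof -
  have U: "g w \<in> topspace (Euclidean_space n)" if "w \<in> W" for w
    using assms(1) that openin_subset[OF assms(3)] unfolding Cinf_map_def by blast
  have *: "continuous_map (subtopology (Euclidean_space m) W) euclideanreal (\<lambda>x. g x i)" for i
  \<comment> \<open>The coordinates from \<open>n\<close> on are zero, since \<open>g\<close> takes its values in \<open>U\<close>.\<close>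
  proof (cases "i < n")
    case True
    then have "Ck_on 0 m W (\<lambda>x. g x i)"
      using assms(1) unfolding Cinf_map_def Cinf_on_def by blast
    then show ?thesis by simp
  next
    case False
    show ?thesis
      by (rule continuous_map_eq[where f="\<lambda>x. 0"]) (use U False in \<open>auto simp: topspace_Euclidean_space\<close>)
  qed
  have "continuous_map (subtopology (Euclidean_space m) W) (Euclidean_space n) g"
    unfolding Euclidean_space_def[of n] continuous_map_in_subtopology
    using U by (auto simp: continuous_map_componentwise_UNIV * topspace_Euclidean_space)
  from openin_continuous_map_preimage[OF this N]
  have "openin (subtopology (Euclidean_space m) W) {x \<in> topspace (Euclidean_space m) \<inter> W. g x \<in> N}"
    by simp
  then have "openin (Euclidean_space m) {x \<in> topspace (Euclidean_space m) \<inter> W. g x \<in> N}"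
    using assms(2) openin_trans_full by blast
  moreover have "{x \<in> topspace (Euclidean_space m) \<inter> W. g x \<in> N} = {w \<in> W. g w \<in> N}"
    using openin_subset[OF assms(2)] by auto
  ultimately show ?thesis by simp
qed

lemma locally_in_open: "locally_in n U P \<Longrightarrow> openin (Euclidean_space n) U"
  by (simp add: locally_in_def)

lemma locally_inE:
  assumes "locally_in n U P" "u \<in> U"
  obtains N where "openin (Euclidean_space n) N" "u \<in> N" "N \<subseteq> U" "P N"
  using assms unfolding locally_in_def by blast

lemma locally_inI:
  assumes "openin (Euclidean_space n) U"
    and "\<And>u. u \<in> U \<Longrightarrow> \<exists>N. openin (Euclidean_space n) N \<and> u \<in> N \<and> N \<subseteq> U \<and> P N"
  shows "locally_in n U P"
  using assms unfolding locally_in_def by blast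

lemma locally_in_whole: "openin (Euclidean_space n) U \<Longrightarrow> P U \<Longrightarrow> locally_in n U P"
  unfolding locally_in_def by blast

lemma locally_in_mono: "locally_in n U P \<Longrightarrow> (\<And>W. W \<subseteq> U \<Longrightarrow> P W \<Longrightarrow> Q W) \<Longrightarrow> locally_in n U Q"
  unfolding locally_in_def by metis

lemma locally_in_idem: "locally_in n U (\<lambda>W. locally_in n W P) \<Longrightarrow> locally_in n U P"
  unfolding locally_in_def by (meson order.trans)

lemma locally_in_preimage:
  assumes "locally_in n U P" "openin (Euclidean_space m) W" "Cinf_map m W n U g"
    and PQ: "\<And>N N'. P N \<Longrightarrow> N \<subseteq> U \<Longrightarrow> openin (Euclidean_space m) N' \<Longrightarrow> N' \<subseteq> W \<Longrightarrow> Cinf_map m N' n N g \<Longrightarrow> Q N'"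
  shows "locally_in m W Q"
proof (rule locally_inI)
  fix u assume u: "u \<in> W"
  then have "g u \<in> U" using assms(3) by (auto simp: Cinf_map_def)
  from locally_inE[OF assms(1) this] obtain N
    where N: "openin (Euclidean_space n) N" "g u \<in> N" "N \<subseteq> U" "P N" .
  let ?N = "{w \<in> W. g w \<in> N}"
  have op: "openin (Euclidean_space m) ?N"
    using openin_Cinf_map_preimage[OF assms(3,2) locally_in_open[OF assms(1)] N(1)] .
  have "Cinf_map m ?N n N g"
    by (rule Cinf_map_subset[OF assms(3)]) auto
  then have "Q ?N"
    using PQ[OF N(4,3) op] by blast
  then show "\<exists>N. openin (Euclidean_space m) N \<and> u \<in> N \<and> N \<subseteq> W \<and> Q N"
    using op u N(2) by (intro exI[of _ ?N]) auto
qed (fact assms(2))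

text \<open>
Local lifts of the finitely many terms of a sum exist on neighbourhoods that depend on the term; they
restrict to the intersection of these neighbourhoods.
\<close>

lemma finite_common_neighbourhood:
  assumes N: "openin (Euclidean_space n) N" "u \<in> N"
    and loc: "\<And>x. x \<in> set xs \<Longrightarrow> \<exists>M y. openin (Euclidean_space n) M \<and> u \<in> M \<and> M \<subseteq> N \<and> P M x y"
    and restrict: "\<And>M M' x y. P M x y \<Longrightarrow> openin (Euclidean_space n) M' \<Longrightarrow> M' \<subseteq> M \<Longrightarrow> P M' x y"
  shows "\<exists>M ys. openin (Euclidean_space n) M \<and> u \<in> M \<and> M \<subseteq> N \<and> list_all2 (P M) xs ys"
  using loc
proof (induction xs)
  case Nil
  then show ?case using N by (intro exI[of _ N] exI[of _ "[]"]) auto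
next
  case (Cons x xs)
  then obtain M ys where M: "openin (Euclidean_space n) M" "u \<in> M" "M \<subseteq> N" "list_all2 (P M) xs ys"
    by (metis list.set_intros(2))
  obtain M' y where M': "openin (Euclidean_space n) M'" "u \<in> M'" "M' \<subseteq> N" "P M' x y"
    using Cons.prems by (metis list.set_intros(1))
  have op: "openin (Euclidean_space n) (M \<inter> M')" using M(1) M'(1) by (rule openin_Int)
  have "list_all2 (P (M \<inter> M')) (x # xs) (y # ys)"
    using restrict[OF M'(4) op] list_all2_mono[OF M(4), of "P (M \<inter> M')"] restrict[OF _ op] by simp
  then show ?case using op M(2,3) M'(2)
    by (intro exI[of _ "M \<inter> M'"] exI[of _ "y # ys"]) auto
qed

section \<open>Diffeological spaces\<close>

lemma diffeological_spaceI:
  assumes "\<And>n U p. plot X n U p \<Longrightarrow> openin (Euclidean_space n) U"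
    and "\<And>n U p u. plot X n U p \<Longrightarrow> u \<in> U \<Longrightarrow> p u \<in> carrier X"
    and "\<And>n U p q. plot X n U p \<Longrightarrow> (\<And>u. u \<in> U \<Longrightarrow> q u = p u) \<Longrightarrow> plot X n U q"
    and "\<And>n U x. x \<in> carrier X \<Longrightarrow> openin (Euclidean_space n) U \<Longrightarrow> plot X n U (\<lambda>_. x)"
    and "\<And>m W n U p g. plot X n U p \<Longrightarrow> openin (Euclidean_space m) W \<Longrightarrow> Cinf_map m W n U g \<Longrightarrow> plot X m W (p \<circ> g)"
    and "\<And>n U p. locally_in n U (\<lambda>W. plot X n W p) \<Longrightarrow> plot X n U p"
  shows "diffeological_space X"
  unfolding diffeological_space_def
proof (intro conjI allI impI ballI)
  fix n U p assume "plot X n U p"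
  then show "p ` U \<subseteq> carrier X" using assms(2) by blast
next
  fix n U p q assume "plot X n U p" "\<forall>u\<in>U. q u = p u"
  then show "plot X n U q" using assms(3)[of n U p q] by blast
qed (fact assms(1) assms(4-6))+

lemma plot_open:
  assumes "diffeological_space X" "plot X n U p"
  shows "openin (Euclidean_space n) U"
  using assms(1)[unfolded diffeological_space_def, THEN conjunct1, rule_format, OF assms(2)] ..

lemma plot_carrier:
  assumes "diffeological_space X" "plot X n U p" "u \<in> U"
  shows "p u \<in> carrier X"
  using assms(1)[unfolded diffeological_space_def, THEN conjunct1, rule_format, OF assms(2)] assms(3)
  by blast

lemma plot_cong:
  assumes "diffeological_space X" "plot X n U p" "\<And>u. u \<in> U \<Longrightarrow> q u = p u"
  shows "plot X n U q"
  using assms(1)[unfolded diffeological_space_def, THEN conjunct2, THEN conjunct1, rule_format, OF assms(2), of q]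
    assms(3) by simp

lemma plot_const:
  assumes "diffeological_space X" "x \<in> carrier X" "openin (Euclidean_space n) U"
  shows "plot X n U (\<lambda>_. x)"
  using assms(1)[unfolded diffeological_space_def, THEN conjunct2, THEN conjunct2, THEN conjunct1,
    rule_format, OF assms(2,3)] .

lemma plot_compose:
  assumes "diffeological_space X" "plot X n U p" "openin (Euclidean_space m) W" "Cinf_map m W n U g"
  shows "plot X m W (p \<circ> g)"
  using assms(1)[unfolded diffeological_space_def, THEN conjunct2, THEN conjunct2, THEN conjunct2,
    THEN conjunct1, rule_format, OF assms(2-4)] .

lemma plot_local:
  assumes "diffeological_space X" "locally_in n U (\<lambda>W. plot X n W p)"
  shows "plot X n U p"
  using assms(1)[unfolded diffeological_space_def, THEN conjunct2, THEN conjunct2, THEN conjunct2,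
    THEN conjunct2, rule_format, OF assms(2)] .

lemma plot_restrict:
  assumes "diffeological_space X" "plot X n U p" "openin (Euclidean_space n) W" "W \<subseteq> U"
  shows "plot X n W p"
  using plot_compose[OF assms(1-3) Cinf_map_inclusion[OF assms(4)]] by (simp add: comp_def)

lemma smooth_carrier: "smooth X Y f \<Longrightarrow> x \<in> carrier X \<Longrightarrow> f x \<in> carrier Y"
  by (auto simp: smooth_def)

lemma smooth_plot: "smooth X Y f \<Longrightarrow> plot X n U p \<Longrightarrow> plot Y n U (f \<circ> p)"
  by (auto simp: smooth_def)

lemma diffeological_sum_space:
  assumes X: "diffeological_space X" and Y: "diffeological_space Y"
  shows "diffeological_space (sum_space X Y)"
proof -
  define P where "P = (\<lambda>n p W. (\<exists>q. plot X n W q \<and> (\<forall>w\<in>W. p w = Inl (q w))) \<or>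
        (\<exists>q. plot Y n W q \<and> (\<forall>w\<in>W. p w = Inr (q w))))"
  have plot: "plot (sum_space X Y) n U p \<longleftrightarrow> locally_in n U (P n p)" for n U p
    unfolding P_def by (simp add: sum_space_def)
  show ?thesis
  proof (rule diffeological_spaceI; unfold plot)
    fix n U p assume L: "locally_in n U (P n p)"
    then show "openin (Euclidean_space n) U" by (rule locally_in_open)
    fix u assume u: "u \<in> U"
    from locally_inE[OF L u] obtain N where "u \<in> N" "P n p N" by metis
    then show "p u \<in> carrier (sum_space X Y)"
      using plot_carrier[OF X] plot_carrier[OF Y] by (auto simp: P_def sum_space_def)
  next
    fix n U p q assume "locally_in n U (P n p)" "\<And>u. u \<in> U \<Longrightarrow> q u = p u"
    then show "locally_in n U (P n q)"
      by (elim locally_in_mono) (auto simp: P_def subset_iff)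
  next
    fix n U x assume "x \<in> carrier (sum_space X Y)" "openin (Euclidean_space n) U"
    then show "locally_in n U (P n (\<lambda>_. x))"
      using plot_const[OF X, of _ n U] plot_const[OF Y, of _ n U]
      by (intro locally_in_whole) (auto simp: P_def sum_space_def)
  next
    fix m W n U p g assume "locally_in n U (P n p)" "openin (Euclidean_space m) W" "Cinf_map m W n U g"
    then show "locally_in m W (P m (p \<circ> g))"
    proof (rule locally_in_preimage)
      fix N N' assume N: "P n p N" "openin (Euclidean_space m) N'" "Cinf_map m N' n N g"
      then have g: "\<And>w. w \<in> N' \<Longrightarrow> g w \<in> N" by (auto simp: Cinf_map_def)
      from N(1) show "P m (p \<circ> g) N'" unfolding P_def
      proof (elim disjE exE conjE, goal_cases)
        case (1 q)
        then show ?case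
          using plot_compose[OF X _ N(2,3), of q] g by (intro disjI1 exI[of _ "q \<circ> g"]) auto
      next
        case (2 q)
        then show ?case
          using plot_compose[OF Y _ N(2,3), of q] g by (intro disjI2 exI[of _ "q \<circ> g"]) auto
      qed
    qed
  next
    fix n U p assume "locally_in n U (\<lambda>W. locally_in n W (P n p))"
    then show "locally_in n U (P n p)" by (rule locally_in_idem)
  qed
qed

lemma diffeological_quotient_space:
  assumes X: "diffeological_space X"
  shows "diffeological_space (quotient_space X r)"
proof -
  define P where "P = (\<lambda>n p W. \<exists>q. plot X n W q \<and> (\<forall>w\<in>W. p w = r `` {q w}))"
  have plot: "plot (quotient_space X r) n U p \<longleftrightarrow> locally_in n U (P n p)" for n U p
    unfolding P_def by (simp add: quotient_space_def)
  show ?thesis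
  proof (rule diffeological_spaceI; unfold plot)
    fix n U p assume L: "locally_in n U (P n p)"
    then show "openin (Euclidean_space n) U" by (rule locally_in_open)
    fix u assume u: "u \<in> U"
    from locally_inE[OF L u] obtain N where "u \<in> N" "P n p N" by metis
    then show "p u \<in> carrier (quotient_space X r)"
      using plot_carrier[OF X] by (auto simp: P_def quotient_space_def intro!: quotientI)
  next
    fix n U p q assume "locally_in n U (P n p)" "\<And>u. u \<in> U \<Longrightarrow> q u = p u"
    then show "locally_in n U (P n q)"
      by (elim locally_in_mono) (auto simp: P_def subset_iff)
  next
    fix n U x assume "x \<in> carrier (quotient_space X r)" "openin (Euclidean_space n) U"
    then show "locally_in n U (P n (\<lambda>_. x))"
      using plot_const[OF X, of _ n U]
      by (intro locally_in_whole) (auto simp: P_def quotient_space_def elim!: quotientE)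
  next
    fix m W n U p g assume "locally_in n U (P n p)" "openin (Euclidean_space m) W" "Cinf_map m W n U g"
    then show "locally_in m W (P m (p \<circ> g))"
    proof (rule locally_in_preimage)
      fix N N' assume N: "P n p N" "openin (Euclidean_space m) N'" "Cinf_map m N' n N g"
      then have g: "\<And>w. w \<in> N' \<Longrightarrow> g w \<in> N" by (auto simp: Cinf_map_def)
      from N(1) obtain q where "plot X n N q" "\<forall>w\<in>N. p w = r `` {q w}" by (auto simp: P_def)
      then show "P m (p \<circ> g) N'" unfolding P_def
        using plot_compose[OF X _ N(2,3), of q] g by (intro exI[of _ "q \<circ> g"]) auto
    qed
  next
    fix n U p assume "locally_in n U (\<lambda>W. locally_in n W (P n p))"
    then show "locally_in n U (P n p)" by (rule locally_in_idem)
  qed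
qed

text \<open>
A surjective smooth map through which all plots of its target lift locally is a subduction, and a
subduction identifies its target with the quotient of its source by its kernel. The diffeomorphism is
stated from the target to the quotient, where it sends a point to its preimage.
\<close>

lemma quotient_by_kernel_diffeomorphism:
  assumes S: "diffeological_space S" and Z: "diffeological_space Z"
    and smooth: "smooth S Z \<Phi>" and onto: "\<Phi> ` carrier S = carrier Z"
    and lift: "\<And>n U p. plot Z n U p \<Longrightarrow> locally_in n U (\<lambda>N. \<exists>q. plot S n N q \<and> (\<forall>w\<in>N. p w = \<Phi> (q w)))"
    and r: "r = {(s, t). s \<in> carrier S \<and> t \<in> carrier S \<and> \<Phi> s = \<Phi> t}"
  shows "diffeomorphism Z (quotient_space S r) (\<lambda>z. {s \<in> carrier S. \<Phi> s = z})"
proof -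
  let ?\<Psi> = "\<lambda>z. {s \<in> carrier S. \<Phi> s = z}"
  have cls: "r `` {s} = ?\<Psi> (\<Phi> s)" if "s \<in> carrier S" for s
    using that by (auto simp: r)
  have inj: "inj_on ?\<Psi> (carrier Z)"
  proof (rule inj_onI)
    fix z z' assume z: "z \<in> carrier Z" and eq: "?\<Psi> z = ?\<Psi> z'"
    from z obtain s where "s \<in> carrier S" "\<Phi> s = z" unfolding onto[symmetric] by blast
    with eq show "z = z'" by blast
  qed
  have img: "?\<Psi> ` carrier Z = carrier (quotient_space S r)"
  proof -
    have "?\<Psi> ` carrier Z = (\<lambda>s. r `` {s}) ` carrier S"
      unfolding onto[symmetric] image_image using cls by (intro image_cong) auto
    then show ?thesis by (auto simp: quotient_space_def quotient_def)
  qed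
  have inv: "inv_into (carrier Z) ?\<Psi> (r `` {s}) = \<Phi> s" if "s \<in> carrier S" for s
    unfolding cls[OF that] using that onto by (intro inv_into_f_f inj) auto
  have "smooth Z (quotient_space S r) ?\<Psi>"
    unfolding smooth_def
  proof (intro conjI allI impI)
    fix n U p assume "plot Z n U p"
    from lift[OF this]
    have "locally_in n U (\<lambda>N. \<exists>q. plot S n N q \<and> (\<forall>w\<in>N. (?\<Psi> \<circ> p) w = r `` {q w}))"
    proof (rule locally_in_mono, elim exE conjE)
      fix N q assume q: "plot S n N q" "\<forall>w\<in>N. p w = \<Phi> (q w)"
      then show "\<exists>q. plot S n N q \<and> (\<forall>w\<in>N. (?\<Psi> \<circ> p) w = r `` {q w})"
        using cls plot_carrier[OF S q(1)] by (intro exI[of _ q]) simp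
    qed
    then show "plot (quotient_space S r) n U (?\<Psi> \<circ> p)" by (simp add: quotient_space_def)
  qed (simp add: img)
  moreover have "smooth (quotient_space S r) Z (inv_into (carrier Z) ?\<Psi>)"
    unfolding smooth_def
  proof (intro conjI allI impI)
    show "inv_into (carrier Z) ?\<Psi> ` carrier (quotient_space S r) \<subseteq> carrier Z"
      unfolding img[symmetric] by (auto intro: inv_into_into)
    fix n U p assume "plot (quotient_space S r) n U p"
    then have L: "locally_in n U (\<lambda>N. \<exists>q. plot S n N q \<and> (\<forall>w\<in>N. p w = r `` {q w}))"
      by (simp add: quotient_space_def)
    show "plot Z n U (inv_into (carrier Z) ?\<Psi> \<circ> p)"
    proof (rule plot_local[OF Z], rule locally_in_mono[OF L], elim exE conjE)
      fix N q assume q: "plot S n N q" "\<forall>w\<in>N. p w = r `` {q w}"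
      show "plot Z n N (inv_into (carrier Z) ?\<Psi> \<circ> p)"
        by (rule plot_cong[OF Z smooth_plot[OF smooth q(1)]])
          (use q plot_carrier[OF S q(1)] inv in auto)
    qed
  qed
  ultimately show ?thesis
    using inj img by (simp add: diffeomorphism_def bij_betw_def)
qed

section \<open>Closure properties of pseudo-bundles\<close>

text \<open>
The properties on which the local description of tensor product diffeologies rests. The plots of a tensor
product must be stable under multiplication by smooth functions, which is achieved by scaling the first
factors.
\<close>

definition scalable_bundle :: "'x diff_space \<Rightarrow> ('x, 'v) vbundle \<Rightarrow> bool" where
  "scalable_bundle X V \<longleftrightarrow>
     diffeological_space X \<and> diffeological_space (total V) \<and> smooth (total V) X (proj V) \<and>
     (\<forall>c. \<forall>v\<in>carrier (total V). proj V (vscale V c v) = proj V v) \<and>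
     smooth (prod_space real_space (total V)) (total V) (\<lambda>(c, v). vscale V c v)"

lemma scalable_bundle_vscale_closed:
  assumes "scalable_bundle X V" "v \<in> points_over V {x}"
  shows "vscale V c v \<in> points_over V {x}"
proof -
  have s: "smooth (prod_space real_space (total V)) (total V) (\<lambda>(c, v). vscale V c v)"
    using assms by (auto simp: scalable_bundle_def)
  have "vscale V c v \<in> carrier (total V)"
    using smooth_carrier[OF s, of "(c, v)"] assms(2) by (auto simp: prod_space_def real_space_def points_over_def)
  then show ?thesis using assms by (auto simp: scalable_bundle_def points_over_def)
qed

lemma pseudo_bundle_scalable:
  assumes "pseudo_bundle X V"
  shows "scalable_bundle X V"
proof -
  have "proj V (vscale V c v) = proj V v" if v: "v \<in> carrier (total V)" for c v
  proof -
    have "proj V v \<in> carrier X"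
      using assms v smooth_carrier by (auto simp: pseudo_bundle_def)
    then interpret Module.module real_field "fibre V (proj V v)"
      using assms by (auto simp: pseudo_bundle_def)
    have "v \<in> carrier (fibre V (proj V v))"
      using v by (simp add: fibre_def points_over_def)
    then have "c \<odot>\<^bsub>fibre V (proj V v)\<^esub> v \<in> carrier (fibre V (proj V v))"
      by (intro smult_closed) (auto simp: real_field_def)
    then show ?thesis by (simp add: fibre_def points_over_def)
  qed
  then show ?thesis using assms by (auto simp: scalable_bundle_def pseudo_bundle_def)
qed

lemma pseudo_bundle_vadd_closed:
  assumes V: "pseudo_bundle X V" and "v \<in> points_over V {x}" "w \<in> points_over V {x}"
  shows "vadd V v w \<in> points_over V {x}"
proof -
  have "x \<in> carrier X"
    using assms smooth_carrier by (fastforce simp: pseudo_bundle_def points_over_def)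
  then interpret Module.module real_field "fibre V x"
    using V by (auto simp: pseudo_bundle_def)
  show ?thesis
    using M.a_closed[of v w] assms(2,3) by (simp add: fibre_def)
qed

lemma plot_vscale:
  assumes "scalable_bundle X V" and c: "plot real_space n N c" and q: "plot (total V) n N q"
  shows "plot (total V) n N (\<lambda>w. vscale V (c w) (q w))"
proof -
  have s: "smooth (prod_space real_space (total V)) (total V) (\<lambda>(c, v). vscale V c v)"
    using assms(1) by (simp add: scalable_bundle_def)
  have "plot (prod_space real_space (total V)) n N (\<lambda>w. (c w, q w))"
    using c q by (simp add: prod_space_def comp_def)
  from smooth_plot[OF s this] show ?thesis by (simp add: comp_def)
qed

section \<open>The algebraic tensor product\<close>

lemma lookup_scaleR [simp]: "Poly_Mapping.lookup (c *\<^sub>R p) k = c *\<^sub>R Poly_Mapping.lookup p k"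
  by (simp add: scaleR_poly_mapping_def Poly_Mapping.map.rep_eq when_def)

text \<open>
A common finite index set makes the sums for two different elements comparable; this is what proves
linearity.
\<close>

lemma free_map_superset:
  assumes "finite K" "Poly_Mapping.keys p \<subseteq> K"
  shows "free_map h p = (\<Sum>a\<in>K. Poly_Mapping.lookup p a *\<^sub>R gen (h a))"
  unfolding free_map_def using assms by (intro sum.mono_neutral_left) (auto simp: in_keys_iff)

lemma linear_free_map: "linear (free_map h)"
proof
  fix p q :: "'a \<Rightarrow>\<^sub>0 real" and c :: real
  have fin: "finite (Poly_Mapping.keys p \<union> Poly_Mapping.keys q)" by simp
  show "free_map h (p + q) = free_map h p + free_map h q"
    using free_map_superset[OF fin, of p h] free_map_superset[OF fin, of q h]
      free_map_superset[OF fin, of "p + q" h] keys_add[of p q]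
    by (simp add: lookup_add scaleR_left_distrib sum.distrib)
  have "Poly_Mapping.keys (c *\<^sub>R p) \<subseteq> Poly_Mapping.keys p"
    by (auto simp: in_keys_iff)
  then show "free_map h (c *\<^sub>R p) = c *\<^sub>R free_map h p"
    using free_map_superset[of "Poly_Mapping.keys p" "c *\<^sub>R p" h]
    by (simp add: free_map_def[of h p] scaleR_sum_right)
qed

lemmas free_map_add = linear_add[OF linear_free_map]
  and free_map_diff = linear_diff[OF linear_free_map]
  and free_map_scaleR = linear_scale[OF linear_free_map]
  and free_map_sum = linear_sum[OF linear_free_map]
  and free_map_0 = linear_0[OF linear_free_map]

lemma free_map_gen [simp]: "free_map h (gen a) = gen (h a)"
  by (simp add: free_map_def)

lemma free_map_comp: "free_map g (free_map h p) = free_map (g \<circ> h) p"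
  by (simp add: free_map_def[of h p] free_map_def[of "g \<circ> h"] free_map_sum free_map_scaleR)

lemma free_map_cong: "(\<And>a. a \<in> Poly_Mapping.keys p \<Longrightarrow> g a = h a) \<Longrightarrow> free_map g p = free_map h p"
  by (simp add: free_map_def)

lemma sum_gen_keys: "(\<Sum>a\<in>Poly_Mapping.keys p. Poly_Mapping.lookup p a *\<^sub>R gen a) = p"
  by (rule poly_mapping_eqI)
    (auto simp: lookup_sum lookup_single when_def in_keys_iff if_distrib[of "(*) _"] cong: if_cong)

lemma free_map_id: "free_map (\<lambda>a. a) p = p"
  by (simp add: free_map_def sum_gen_keys)

lemma subspace_free_vs: "subspace (free_vs A)"
proof -
  have "free_vs A = {p. \<forall>k. k \<notin> A \<longrightarrow> Poly_Mapping.lookup p k = 0}"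
    by (auto simp: free_vs_def in_keys_iff)
  then show ?thesis by (simp add: subspace_def lookup_add)
qed

lemmas free_vs_add = subspace_add[OF subspace_free_vs]
  and free_vs_scaleR = subspace_scale[OF subspace_free_vs]
  and free_vs_0 = subspace_0[OF subspace_free_vs]

lemma gen_in_free_vs [simp]: "gen a \<in> free_vs A \<longleftrightarrow> a \<in> A"
  by (simp add: free_vs_def)

lemma free_map_in_free_vs:
  assumes "p \<in> free_vs A" "h ` A \<subseteq> B"
  shows "free_map h p \<in> free_vs B"
  unfolding free_map_def using assms
  by (intro subspace_sum[OF subspace_free_vs] free_vs_scaleR) (auto simp: free_vs_def)

lemma sum_list_gen_in_free_vs: "set xs \<subseteq> A \<Longrightarrow> sum_list (map gen xs) \<in> free_vs A"
  by (induction xs) (auto intro: free_vs_add free_vs_0)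

lemma free_map_sum_list_gen: "free_map h (sum_list (map gen xs)) = sum_list (map gen (map h xs))"
  by (induction xs) (auto simp: free_map_add free_map_0)

abbreviation fibre_pairs :: "('x, 'v) vbundle \<Rightarrow> ('x, 'w) vbundle \<Rightarrow> 'x \<Rightarrow> ('v \<times> 'w) set" where
  "fibre_pairs V W x \<equiv> points_over V {x} \<times> points_over W {x}"

text \<open>
The class of a formal combination \<open>p\<close>, that is, the second component of a point of the tensor product.
\<close>

definition tensor_class ::
    "('x, 'v) vbundle \<Rightarrow> ('x, 'w) vbundle \<Rightarrow> 'x \<Rightarrow> ('v \<times> 'w \<Rightarrow>\<^sub>0 real) \<Rightarrow> ('v \<times> 'w \<Rightarrow>\<^sub>0 real) set" where
  "tensor_class V W x p = tensor_rel V W x `` {p}"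

lemma tensor_class_iff:
  assumes "p \<in> free_vs (fibre_pairs V W x)"
  shows "q \<in> tensor_class V W x p \<longleftrightarrow>
    q \<in> free_vs (fibre_pairs V W x) \<and> p - q \<in> span (bilinear_relators V W x)"
  using assms by (simp add: tensor_rel_def tensor_class_def)

lemma tensor_class_eq_iff:
  assumes "p \<in> free_vs (fibre_pairs V W x)" "q \<in> free_vs (fibre_pairs V W x)"
  shows "tensor_class V W x p = tensor_class V W x q \<longleftrightarrow> p - q \<in> span (bilinear_relators V W x)"
proof
  assume "tensor_class V W x p = tensor_class V W x q"
  then have "q \<in> tensor_class V W x p"
    using assms by (simp add: tensor_class_iff span_0)
  then show "p - q \<in> span (bilinear_relators V W x)"
    using assms by (simp add: tensor_class_iff)
next
  assume pq: "p - q \<in> span (bilinear_relators V W x)"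
  have "p - a \<in> span (bilinear_relators V W x) \<longleftrightarrow> q - a \<in> span (bilinear_relators V W x)" for a
    using span_add_eq[OF pq, of "q - a"] by simp
  then show "tensor_class V W x p = tensor_class V W x q"
    unfolding set_eq_iff tensor_class_iff[OF assms(1)] tensor_class_iff[OF assms(2)] by blast
qed

text \<open>
The operations on tensors are defined by applying \<open>tensor_rel\<close> to a set of representatives of the
result. Such a set lies in one class and contains a known representative, so its image is that class.
\<close>

lemma tensor_rel_image_eq:
  assumes p: "p \<in> free_vs (fibre_pairs V W x)"
    and A: "A \<subseteq> tensor_class V W x p" "p \<in> A"
  shows "tensor_rel V W x `` A = tensor_class V W x p"
proof
  show "tensor_class V W x p \<subseteq> tensor_rel V W x `` A"
    unfolding tensor_class_def using A(2) by blast
  show "tensor_rel V W x `` A \<subseteq> tensor_class V W x p"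
  proof
    fix b assume "b \<in> tensor_rel V W x `` A"
    then obtain a where a: "a \<in> A" "(a, b) \<in> tensor_rel V W x" by blast
    then have "p - a \<in> span (bilinear_relators V W x)" "a - b \<in> span (bilinear_relators V W x)"
      "b \<in> free_vs (fibre_pairs V W x)"
      using A(1) tensor_class_iff[OF p] by (auto simp: tensor_rel_def)
    then show "b \<in> tensor_class V W x p"
      using p span_add[of "p - a" _ "a - b"] by (simp add: tensor_class_iff)
  qed
qed

lemma tensor_class_add:
  assumes "p \<in> free_vs (fibre_pairs V W x)" "q \<in> free_vs (fibre_pairs V W x)"
  shows "tensor_rel V W x `` {a + b | a b. a \<in> tensor_class V W x p \<and> b \<in> tensor_class V W x q} =
    tensor_class V W x (p + q)"
proof (rule tensor_rel_image_eq)
  show "{a + b | a b. a \<in> tensor_class V W x p \<and> b \<in> tensor_class V W x q} \<subseteq> tensor_class V W x (p + q)"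
    unfolding tensor_class_iff[OF assms(1)] tensor_class_iff[OF assms(2)]
      tensor_class_iff[OF free_vs_add[OF assms]] subset_iff
  proof (clarify)
    fix a b
    assume "a \<in> free_vs (fibre_pairs V W x)" "p - a \<in> span (bilinear_relators V W x)"
      "b \<in> free_vs (fibre_pairs V W x)" "q - b \<in> span (bilinear_relators V W x)"
    then show "a + b \<in> free_vs (fibre_pairs V W x) \<and> p + q - (a + b) \<in> span (bilinear_relators V W x)"
      using span_add[of "p - a" _ "q - b"] by (auto intro: free_vs_add simp: algebra_simps)
  qed
  show "p + q \<in> {a + b | a b. a \<in> tensor_class V W x p \<and> b \<in> tensor_class V W x q}"
    using assms tensor_class_iff[OF assms(1), of p] tensor_class_iff[OF assms(2), of q]
    by (simp add: span_0) blast
qed (intro free_vs_add assms)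

lemma tensor_class_scaleR:
  assumes "p \<in> free_vs (fibre_pairs V W x)"
  shows "tensor_rel V W x `` ((*\<^sub>R) c ` tensor_class V W x p) = tensor_class V W x (c *\<^sub>R p)"
proof (rule tensor_rel_image_eq)
  show "(*\<^sub>R) c ` tensor_class V W x p \<subseteq> tensor_class V W x (c *\<^sub>R p)"
    unfolding image_subset_iff Ball_def tensor_class_iff[OF assms]
      tensor_class_iff[OF free_vs_scaleR[OF assms]] scaleR_diff_right[symmetric]
    by (auto intro: free_vs_scaleR span_scale)
  show "c *\<^sub>R p \<in> (*\<^sub>R) c ` tensor_class V W x p"
    using assms by (auto simp: tensor_class_iff span_0)
qed (intro free_vs_scaleR assms)

lemma tensor_with_simps [simp]:
  "total (tensor_with V W T) = T"
  "proj (tensor_with V W T) = fst"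
  "vzero (tensor_with V W T) x = (x, tensor_class V W x 0)"
  by (simp_all add: tensor_with_def tensor_class_def)

lemma tensor_with_vadd:
  assumes "p \<in> free_vs (fibre_pairs V W x)" "q \<in> free_vs (fibre_pairs V W x)"
  shows "vadd (tensor_with V W T) (x, tensor_class V W x p) (x, tensor_class V W x q) =
    (x, tensor_class V W x (p + q))"
  by (simp add: tensor_with_def tensor_class_add[OF assms])

lemma tensor_with_vscale:
  assumes "p \<in> free_vs (fibre_pairs V W x)"
  shows "vscale (tensor_with V W T) c (x, tensor_class V W x p) = (x, tensor_class V W x (c *\<^sub>R p))"
  by (simp add: tensor_with_def tensor_class_scaleR[OF assms])

lemma mem_tensor_points_iff:
  "t \<in> tensor_points X V W \<longleftrightarrow>
    (\<exists>x\<in>carrier X. \<exists>p\<in>free_vs (fibre_pairs V W x). t = (x, tensor_class V W x p))"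
  by (auto simp: tensor_points_def quotient_def tensor_class_def)

lemma cring_real_field: "cring real_field"
  by (intro cringI abelian_groupI comm_monoidI)
    (auto simp: real_field_def algebra_simps intro: exI[of _ "- x" for x])

text \<open>
The fibres of \<open>tensor_with\<close> are quotients of a free vector space by the span of the relators, hence
vector spaces whatever the diffeology of the total space.
\<close>

lemma tensor_with_module:
  assumes x: "x \<in> carrier X" and T: "carrier T = tensor_points X V W"
  shows "Module.module real_field (fibre (tensor_with V W T) x)"
proof -
  let ?F = "free_vs (fibre_pairs V W x)" and ?c = "tensor_class V W x" and ?B = "tensor_with V W T"
  have carr: "points_over ?B {x} = (\<lambda>p. (x, ?c p)) ` ?F"
    using x by (auto simp: points_over_def T mem_tensor_points_iff)
  note [simp] = carr tensor_with_vadd tensor_with_vscale free_vs_add free_vs_scaleR free_vs_0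
  have "abelian_group (fibre ?B x)"
  proof (rule abelian_groupI)
    fix a assume "a \<in> carrier (fibre ?B x)"
    then obtain p where p: "p \<in> ?F" "a = (x, ?c p)" by (auto simp: fibre_def)
    have "- 1 *\<^sub>R p \<in> ?F" using p(1) by (rule free_vs_scaleR)
    then show "\<exists>y\<in>carrier (fibre ?B x). y \<oplus>\<^bsub>fibre ?B x\<^esub> a = \<zero>\<^bsub>fibre ?B x\<^esub>"
      using p by (intro bexI[of _ "(x, ?c (- 1 *\<^sub>R p))"]) (simp_all add: fibre_def)
  qed (auto simp: fibre_def add_ac)
  then show ?thesis
    by (intro moduleI cring_real_field)
      (auto simp: fibre_def real_field_def scaleR_left_distrib scaleR_right_distrib)
qed

section \<open>Tensor products of fibrewise linear maps\<close>

text \<open>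
Linearity on a single fibre, with the target fibre named. The maps into a glued bundle go from the
fibre over \<open>x\<close> to the fibre over the class of \<open>x\<close>.
\<close>

definition fibre_linear :: "('x, 'v) vbundle \<Rightarrow> 'x \<Rightarrow> ('y, 'w) vbundle \<Rightarrow> 'y \<Rightarrow> ('v \<Rightarrow> 'w) \<Rightarrow> bool" where
  "fibre_linear V x W y h \<longleftrightarrow> h ` points_over V {x} \<subseteq> points_over W {y} \<and> linear_on_fibres V {x} W h"

text \<open>
A pair of linear maps sends each of the four kinds of relators to a relator of the same kind, so the
induced map of free vector spaces descends to the tensor products.
\<close>

lemma free_map_bilinear_relators:
  assumes "fibre_linear V x V2 y h" "fibre_linear W x W2 y k"
  shows "free_map (map_prod h k) ` bilinear_relators V W x \<subseteq> bilinear_relators V2 W2 y"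
proof -
  have h: "h v \<in> points_over V2 {y}" if "v \<in> points_over V {x}" for v
    using assms that by (auto simp: fibre_linear_def)
  have k: "k v \<in> points_over W2 {y}" if "v \<in> points_over W {x}" for v
    using assms that by (auto simp: fibre_linear_def)
  have lin: "h (vadd V v v') = vadd V2 (h v) (h v')" "h (vscale V c v) = vscale V2 c (h v)"
    if "v \<in> points_over V {x}" "v' \<in> points_over V {x}" for v v' c
    using assms that by (auto simp: fibre_linear_def linear_on_fibres_def)
  have lin': "k (vadd W v v') = vadd W2 (k v) (k v')" "k (vscale W c v) = vscale W2 c (k v)"
    if "v \<in> points_over W {x}" "v' \<in> points_over W {x}" for v v' c
    using assms that by (auto simp: fibre_linear_def linear_on_fibres_def)
  show ?thesis
    unfolding bilinear_relators_def
    apply (intro subsetI)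
    apply (elim imageE UnE CollectE exE conjE)
    subgoal by (intro UnI1 CollectI, simp add: free_map_diff lin) (use h k in blast)
    subgoal by (intro UnI1 UnI2 CollectI, simp add: free_map_diff lin') (use h k in blast)
    subgoal by (intro UnI1 UnI2 CollectI, simp add: free_map_diff free_map_scaleR lin) (use h k in blast)
    subgoal by (intro UnI2 CollectI, simp add: free_map_diff free_map_scaleR lin') (use h k in blast)
    done
qed

lemma free_map_span_relators:
  assumes "fibre_linear V x V2 y h" "fibre_linear W x W2 y k"
    and "p \<in> span (bilinear_relators V W x)"
  shows "free_map (map_prod h k) p \<in> span (bilinear_relators V2 W2 y)"
proof -
  have "free_map (map_prod h k) p \<in> span (free_map (map_prod h k) ` bilinear_relators V W x)"
    using assms(3) by (simp add: linear_span_image[OF linear_free_map])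
  then show ?thesis
    using span_mono[OF free_map_bilinear_relators[OF assms(1,2)]] by blast
qed

lemma fibre_linear_free_vs:
  assumes "fibre_linear V x V2 y h" "fibre_linear W x W2 y k" "p \<in> free_vs (fibre_pairs V W x)"
  shows "free_map (map_prod h k) p \<in> free_vs (fibre_pairs V2 W2 y)"
  using assms by (intro free_map_in_free_vs[OF assms(3)]) (auto simp: fibre_linear_def)

lemma tensor_map_class:
  assumes lin: "fibre_linear V x V2 (f x) h" "fibre_linear W x W2 (f x) k"
    and p: "p \<in> free_vs (fibre_pairs V W x)"
  shows "tensor_map f V2 W2 h k (x, tensor_class V W x p) =
    (f x, tensor_class V2 W2 (f x) (free_map (map_prod h k) p))"
proof -
  let ?m = "free_map (map_prod h k)"
  note fp = fibre_linear_free_vs[OF lin p]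
  have "tensor_rel V2 W2 (f x) `` (?m ` tensor_class V W x p) = tensor_class V2 W2 (f x) (?m p)"
  proof (rule tensor_rel_image_eq[OF fp])
    show "?m ` tensor_class V W x p \<subseteq> tensor_class V2 W2 (f x) (?m p)"
      unfolding image_subset_iff Ball_def tensor_class_iff[OF p] tensor_class_iff[OF fp]
      using fibre_linear_free_vs[OF lin] free_map_span_relators[OF lin]
      by (simp add: free_map_diff[symmetric])
    show "?m p \<in> ?m ` tensor_class V W x p"
      using p by (simp add: tensor_class_iff span_0)
  qed
  then show ?thesis by (simp add: tensor_map_def)
qed

lemma fibre_linear_inverse:
  assumes V: "pseudo_bundle X V" and lin: "fibre_linear V x W y h"
    and bij: "bij_betw h (points_over V {x}) (points_over W {y})"
  shows "fibre_linear W y V x (inv_into (points_over V {x}) h)"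
proof -
  let ?k = "inv_into (points_over V {x}) h"
  have mem: "?k a \<in> points_over V {x}" and inv: "h (?k a) = a" if "a \<in> points_over W {y}" for a
    using that bij by (auto simp: bij_betw_def inv_into_into f_inv_into_f)
  have inv': "?k (h v) = v" if "v \<in> points_over V {x}" for v
    using bij that by (simp add: bij_betw_def)
  have "?k (vadd W a b) = vadd V (?k a) (?k b)" if "a \<in> points_over W {y}" "b \<in> points_over W {y}" for a b
  proof -
    have "vadd W a b = h (vadd V (?k a) (?k b))"
      using lin mem[OF that(1)] mem[OF that(2)] inv that by (simp add: fibre_linear_def linear_on_fibres_def)
    then show ?thesis
      using inv'[OF pseudo_bundle_vadd_closed[OF V mem[OF that(1)] mem[OF that(2)]]] by simp
  qed
  moreover have "?k (vscale W c a) = vscale V c (?k a)" if "a \<in> points_over W {y}" for a c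
  proof -
    have "vscale W c a = h (vscale V c (?k a))"
      using lin mem[OF that] inv that by (simp add: fibre_linear_def linear_on_fibres_def)
    then show ?thesis
      using inv'[OF scalable_bundle_vscale_closed[OF pseudo_bundle_scalable[OF V] mem[OF that]]] by simp
  qed
  ultimately show ?thesis
    using mem by (auto simp: fibre_linear_def linear_on_fibres_def)
qed

definition tensor_fibre :: "('x, 'v) vbundle \<Rightarrow> ('x, 'w) vbundle \<Rightarrow> 'x \<Rightarrow> ('x, 'v, 'w) tensor set" where
  "tensor_fibre V W x = (\<lambda>p. (x, tensor_class V W x p)) ` free_vs (fibre_pairs V W x)"

lemma tensor_points_eq_Union: "tensor_points X V W = (\<Union>x\<in>carrier X. tensor_fibre V W x)"
  unfolding set_eq_iff mem_tensor_points_iff tensor_fibre_def by blast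

lemma fst_tensor_fibre: "t \<in> tensor_fibre V W x \<Longrightarrow> fst t = x"
  by (auto simp: tensor_fibre_def)

lemma tensor_map_fibre:
  assumes lin: "fibre_linear V x V2 (f x) h" "fibre_linear W x W2 (f x) k"
  shows "tensor_map f V2 W2 h k ` tensor_fibre V W x \<subseteq> tensor_fibre V2 W2 (f x)"
  unfolding tensor_fibre_def
proof (rule image_subsetI, elim imageE, simp only:)
  fix p assume p: "p \<in> free_vs (fibre_pairs V W x)"
  show "tensor_map f V2 W2 h k (x, tensor_class V W x p) \<in>
      (\<lambda>p. (f x, tensor_class V2 W2 (f x) p)) ` free_vs (fibre_pairs V2 W2 (f x))"
    unfolding tensor_map_class[of V x V2 f, OF lin p] using fibre_linear_free_vs[OF lin p] by blast
qed

lemma tensor_map_comp: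
  assumes lin: "fibre_linear V x V2 (f x) h" "fibre_linear W x W2 (f x) k"
    and lin': "fibre_linear V2 (f x) V3 (g (f x)) h'" "fibre_linear W2 (f x) W3 (g (f x)) k'"
    and lin'': "fibre_linear V x V3 (e x) h''" "fibre_linear W x W3 (e x) k''"
    and eq: "e x = g (f x)" "\<And>v. v \<in> points_over V {x} \<Longrightarrow> h'' v = h' (h v)"
      "\<And>w. w \<in> points_over W {x} \<Longrightarrow> k'' w = k' (k w)"
    and t: "t \<in> tensor_fibre V W x"
  shows "tensor_map g V3 W3 h' k' (tensor_map f V2 W2 h k t) = tensor_map e V3 W3 h'' k'' t"
proof -
  obtain p where p: "p \<in> free_vs (fibre_pairs V W x)" "t = (x, tensor_class V W x p)"
    using t by (auto simp: tensor_fibre_def)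
  have "free_map (map_prod h' k') (free_map (map_prod h k) p) = free_map (map_prod h'' k'') p"
    unfolding free_map_comp using p(1) eq(2,3) by (intro free_map_cong) (auto simp: free_vs_def)
  then show ?thesis
    unfolding p(2) tensor_map_class[of V x V2 f, OF lin p(1)] tensor_map_class[of V x V3 e, OF lin'' p(1)]
      tensor_map_class[of V2 "f x" V3 g, OF lin' fibre_linear_free_vs[OF lin p(1)]]
    by (simp add: eq(1))
qed

text \<open>
Functoriality: the tensor product of the inverse maps is inverse to the tensor product of the maps. The
inverse maps are linear by \<open>fibre_linear_inverse\<close>.
\<close>

lemma tensor_map_bij:
  assumes V: "pseudo_bundle X V" and W: "pseudo_bundle X W"
    and lin: "fibre_linear V x V2 (f x) h" "fibre_linear W x W2 (f x) k"
    and bij: "bij_betw h (points_over V {x}) (points_over V2 {f x})"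
      "bij_betw k (points_over W {x}) (points_over W2 {f x})"
  shows "bij_betw (tensor_map f V2 W2 h k) (tensor_fibre V W x) (tensor_fibre V2 W2 (f x))"
proof -
  define h' where "h' = inv_into (points_over V {x}) h"
  define k' where "k' = inv_into (points_over W {x}) k"
  have lin': "fibre_linear V2 (f x) V x h'" "fibre_linear W2 (f x) W x k'"
    unfolding h'_def k'_def by (rule fibre_linear_inverse[OF V lin(1) bij(1)] fibre_linear_inverse[OF W lin(2) bij(2)])+
  have inv: "h' (h v) = v" if "v \<in> points_over V {x}" for v
    using that bij(1) by (simp add: h'_def bij_betw_def)
  have inv2: "k' (k v) = v" if "v \<in> points_over W {x}" for v
    using that bij(2) by (simp add: k'_def bij_betw_def)
  have inv3: "h (h' v) = v" if "v \<in> points_over V2 {f x}" for v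
    using that bij(1) by (auto simp: h'_def bij_betw_def f_inv_into_f)
  have inv4: "k (k' v) = v" if "v \<in> points_over W2 {f x}" for v
    using that bij(2) by (auto simp: k'_def bij_betw_def f_inv_into_f)
  let ?F = "\<lambda>p. free_map (map_prod h k) p" and ?G = "\<lambda>p. free_map (map_prod h' k') p"
  have GF: "?G (?F p) = p" if "p \<in> free_vs (fibre_pairs V W x)" for p
  proof -
    have "?G (?F p) = free_map (\<lambda>z. z) p"
      unfolding free_map_comp using that inv inv2 by (intro free_map_cong) (auto simp: free_vs_def)
    then show ?thesis by (simp add: free_map_id)
  qed
  have FG: "?F (?G p) = p" if "p \<in> free_vs (fibre_pairs V2 W2 (f x))" for p
  proof -
    have "?F (?G p) = free_map (\<lambda>z. z) p"
      unfolding free_map_comp using that inv3 inv4 by (intro free_map_cong) (auto simp: free_vs_def)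
    then show ?thesis by (simp add: free_map_id)
  qed
  let ?g = "tensor_map (\<lambda>_. x) V W h' k'"
  have F: "tensor_map f V2 W2 h k (x, tensor_class V W x p) = (f x, tensor_class V2 W2 (f x) (?F p))"
    if "p \<in> free_vs (fibre_pairs V W x)" for p
    using tensor_map_class[of V x V2 f, OF lin that] .
  have G: "?g (f x, tensor_class V2 W2 (f x) p) = (x, tensor_class V W x (?G p))"
    if "p \<in> free_vs (fibre_pairs V2 W2 (f x))" for p
    using tensor_map_class[of V2 "f x" V "\<lambda>_. x", OF lin' that] .
  show ?thesis
  proof (rule bij_betw_byWitness[where f' = ?g])
    show "tensor_map f V2 W2 h k ` tensor_fibre V W x \<subseteq> tensor_fibre V2 W2 (f x)"
      using tensor_map_fibre[of V x V2 f, OF lin] .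
    show "?g ` tensor_fibre V2 W2 (f x) \<subseteq> tensor_fibre V W x"
      using tensor_map_fibre[of V2 "f x" V "\<lambda>_. x", OF lin'] .
    show "\<forall>t\<in>tensor_fibre V W x. ?g (tensor_map f V2 W2 h k t) = t"
      using F G GF fibre_linear_free_vs[OF lin] by (auto simp: tensor_fibre_def)
    show "\<forall>t\<in>tensor_fibre V2 W2 (f x). tensor_map f V2 W2 h k (?g t) = t"
      using F G FG fibre_linear_free_vs[OF lin'] by (auto simp: tensor_fibre_def)
  qed
qed

section \<open>Plots of a tensor product are local sums of tensors\<close>

text \<open>
The factor \<open>c\<close> is moved into the first components: \<open>c *\<^sub>R (\<Sum>i. v i \<otimes> w i) = \<Sum>i. (c *\<^sub>R v i) \<otimes> w i\<close>. This
lets sums without coefficients represent all tensors.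
\<close>

lemma sum_gen_vscale:
  assumes V: "scalable_bundle X V" and vs: "set vs \<subseteq> fibre_pairs V W x"
  shows "tensor_class V W x (sum_list (map gen (map (map_prod (vscale V c) (\<lambda>w. w)) vs))) =
    tensor_class V W x (c *\<^sub>R sum_list (map gen vs))"
proof -
  have closed: "set (map (map_prod (vscale V c) (\<lambda>w. w)) vs) \<subseteq> fibre_pairs V W x"
    using vs scalable_bundle_vscale_closed[OF V] by force
  have "sum_list (map gen (map (map_prod (vscale V c) (\<lambda>w. w)) vs)) - c *\<^sub>R sum_list (map gen vs)
    \<in> span (bilinear_relators V W x)"
    using vs
  proof (induction vs)
    case (Cons a vs)
    obtain v w where a: "a = (v, w)" by (cases a)
    then have "gen (vscale V c v, w) - c *\<^sub>R gen (v, w) \<in> bilinear_relators V W x"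
      using Cons.prems unfolding bilinear_relators_def by auto
    then have "gen (vscale V c v, w) - c *\<^sub>R gen (v, w) \<in> span (bilinear_relators V W x)"
      by (rule span_base)
    from span_add[OF this Cons.IH] show ?case
      using Cons.prems by (simp add: a algebra_simps)
  qed (simp add: span_0)
  then show ?thesis
    using tensor_class_eq_iff[OF sum_list_gen_in_free_vs[OF closed] free_vs_scaleR[OF sum_list_gen_in_free_vs[OF vs]]]
    by simp
qed

text \<open>
Every tensor is a sum of pure tensors, its coefficients being absorbed by the first factors. With such a
sum a constant map becomes a sum of constant plots.
\<close>

lemma tensor_class_as_sum_gen:
  assumes V: "scalable_bundle X V" and p: "p \<in> free_vs (fibre_pairs V W x)"
  obtains vs where "set vs \<subseteq> fibre_pairs V W x"
    "tensor_class V W x p = tensor_class V W x (sum_list (map gen vs))"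
proof -
  have fin: "finite (Poly_Mapping.keys p)" by simp
  have "\<exists>vs. set vs \<subseteq> fibre_pairs V W x \<and>
      tensor_class V W x (\<Sum>a\<in>K. Poly_Mapping.lookup p a *\<^sub>R gen a) = tensor_class V W x (sum_list (map gen vs))"
    if "K \<subseteq> Poly_Mapping.keys p" for K
    using finite_subset[OF that fin] that
  proof (induction K rule: finite_induct)
    case empty
    then show ?case by (intro exI[of _ "[]"]) simp
  next
    case (insert a K)
    let ?s = "\<Sum>a\<in>K. Poly_Mapping.lookup p a *\<^sub>R gen a" and ?c = "Poly_Mapping.lookup p a"
    obtain vs where vs: "set vs \<subseteq> fibre_pairs V W x"
      "tensor_class V W x ?s = tensor_class V W x (sum_list (map gen vs))"
      using insert by auto
    have K: "insert a K \<subseteq> fibre_pairs V W x" using insert.prems p by (auto simp: free_vs_def)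
    then have a: "set [a] \<subseteq> fibre_pairs V W x" by simp
    have s: "?s \<in> free_vs (fibre_pairs V W x)"
      using K by (intro subspace_sum[OF subspace_free_vs] free_vs_scaleR) auto
    define a' where "a' = map_prod (vscale V ?c) (\<lambda>w. w) a"
    have a': "a' \<in> fibre_pairs V W x"
      using a scalable_bundle_vscale_closed[OF V] by (force simp: a'_def)
    have "tensor_class V W x (gen a') = tensor_class V W x (?c *\<^sub>R gen a)"
      using sum_gen_vscale[OF V a, of ?c] by (simp add: a'_def)
    then have "gen a' - ?c *\<^sub>R gen a \<in> span (bilinear_relators V W x)"
      using tensor_class_eq_iff[of "gen a'" V x W "?c *\<^sub>R gen a"] a a'
        free_vs_scaleR[of "gen a" "fibre_pairs V W x" ?c] by simp
    moreover have "sum_list (map gen vs) - ?s \<in> span (bilinear_relators V W x)"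
      using vs tensor_class_eq_iff[OF sum_list_gen_in_free_vs[OF vs(1)] s] by simp
    ultimately have "(gen a' + sum_list (map gen vs)) - (?c *\<^sub>R gen a + ?s) \<in> span (bilinear_relators V W x)"
      using span_add[of "gen a' - ?c *\<^sub>R gen a" _ "sum_list (map gen vs) - ?s"] by (simp add: algebra_simps)
    then have "tensor_class V W x (sum_list (map gen (a' # vs))) = tensor_class V W x (?c *\<^sub>R gen a + ?s)"
      using tensor_class_eq_iff[of "sum_list (map gen (a' # vs))" V x W "?c *\<^sub>R gen a + ?s"]
        sum_list_gen_in_free_vs[of "a' # vs" "fibre_pairs V W x"] vs(1) a a' s
      by (simp add: free_vs_add free_vs_scaleR)
    then show ?case
      using insert.hyps vs(1) a' by (intro exI[of _ "a' # vs"]) simp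
  qed
  from this[of "Poly_Mapping.keys p"] show ?thesis
    using that by (auto simp: sum_gen_keys)
qed

lemma diffeological_fibre_product:
  assumes V: "diffeological_space (total V)" and W: "diffeological_space (total W)"
  shows "diffeological_space (fibre_product V W)"
proof (rule diffeological_spaceI)
  note [simp] = fibre_product_def subset_space_def prod_space_def
  fix n U p assume p: "plot (fibre_product V W) n U p"
  then show "openin (Euclidean_space n) U" using plot_open[OF V] by auto
  {
    fix q assume eq: "\<And>u. u \<in> U \<Longrightarrow> q u = p u"
    show "plot (fibre_product V W) n U q"
      using p plot_cong[OF V, of n U "fst \<circ> p" "fst \<circ> q"] plot_cong[OF W, of n U "snd \<circ> p" "snd \<circ> q"]
      by (auto simp: eq image_subset_iff)
  next
    fix m N g assume "openin (Euclidean_space m) N" and g: "Cinf_map m N n U g"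
    then show "plot (fibre_product V W) m N (p \<circ> g)"
      using p plot_compose[OF V, of n U "fst \<circ> p" m N g] plot_compose[OF W, of n U "snd \<circ> p" m N g]
      by (auto simp: comp_assoc Cinf_map_def)
  }
next
  note [simp] = fibre_product_def subset_space_def prod_space_def
  fix n U p u assume "plot (fibre_product V W) n U p" "u \<in> U"
  then show "p u \<in> carrier (fibre_product V W)" by auto
next
  note [simp] = fibre_product_def subset_space_def prod_space_def
  fix n U x assume "x \<in> carrier (fibre_product V W)" "openin (Euclidean_space n) U"
  then show "plot (fibre_product V W) n U (\<lambda>_. x)"
    using plot_const[OF V] plot_const[OF W] by (auto simp: comp_def)
next
  note [simp] = fibre_product_def subset_space_def prod_space_def
  fix n U p assume L: "locally_in n U (\<lambda>N. plot (fibre_product V W) n N p)"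
  have "plot (total V) n U (fst \<circ> p)"
    by (rule plot_local[OF V locally_in_mono[OF L]]) simp
  moreover have "plot (total W) n U (snd \<circ> p)"
    by (rule plot_local[OF W locally_in_mono[OF L]]) simp
  moreover have "p u \<in> {(v, w). v \<in> carrier (total V) \<and> w \<in> carrier (total W) \<and> proj V v = proj W w}"
    if "u \<in> U" for u
  proof -
    from locally_inE[OF L that] obtain N where "u \<in> N" "plot (fibre_product V W) n N p" by metis
    then show ?thesis by (auto simp: image_subset_iff)
  qed
  ultimately show "plot (fibre_product V W) n U p" by (auto simp: image_subset_iff)
qed

lemma plot_fibre_productI:
  assumes "plot (total V) n U (fst \<circ> p)" "plot (total W) n U (snd \<circ> p)"
    and "diffeological_space (total V)" "diffeological_space (total W)"
    and "\<And>u. u \<in> U \<Longrightarrow> proj V (fst (p u)) = proj W (snd (p u))"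
  shows "plot (fibre_product V W) n U p"
  using assms(1,2,5) plot_carrier[OF assms(3,1)] plot_carrier[OF assms(4,2)]
  by (simp add: fibre_product_def subset_space_def prod_space_def image_subset_iff case_prod_beta)

lemma plot_fibre_productD:
  assumes "plot (fibre_product V W) n U p"
  shows "plot (total V) n U (fst \<circ> p)" "plot (total W) n U (snd \<circ> p)"
    and "u \<in> U \<Longrightarrow> p u \<in> fibre_pairs V W (proj V (fst (p u)))"
  using assms
  by (auto simp: fibre_product_def subset_space_def prod_space_def image_subset_iff case_prod_beta
     points_over_def mem_Times_iff)

text \<open>
The plot \<open>r\<close> of the base is recorded separately because the list may be empty: the zero section over
\<open>r\<close> is the empty sum.
\<close>

definition plots_over ::
    "'x diff_space \<Rightarrow> ('x, 'v) vbundle \<Rightarrow> ('x, 'w) vbundle \<Rightarrow> nat \<Rightarrow> (nat \<Rightarrow> real) set \<Rightarrow>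
     ((nat \<Rightarrow> real) \<Rightarrow> 'x) \<Rightarrow> ((nat \<Rightarrow> real) \<Rightarrow> 'v \<times> 'w) list \<Rightarrow> bool" where
  "plots_over X V W n N r qs \<longleftrightarrow> plot X n N r \<and>
     (\<forall>q\<in>set qs. plot (fibre_product V W) n N q \<and> (\<forall>w\<in>N. proj V (fst (q w)) = r w))"

definition sum_of_tensors_on ::
    "'x diff_space \<Rightarrow> ('x, 'v) vbundle \<Rightarrow> ('x, 'w) vbundle \<Rightarrow> nat \<Rightarrow>
     ((nat \<Rightarrow> real) \<Rightarrow> ('x, 'v, 'w) tensor) \<Rightarrow> (nat \<Rightarrow> real) set \<Rightarrow> bool" where
  "sum_of_tensors_on X V W n p N \<longleftrightarrow>
     (\<exists>r qs. plots_over X V W n N r qs \<and>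
       (\<forall>w\<in>N. p w = (r w, tensor_class V W (r w) (sum_list (map (\<lambda>q. gen (q w)) qs)))))"

lemma sum_of_tensors_onE:
  assumes "sum_of_tensors_on X V W n p N"
  obtains r qs where "plots_over X V W n N r qs"
    "\<forall>w\<in>N. p w = (r w, tensor_class V W (r w) (sum_list (map (\<lambda>q. gen (q w)) qs)))"
  using assms unfolding sum_of_tensors_on_def by blast

lemma plots_overD:
  assumes "plots_over X V W n N r qs"
  shows "plot X n N r"
    and "q \<in> set qs \<Longrightarrow> plot (fibre_product V W) n N q"
    and "q \<in> set qs \<Longrightarrow> w \<in> N \<Longrightarrow> proj V (fst (q w)) = r w"
    and "q \<in> set qs \<Longrightarrow> w \<in> N \<Longrightarrow> q w \<in> fibre_pairs V W (r w)"
  using assms plot_fibre_productD(3)[of V W n N q w] by (auto simp: plots_over_def)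

lemma plots_over_free_vs:
  assumes "plots_over X V W n N r qs" "w \<in> N"
  shows "sum_list (map (\<lambda>q. gen (q w)) qs) \<in> free_vs (fibre_pairs V W (r w))"
proof -
  have "set (map (\<lambda>q. q w) qs) \<subseteq> fibre_pairs V W (r w)"
    using plots_overD(4)[OF assms(1) _ assms(2)] by (simp add: image_subset_iff)
  from sum_list_gen_in_free_vs[OF this] show ?thesis by (simp add: comp_def)
qed

lemma plots_overI:
  assumes "plot X n N r" "\<And>q. q \<in> set qs \<Longrightarrow> plot (fibre_product V W) n N q"
    "\<And>q w. q \<in> set qs \<Longrightarrow> w \<in> N \<Longrightarrow> proj V (fst (q w)) = r w"
  shows "plots_over X V W n N r qs"
  using assms unfolding plots_over_def by simp

lemma sum_of_tensors_onI:
  assumes "plot X n N r" "\<And>q. q \<in> set qs \<Longrightarrow> plot (fibre_product V W) n N q"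
    "\<And>q w. q \<in> set qs \<Longrightarrow> w \<in> N \<Longrightarrow> proj V (fst (q w)) = r w"
    "\<And>w. w \<in> N \<Longrightarrow> p w = (r w, tensor_class V W (r w) (sum_list (map (\<lambda>q. gen (q w)) qs)))"
  shows "sum_of_tensors_on X V W n p N"
proof -
  have "plots_over X V W n N r qs" using assms(1-3) by (rule plots_overI)
  then show ?thesis unfolding sum_of_tensors_on_def using assms(4) by blast
qed

lemma sum_of_tensors_on_carrier:
  assumes "sum_of_tensors_on X V W n p N" "diffeological_space X" "w \<in> N"
  shows "p w \<in> tensor_points X V W"
  using assms(1)
proof (rule sum_of_tensors_onE)
  fix r qs
  assume D: "plots_over X V W n N r qs"
    and p: "\<forall>w\<in>N. p w = (r w, tensor_class V W (r w) (sum_list (map (\<lambda>q. gen (q w)) qs)))"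
  show ?thesis
    unfolding mem_tensor_points_iff p[rule_format, OF assms(3)]
    using plot_carrier[OF assms(2) plots_overD(1)[OF D] assms(3)] plots_over_free_vs[OF D assms(3)] by blast
qed

lemma sum_of_tensors_on_cong:
  assumes "sum_of_tensors_on X V W n p N" "\<And>w. w \<in> N \<Longrightarrow> q w = p w"
  shows "sum_of_tensors_on X V W n q N"
  using assms unfolding sum_of_tensors_on_def by simp

lemma sum_of_tensors_on_compose:
  assumes p: "sum_of_tensors_on X V W n p N"
    and X: "diffeological_space X" and V: "diffeological_space (total V)" and W: "diffeological_space (total W)"
    and N': "openin (Euclidean_space m) N'" and g: "Cinf_map m N' n N g"
  shows "sum_of_tensors_on X V W m (p \<circ> g) N'"
  using p
proof (rule sum_of_tensors_onE)
  fix r qs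
  assume D: "plots_over X V W n N r qs"
    and p: "\<forall>w\<in>N. p w = (r w, tensor_class V W (r w) (sum_list (map (\<lambda>q. gen (q w)) qs)))"
  note r = plots_overD(1)[OF D] and qs = plots_overD(2,3)[OF D]
  have gN: "g w \<in> N" if "w \<in> N'" for w
    using g that by (auto simp: Cinf_map_def)
  show ?thesis
  proof (rule sum_of_tensors_onI)
    show "plot X m N' (r \<circ> g)" by (rule plot_compose[OF X r N' g])
    show "(p \<circ> g) w = ((r \<circ> g) w, tensor_class V W ((r \<circ> g) w)
        (sum_list (map (\<lambda>q. gen (q w)) (map (\<lambda>q. q \<circ> g) qs))))" if "w \<in> N'" for w
      using p gN[OF that] by (simp add: comp_def)
  next
    fix q assume "q \<in> set (map (\<lambda>q. q \<circ> g) qs)"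
    then obtain q' where q': "q' \<in> set qs" "q = q' \<circ> g" by auto
    show "plot (fibre_product V W) m N' q"
      unfolding q'(2) using plot_compose[OF diffeological_fibre_product[OF V W] qs(1)[OF q'(1)] N' g] .
    show "proj V (fst (q w)) = (r \<circ> g) w" if "w \<in> N'" for w
      using qs(2)[OF q'(1) gN[OF that]] q'(2) by simp
  qed
qed

lemma sum_of_tensors_on_restrict:
  assumes "sum_of_tensors_on X V W n p N"
    and "diffeological_space X" "diffeological_space (total V)" "diffeological_space (total W)"
    and "openin (Euclidean_space n) N'" "N' \<subseteq> N"
  shows "sum_of_tensors_on X V W n p N'"
  using sum_of_tensors_on_compose[OF assms(1-5) Cinf_map_inclusion[OF assms(6)]] by (simp add: comp_def)

text \<open>
The candidate for the tensor product diffeology, to be shown equal to it.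
\<close>

definition tensor_sum_space ::
    "'x diff_space \<Rightarrow> ('x, 'v) vbundle \<Rightarrow> ('x, 'w) vbundle \<Rightarrow> ('x, 'v, 'w) tensor diff_space" where
  "tensor_sum_space X V W =
     \<lparr>carrier = tensor_points X V W, plot = (\<lambda>n U p. locally_in n U (sum_of_tensors_on X V W n p))\<rparr>"

lemma tensor_sum_space_simps [simp]:
  "carrier (tensor_sum_space X V W) = tensor_points X V W"
  "plot (tensor_sum_space X V W) n U p \<longleftrightarrow> locally_in n U (sum_of_tensors_on X V W n p)"
  by (simp_all add: tensor_sum_space_def)

context
  fixes X :: "'x diff_space" and V :: "('x, 'v) vbundle" and W :: "('x, 'w) vbundle"
  assumes V: "scalable_bundle X V" and W: "scalable_bundle X W"
begin

lemma X_diffeological: "diffeological_space X"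
  and V_diffeological: "diffeological_space (total V)"
  and W_diffeological: "diffeological_space (total W)"
  and V_proj: "smooth (total V) X (proj V)"
  and V_scale_proj: "v \<in> carrier (total V) \<Longrightarrow> proj V (vscale V c v) = proj V v"
  using V W by (auto simp: scalable_bundle_def)

lemma diffeological_tensor_sum_space: "diffeological_space (tensor_sum_space X V W)"
proof (rule diffeological_spaceI; unfold tensor_sum_space_simps)
  fix n U p u assume L: "locally_in n U (sum_of_tensors_on X V W n p)" "u \<in> U"
  from locally_inE[OF this] obtain N
    where "openin (Euclidean_space n) N" "u \<in> N" "N \<subseteq> U" "sum_of_tensors_on X V W n p N" .
  then show "p u \<in> tensor_points X V W"
    using sum_of_tensors_on_carrier[OF _ X_diffeological] by blast
next
  fix n U p q assume "locally_in n U (sum_of_tensors_on X V W n p)" and eq: "\<And>u. u \<in> U \<Longrightarrow> q u = p u"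
  then show "locally_in n U (sum_of_tensors_on X V W n q)"
    using sum_of_tensors_on_cong[of X V W n p _ q]
    by (elim locally_in_mono) (auto simp: subset_iff)
next
  fix n U t assume "t \<in> tensor_points X V W" and U: "openin (Euclidean_space n) U"
  then obtain x p where x: "x \<in> carrier X" and p: "p \<in> free_vs (fibre_pairs V W x)"
    and t: "t = (x, tensor_class V W x p)"
    by (auto simp: mem_tensor_points_iff)
  from tensor_class_as_sum_gen[OF V p] obtain vs where vs: "set vs \<subseteq> fibre_pairs V W x"
    "tensor_class V W x p = tensor_class V W x (sum_list (map gen vs))" .
  have "sum_of_tensors_on X V W n (\<lambda>_. t) U"
  proof (rule sum_of_tensors_onI)
    show "plot X n U (\<lambda>_. x)" by (rule plot_const[OF X_diffeological x U])
    show "t = (x, tensor_class V W x (sum_list (map (\<lambda>q. gen (q w)) (map (\<lambda>v _. v) vs))))" for w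
      using vs(2) t by (simp add: comp_def)
  next
    fix q assume "q \<in> set (map (\<lambda>v (_ :: nat \<Rightarrow> real). v) vs)"
    then obtain v where v: "v \<in> set vs" "q = (\<lambda>_. v)" by auto
    then have "v \<in> carrier (fibre_product V W)" "proj V (fst v) = x"
      using vs(1) by (auto simp: fibre_product_def subset_space_def points_over_def)
    then show "plot (fibre_product V W) n U q" "\<And>w. proj V (fst (q w)) = x"
      using plot_const[OF diffeological_fibre_product[OF V_diffeological W_diffeological] _ U] v(2) by auto
  qed
  then show "locally_in n U (sum_of_tensors_on X V W n (\<lambda>_. t))"
    using U by (rule locally_in_whole[rotated])
next
  fix m W' n U p g
  assume "locally_in n U (sum_of_tensors_on X V W n p)" "openin (Euclidean_space m) W'" "Cinf_map m W' n U g"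
  then show "locally_in m W' (sum_of_tensors_on X V W m (p \<circ> g))"
    using sum_of_tensors_on_compose[OF _ X_diffeological V_diffeological W_diffeological]
    by (rule locally_in_preimage)
qed (fact locally_in_open locally_in_idem)+

text \<open>
Concatenating the two lists of plots adds the tensors. Both lists lie over the same plot of the base,
since the two tensors do.
\<close>

lemma sum_of_tensors_on_add:
  assumes p: "sum_of_tensors_on X V W n p N" and q: "sum_of_tensors_on X V W n q N"
    and pq: "\<And>w. w \<in> N \<Longrightarrow> fst (p w) = fst (q w)"
  shows "sum_of_tensors_on X V W n (\<lambda>w. vadd (tensor_with V W T) (p w) (q w)) N"
proof -
  obtain r ps where D: "plots_over X V W n N r ps"
    and p: "\<forall>w\<in>N. p w = (r w, tensor_class V W (r w) (sum_list (map (\<lambda>q. gen (q w)) ps)))"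
    by (rule sum_of_tensors_onE[OF p])
  note r = plots_overD(1)[OF D] and ps = plots_overD(2,3)[OF D] and pfree = plots_over_free_vs[OF D]
  obtain r' qs where D': "plots_over X V W n N r' qs"
    and q: "\<forall>w\<in>N. q w = (r' w, tensor_class V W (r' w) (sum_list (map (\<lambda>q. gen (q w)) qs)))"
    by (rule sum_of_tensors_onE[OF q])
  note r' = plots_overD(1)[OF D'] and qs = plots_overD(2,3)[OF D'] and qfree = plots_over_free_vs[OF D']
  have rr': "r' w = r w" if "w \<in> N" for w
    using pq[OF that] p q that by simp
  show ?thesis
  proof (rule sum_of_tensors_onI[OF r, of "ps @ qs"])
    show "plot (fibre_product V W) n N q" if "q \<in> set (ps @ qs)" for q
      using ps(1) qs(1) that by auto
    show "proj V (fst (q w)) = r w" if "q \<in> set (ps @ qs)" "w \<in> N" for q w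
      using ps(2) qs(2) rr' that by auto
    show "vadd (tensor_with V W T) (p w) (q w) =
        (r w, tensor_class V W (r w) (sum_list (map (\<lambda>q. gen (q w)) (ps @ qs))))" if "w \<in> N" for w
      unfolding p[rule_format, OF that] q[rule_format, OF that] rr'[OF that]
      using tensor_with_vadd[OF pfree[OF that] qfree[OF that, unfolded rr'[OF that]]] by simp
  qed
qed

lemma sum_of_tensors_on_scale:
  assumes p: "sum_of_tensors_on X V W n p N" and c: "plot real_space n N c"
  shows "sum_of_tensors_on X V W n (\<lambda>w. vscale (tensor_with V W T) (c w) (p w)) N"
proof -
  obtain r ps where D: "plots_over X V W n N r ps"
    and p: "\<forall>w\<in>N. p w = (r w, tensor_class V W (r w) (sum_list (map (\<lambda>q. gen (q w)) ps)))"
    by (rule sum_of_tensors_onE[OF p])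
  note r = plots_overD(1)[OF D] and ps = plots_overD(2,3)[OF D] and pfree = plots_over_free_vs[OF D]
  let ?s = "\<lambda>q w. map_prod (vscale V (c w)) (\<lambda>v. v) (q w)"
  show ?thesis
  proof (rule sum_of_tensors_onI[OF r, of "map ?s ps"])
    show "vscale (tensor_with V W T) (c w) (p w) =
        (r w, tensor_class V W (r w) (sum_list (map (\<lambda>q. gen (q w)) (map ?s ps))))" if "w \<in> N" for w
      unfolding p[rule_format, OF that] tensor_with_vscale[OF pfree[OF that]]
      using sum_gen_vscale[OF V, of "map (\<lambda>q. q w) ps" "r w" W "c w"] plots_overD(4)[OF D _ that]
      by (simp add: comp_def image_subset_iff)
  next
    fix q assume "q \<in> set (map ?s ps)"
    then obtain q' where q': "q' \<in> set ps" "q = ?s q'" by auto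
    note fq' = plot_fibre_productD[OF ps(1)[OF q'(1)]]
    show proj: "proj V (fst (q w)) = r w" if "w \<in> N" for w
      using ps(2)[OF q'(1) that] V_scale_proj plot_carrier[OF V_diffeological fq'(1) that] q'(2) by simp
    show "plot (fibre_product V W) n N q"
    proof (rule plot_fibre_productI[OF _ _ V_diffeological W_diffeological])
      show "plot (total V) n N (fst \<circ> q)"
        using plot_vscale[OF V c fq'(1)] by (simp add: q'(2) comp_def)
      show "plot (total W) n N (snd \<circ> q)"
        using fq'(2) by (simp add: q'(2) comp_def)
      show "proj V (fst (q w)) = proj W (snd (q w))" if "w \<in> N" for w
        using proj[OF that] ps(2)[OF q'(1) that] fq'(3)[OF that] q'(2) by (auto simp: points_over_def mem_Times_iff)
    qed
  qed
qed

lemma pseudo_bundle_tensor_sum_space: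
  "pseudo_bundle X (tensor_with V W (tensor_sum_space X V W))"
proof -
  let ?T = "tensor_sum_space X V W"
  let ?B = "tensor_with V W ?T"
  note XVW = X_diffeological V_diffeological W_diffeological
  have fst: "smooth ?T X fst"
    unfolding smooth_def
  proof (intro conjI allI impI)
    show "fst ` carrier ?T \<subseteq> carrier X" by (auto simp: mem_tensor_points_iff)
    fix n U p assume "plot ?T n U p"
    then have L: "locally_in n U (sum_of_tensors_on X V W n p)" by simp
    show "plot X n U (fst \<circ> p)"
    proof (rule plot_local[OF X_diffeological locally_in_mono[OF L]])
      fix N assume "sum_of_tensors_on X V W n p N"
      then show "plot X n N (fst \<circ> p)"
      proof (rule sum_of_tensors_onE)
        fix r qs assume D: "plots_over X V W n N r qs"
          and p: "\<forall>w\<in>N. p w = (r w, tensor_class V W (r w) (sum_list (map (\<lambda>q. gen (q w)) qs)))"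
        show ?thesis
          by (rule plot_cong[OF X_diffeological plots_overD(1)[OF D]]) (simp add: p)
      qed
    qed
  qed
  have zero_mem: "(x, tensor_class V W x 0) \<in> tensor_points X V W" if "x \<in> carrier X" for x
    unfolding mem_tensor_points_iff using that free_vs_0 by blast
  have onto: "fst ` tensor_points X V W = carrier X"
    using zero_mem by (force simp: mem_tensor_points_iff)
  have zero: "smooth X ?T (vzero ?B)"
    unfolding smooth_def
  proof (intro conjI allI impI)
    show "vzero ?B ` carrier X \<subseteq> carrier ?T" using zero_mem by auto
    fix n U r assume r: "plot X n U r"
    have "sum_of_tensors_on X V W n (vzero ?B \<circ> r) U"
      by (rule sum_of_tensors_onI[OF r, of "[]"]) auto
    then show "plot ?T n U (vzero ?B \<circ> r)"
      using locally_in_whole[of n U] plot_open[OF X_diffeological r] by simp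
  qed
  have add: "smooth (fibre_product ?B ?B) ?T (\<lambda>(v, w). vadd ?B v w)"
    unfolding smooth_def
  proof (intro conjI allI impI)
    show "(\<lambda>(v, w). vadd ?B v w) ` carrier (fibre_product ?B ?B) \<subseteq> carrier ?T"
    proof (rule image_subsetI, split prod.split, intro allI impI)
      fix z a b assume "z \<in> carrier (fibre_product ?B ?B)" "z = (a, b)"
      then have "(a, b) \<in> carrier (fibre_product ?B ?B)" by simp
      then have ab: "a \<in> tensor_points X V W" "b \<in> tensor_points X V W" "fst a = fst b"
        by (simp_all add: fibre_product_def subset_space_def)
      obtain x p where x: "x \<in> carrier X" and p: "p \<in> free_vs (fibre_pairs V W x)"
        and a: "a = (x, tensor_class V W x p)"
        using ab(1) unfolding mem_tensor_points_iff by blast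
      obtain q where q: "q \<in> free_vs (fibre_pairs V W x)" and b: "b = (x, tensor_class V W x q)"
        using ab(2,3) a unfolding mem_tensor_points_iff by fastforce
      show "vadd ?B a b \<in> carrier ?T"
        unfolding tensor_sum_space_simps mem_tensor_points_iff a b tensor_with_vadd[OF p q]
        using x free_vs_add[OF p q] by blast
    qed
    fix n U p assume p: "plot (fibre_product ?B ?B) n U p"
    then have L: "locally_in n U (sum_of_tensors_on X V W n (fst \<circ> p))"
        "locally_in n U (sum_of_tensors_on X V W n (snd \<circ> p))"
      and eq: "\<And>u. u \<in> U \<Longrightarrow> fst (fst (p u)) = fst (snd (p u))"
      by (auto simp: fibre_product_def subset_space_def prod_space_def image_subset_iff case_prod_beta)
    have "locally_in n U (sum_of_tensors_on X V W n (\<lambda>w. vadd ?B (fst (p w)) (snd (p w))))"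
    proof (rule locally_inI[OF locally_in_open[OF L(1)]])
      fix u assume u: "u \<in> U"
      from locally_inE[OF L(1) u] obtain N
        where N: "openin (Euclidean_space n) N" "u \<in> N" "N \<subseteq> U" "sum_of_tensors_on X V W n (fst \<circ> p) N" .
      from locally_inE[OF L(2) u] obtain M
        where M: "openin (Euclidean_space n) M" "u \<in> M" "M \<subseteq> U" "sum_of_tensors_on X V W n (snd \<circ> p) M" .
      have op: "openin (Euclidean_space n) (N \<inter> M)" using N(1) M(1) by (rule openin_Int)
      have "sum_of_tensors_on X V W n (\<lambda>w. vadd ?B ((fst \<circ> p) w) ((snd \<circ> p) w)) (N \<inter> M)"
        by (rule sum_of_tensors_on_add[OF sum_of_tensors_on_restrict[OF N(4) XVW op]
              sum_of_tensors_on_restrict[OF M(4) XVW op]]) (use eq N(3) in auto)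
      then show "\<exists>N. openin (Euclidean_space n) N \<and> u \<in> N \<and> N \<subseteq> U \<and>
          sum_of_tensors_on X V W n (\<lambda>w. vadd ?B (fst (p w)) (snd (p w))) N"
        using op N(2,3) M(2) by (intro exI[of _ "N \<inter> M"]) (auto simp: comp_def)
    qed
    then show "plot ?T n U ((\<lambda>(v, w). vadd ?B v w) \<circ> p)" by (simp add: comp_def case_prod_beta)
  qed
  have scale: "smooth (prod_space real_space ?T) ?T (\<lambda>(c, v). vscale ?B c v)"
    unfolding smooth_def
  proof (intro conjI allI impI)
    show "(\<lambda>(c, v). vscale ?B c v) ` carrier (prod_space real_space ?T) \<subseteq> carrier ?T"
    proof (rule image_subsetI, split prod.split, intro allI impI)
      fix z c a assume "z \<in> carrier (prod_space real_space ?T)" "z = (c, a)"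
      then have "(c, a) \<in> carrier (prod_space real_space ?T)" by simp
      then obtain x p where x: "x \<in> carrier X" and p: "p \<in> free_vs (fibre_pairs V W x)"
        and a: "a = (x, tensor_class V W x p)"
        by (auto simp: prod_space_def mem_tensor_points_iff)
      then show "vscale ?B c a \<in> carrier ?T"
        unfolding tensor_sum_space_simps mem_tensor_points_iff a tensor_with_vscale[OF p]
        using x free_vs_scaleR[OF p] by blast
    qed
    fix n U p assume p: "plot (prod_space real_space ?T) n U p"
    then have c: "Cinf_on n U (fst \<circ> p)" and L: "locally_in n U (sum_of_tensors_on X V W n (snd \<circ> p))"
      by (auto simp: prod_space_def real_space_def)
    have "locally_in n U (sum_of_tensors_on X V W n (\<lambda>w. vscale ?B (fst (p w)) (snd (p w))))"
    proof (rule locally_inI[OF locally_in_open[OF L]])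
      fix u assume u: "u \<in> U"
      from locally_inE[OF L u] obtain N
        where N: "openin (Euclidean_space n) N" "u \<in> N" "N \<subseteq> U" "sum_of_tensors_on X V W n (snd \<circ> p) N" .
      have "plot real_space n N (fst \<circ> p)"
        using Cinf_on_subset[OF c N(3)] N(1) by (simp add: real_space_def)
      from sum_of_tensors_on_scale[OF N(4) this]
      show "\<exists>N. openin (Euclidean_space n) N \<and> u \<in> N \<and> N \<subseteq> U \<and>
          sum_of_tensors_on X V W n (\<lambda>w. vscale ?B (fst (p w)) (snd (p w))) N"
        using N(1-3) by (intro exI[of _ N]) (auto simp: comp_def)
    qed
    then show "plot ?T n U ((\<lambda>(c, v). vscale ?B c v) \<circ> p)" by (simp add: comp_def case_prod_beta)
  qed
  show ?thesis
    unfolding pseudo_bundle_def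
    using X_diffeological diffeological_tensor_sum_space fst onto zero add scale
      tensor_with_module[of _ X ?T V W] by simp
qed

lemma universal_map_eq:
  "universal_map V W z = (proj V (fst z), tensor_class V W (proj V (fst z)) (gen z))"
  by (simp add: universal_map_def tensor_class_def case_prod_beta)

lemma smooth_universal_map: "smooth (fibre_product V W) (tensor_sum_space X V W) (universal_map V W)"
  unfolding smooth_def
proof (intro conjI allI impI)
  show "universal_map V W ` carrier (fibre_product V W) \<subseteq> carrier (tensor_sum_space X V W)"
  proof
    fix t assume "t \<in> universal_map V W ` carrier (fibre_product V W)"
    then obtain z where z: "z \<in> carrier (fibre_product V W)" "t = universal_map V W z" by blast
    have "proj V (fst z) \<in> carrier X" "gen z \<in> free_vs (fibre_pairs V W (proj V (fst z)))"
      using z(1) smooth_carrier[OF V_proj, of "fst z"]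
      by (auto simp: fibre_product_def subset_space_def points_over_def)
    then show "t \<in> carrier (tensor_sum_space X V W)"
      unfolding z(2) universal_map_eq tensor_sum_space_simps mem_tensor_points_iff by blast
  qed
  fix n U p assume p: "plot (fibre_product V W) n U p"
  have "plot X n U (proj V \<circ> (fst \<circ> p))"
    by (rule smooth_plot[OF V_proj plot_fibre_productD(1)[OF p]])
  then have "sum_of_tensors_on X V W n (universal_map V W \<circ> p) U"
    by (rule sum_of_tensors_onI[of _ _ _ _ "[p]"]) (use p in \<open>auto simp: universal_map_eq\<close>)
  then show "plot (tensor_sum_space X V W) n U (universal_map V W \<circ> p)"
    using locally_in_whole[of n U] plot_open[OF diffeological_fibre_product[OF V_diffeological W_diffeological] p]
    by simp
qed

text \<open>
Minimality: in any admissible diffeology the zero section and the images of plots under the universal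
map are plots, and addition is smooth, so every finite sum is a plot by induction on its length.
\<close>

lemma plot_of_sum_of_tensors_on:
  assumes T: "carrier T = tensor_points X V W" "pseudo_bundle X (tensor_with V W T)"
    "smooth (fibre_product V W) T (universal_map V W)"
    and p: "sum_of_tensors_on X V W n p N"
  shows "plot T n N p"
proof -
  let ?B = "tensor_with V W T"
  have dT: "diffeological_space T" and zero: "smooth X T (vzero ?B)"
    and add: "smooth (fibre_product ?B ?B) T (\<lambda>(v, w). vadd ?B v w)"
    using T(2) by (auto simp: pseudo_bundle_def)
  obtain r qs where D: "plots_over X V W n N r qs"
    and p: "\<forall>w\<in>N. p w = (r w, tensor_class V W (r w) (sum_list (map (\<lambda>q. gen (q w)) qs)))"
    by (rule sum_of_tensors_onE[OF p])
  note r = plots_overD(1)[OF D] and qs = plots_overD(2,3)[OF D] and pfree = plots_over_free_vs[OF D]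
  have "plot T n N (\<lambda>w. (r w, tensor_class V W (r w) (sum_list (map (\<lambda>q. gen (q w)) qs))))"
    using qs
  proof (induction qs)
    case Nil
    show ?case using smooth_plot[OF zero r] by (simp add: comp_def)
  next
    case (Cons q qs)
    let ?s = "\<lambda>w. sum_list (map (\<lambda>q. gen (q w)) qs)"
    have IH: "plot T n N (\<lambda>w. (r w, tensor_class V W (r w) (?s w)))"
      using Cons by auto
    have q: "plot (fibre_product V W) n N q" "\<And>w. w \<in> N \<Longrightarrow> proj V (fst (q w)) = r w"
      using Cons.prems by auto
    have uq: "plot T n N (universal_map V W \<circ> q)" by (rule smooth_plot[OF T(3) q(1)])
    have "plot (fibre_product ?B ?B) n N (\<lambda>w. (universal_map V W (q w), (r w, tensor_class V W (r w) (?s w))))"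
      by (rule plot_fibre_productI) (use uq IH dT q(2) in \<open>auto simp: comp_def universal_map_eq\<close>)
    from smooth_plot[OF add this]
    have *: "plot T n N (\<lambda>w. vadd ?B (universal_map V W (q w)) (r w, tensor_class V W (r w) (?s w)))"
      by (simp add: comp_def)
    show ?case
    proof (rule plot_cong[OF dT *])
      fix w assume w: "w \<in> N"
      have "set (map (\<lambda>q. q w) qs) \<subseteq> fibre_pairs V W (r w)"
        using plot_fibre_productD(3)[of V W n N _ w] Cons.prems w by fastforce
      from sum_list_gen_in_free_vs[OF this]
      have s: "?s w \<in> free_vs (fibre_pairs V W (r w))" by (simp add: comp_def)
      have g: "gen (q w) \<in> free_vs (fibre_pairs V W (r w))"
        using plot_fibre_productD(3)[OF q(1) w] q(2)[OF w] by simp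
      show "(r w, tensor_class V W (r w) (sum_list (map (\<lambda>q. gen (q w)) (q # qs)))) =
          vadd ?B (universal_map V W (q w)) (r w, tensor_class V W (r w) (?s w))"
        using tensor_with_vadd[OF g s] q(2)[OF w] by (simp add: universal_map_eq)
    qed
  qed
  then show ?thesis by (rule plot_cong[OF dT]) (use p in auto)
qed

theorem plot_tensor_space_iff:
  "plot (tensor_space X V W) n U p \<longleftrightarrow> locally_in n U (sum_of_tensors_on X V W n p)"
proof
  assume "plot (tensor_space X V W) n U p"
  then have "plot (tensor_sum_space X V W) n U p"
    unfolding tensor_space_def diff_space.simps
    using pseudo_bundle_tensor_sum_space smooth_universal_map tensor_sum_space_simps(1) by metis
  then show "locally_in n U (sum_of_tensors_on X V W n p)" by simp
next
  assume L: "locally_in n U (sum_of_tensors_on X V W n p)"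
  have "plot T n U p" if "carrier T = tensor_points X V W" "pseudo_bundle X (tensor_with V W T)"
    "smooth (fibre_product V W) T (universal_map V W)" for T
  proof (rule plot_local)
    show "diffeological_space T" using that(2) by (simp add: pseudo_bundle_def)
    show "locally_in n U (\<lambda>N. plot T n N p)"
      by (rule locally_in_mono[OF L]) (rule plot_of_sum_of_tensors_on[OF that])
  qed
  then show "plot (tensor_space X V W) n U p" by (simp add: tensor_space_def)
qed

lemma tensor_space_eq: "tensor_space X V W = tensor_sum_space X V W"
proof -
  have "plot (tensor_space X V W) = plot (tensor_sum_space X V W)"
    by (intro ext) (simp add: plot_tensor_space_iff)
  then show ?thesis by (simp add: tensor_space_def tensor_sum_space_def)
qed

end

lemma diffeological_tensor_space:
  assumes "scalable_bundle X V" "scalable_bundle X W"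
  shows "diffeological_space (tensor_space X V W)"
  using diffeological_tensor_sum_space[OF assms] by (simp add: tensor_space_eq[OF assms])

text \<open>
With plots being local sums, smoothness holds term by term: a sum of \<open>q i \<otimes> q' i\<close> over \<open>r\<close> goes to the
sum of \<open>h (q i) \<otimes> k (q' i)\<close> over \<open>f \<circ> r\<close>.
\<close>

lemma smooth_tensor_map:
  assumes VW: "scalable_bundle X V" "scalable_bundle X W" and VW2: "scalable_bundle X2 V2" "scalable_bundle X2 W2"
    and f: "smooth X X2 f" and h: "smooth (total V) (total V2) h" and k: "smooth (total W) (total W2) k"
    and lin: "\<And>x. x \<in> carrier X \<Longrightarrow> fibre_linear V x V2 (f x) h" "\<And>x. x \<in> carrier X \<Longrightarrow> fibre_linear W x W2 (f x) k"
  shows "smooth (tensor_space X V W) (tensor_space X2 V2 W2) (tensor_map f V2 W2 h k)"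
  unfolding smooth_def
proof (intro conjI allI impI)
  show "tensor_map f V2 W2 h k ` carrier (tensor_space X V W) \<subseteq> carrier (tensor_space X2 V2 W2)"
  proof (rule image_subsetI)
    fix t assume "t \<in> carrier (tensor_space X V W)"
    then obtain x p where p: "x \<in> carrier X" "p \<in> free_vs (fibre_pairs V W x)" "t = (x, tensor_class V W x p)"
      by (auto simp: tensor_space_def mem_tensor_points_iff)
    have "f x \<in> carrier X2" by (rule smooth_carrier[OF f p(1)])
    moreover have "free_map (map_prod h k) p \<in> free_vs (fibre_pairs V2 W2 (f x))"
      by (rule fibre_linear_free_vs[OF lin[OF p(1)] p(2)])
    moreover have "tensor_map f V2 W2 h k t = (f x, tensor_class V2 W2 (f x) (free_map (map_prod h k) p))"
      unfolding p(3) by (rule tensor_map_class[of V x V2 f, OF lin[OF p(1)] p(2)])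
    ultimately show "tensor_map f V2 W2 h k t \<in> carrier (tensor_space X2 V2 W2)"
      unfolding tensor_space_def partial_object.simps mem_tensor_points_iff by blast
  qed
  fix n U p assume "plot (tensor_space X V W) n U p"
  then have L: "locally_in n U (sum_of_tensors_on X V W n p)" by (simp add: plot_tensor_space_iff[OF VW])
  have dX: "diffeological_space X" and dV2: "diffeological_space (total V2)" "diffeological_space (total W2)"
    using VW VW2 by (auto simp: scalable_bundle_def)
  have "locally_in n U (sum_of_tensors_on X2 V2 W2 n (tensor_map f V2 W2 h k \<circ> p))"
  proof (rule locally_in_mono[OF L])
    fix N assume "sum_of_tensors_on X V W n p N"
    then obtain r qs where D: "plots_over X V W n N r qs"
      and p: "\<forall>w\<in>N. p w = (r w, tensor_class V W (r w) (sum_list (map (\<lambda>q. gen (q w)) qs)))"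
      by (rule sum_of_tensors_onE)
    note r = plots_overD(1)[OF D] and qs = plots_overD(2,3)[OF D] and free = plots_over_free_vs[OF D]
    show "sum_of_tensors_on X2 V2 W2 n (tensor_map f V2 W2 h k \<circ> p) N"
    proof (rule sum_of_tensors_onI[of _ _ _ "f \<circ> r" "map (\<lambda>q w. map_prod h k (q w)) qs"])
      show "plot X2 n N (f \<circ> r)" by (rule smooth_plot[OF f r])
    next
      fix w assume w: "w \<in> N"
      have rw: "r w \<in> carrier X" by (rule plot_carrier[OF dX r w])
      show "(tensor_map f V2 W2 h k \<circ> p) w = ((f \<circ> r) w, tensor_class V2 W2 ((f \<circ> r) w)
          (sum_list (map (\<lambda>q. gen (q w)) (map (\<lambda>q w. map_prod h k (q w)) qs))))"
        using p w tensor_map_class[of V "r w" V2 f, OF lin[OF rw] free[OF w]]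
          free_map_sum_list_gen[of "map_prod h k" "map (\<lambda>q. q w) qs"]
        by (simp add: comp_def)
    next
      fix q assume "q \<in> set (map (\<lambda>q w. map_prod h k (q w)) qs)"
      then obtain q' where q': "q' \<in> set qs" "q = (\<lambda>w. map_prod h k (q' w))" by auto
      note fq' = plot_fibre_productD[OF qs(1)[OF q'(1)]]
      have over: "h (fst (q' w)) \<in> points_over V2 {f (r w)}" "k (snd (q' w)) \<in> points_over W2 {f (r w)}"
        if "w \<in> N" for w
        using fq'(3)[OF that] qs(2)[OF q'(1) that] lin[OF plot_carrier[OF dX r that]]
        by (auto simp: fibre_linear_def mem_Times_iff)
      then show "proj V2 (fst (q w)) = (f \<circ> r) w" if "w \<in> N" for w
        using that by (simp add: q'(2) points_over_def)
      show "plot (fibre_product V2 W2) n N q"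
        by (rule plot_fibre_productI)
          (use smooth_plot[OF h fq'(1)] smooth_plot[OF k fq'(2)] over dV2 in
            \<open>auto simp: q'(2) comp_def points_over_def\<close>)
    qed
  qed
  then show "plot (tensor_space X2 V2 W2) n U (tensor_map f V2 W2 h k \<circ> p)"
    by (simp add: plot_tensor_space_iff[OF VW2])
qed

section \<open>Lifting local sums of tensors\<close>

text \<open>
If every term of a local sum lifts along \<open>a\<close> and \<open>b\<close>, over one lift \<open>r2\<close> of the base plot, then the sum
lifts along the tensor product of \<open>a\<close> and \<open>b\<close>.
\<close>

lemma lift_sum_of_tensors:
  assumes V2: "scalable_bundle X2 V2" and W2: "scalable_bundle X2 W2"
    and r2: "plot X2 n N r2" and u: "u \<in> N"
    and lin: "\<And>x. x \<in> carrier X2 \<Longrightarrow> fibre_linear V2 x A (i x) a" "\<And>x. x \<in> carrier X2 \<Longrightarrow> fibre_linear W2 x B (i x) b"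
    and lift: "\<And>q. q \<in> set qs \<Longrightarrow> \<exists>M q'. openin (Euclidean_space n) M \<and> u \<in> M \<and> M \<subseteq> N \<and>
      plot (fibre_product V2 W2) n M q' \<and> (\<forall>w\<in>M. q w = map_prod a b (q' w) \<and> proj V2 (fst (q' w)) = r2 w)"
  obtains M t where "openin (Euclidean_space n) M" "u \<in> M" "M \<subseteq> N" "plot (tensor_space X2 V2 W2) n M t"
    "\<forall>w\<in>M. tensor_map i A B a b (t w) =
      (i (r2 w), tensor_class A B (i (r2 w)) (sum_list (map (\<lambda>q. gen (q w)) qs)))"
proof -
  have dX2: "diffeological_space X2" and dV2: "diffeological_space (total V2)" and dW2: "diffeological_space (total W2)"
    using V2 W2 by (auto simp: scalable_bundle_def)
  define P where "P = (\<lambda>M q q'. plot (fibre_product V2 W2) n M q' \<and>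
    (\<forall>w\<in>M. q w = map_prod a b (q' w) \<and> proj V2 (fst (q' w)) = r2 w))"
  have "\<exists>M qs'. openin (Euclidean_space n) M \<and> u \<in> M \<and> M \<subseteq> N \<and> list_all2 (P M) qs qs'"
  proof (rule finite_common_neighbourhood[OF plot_open[OF dX2 r2] u])
    show "\<exists>M q'. openin (Euclidean_space n) M \<and> u \<in> M \<and> M \<subseteq> N \<and> P M q q'" if "q \<in> set qs" for q
      using lift[OF that] by (simp add: P_def)
    show "P M' q q'" if "P M q q'" "openin (Euclidean_space n) M'" "M' \<subseteq> M" for M M' q q'
      using that plot_restrict[OF diffeological_fibre_product[OF dV2 dW2]] by (auto simp: P_def)
  qed
  then obtain M qs' where M: "openin (Euclidean_space n) M" "u \<in> M" "M \<subseteq> N" and all: "list_all2 (P M) qs qs'"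
    by blast
  have P: "plot (fibre_product V2 W2) n M q'" "\<And>w. w \<in> M \<Longrightarrow> proj V2 (fst (q' w)) = r2 w"
    if "q' \<in> set qs'" for q'
  proof -
    obtain i where "i < length qs'" "q' = qs' ! i"
      using \<open>q' \<in> set qs'\<close> unfolding in_set_conv_nth by blast
    then have "P M (qs ! i) q'"
      using list_all2_nthD2[OF all, of i] by simp
    then show "plot (fibre_product V2 W2) n M q'" "\<And>w. w \<in> M \<Longrightarrow> proj V2 (fst (q' w)) = r2 w"
      by (auto simp: P_def)
  qed
  have D: "plots_over X2 V2 W2 n M r2 qs'"
    by (rule plots_overI[OF plot_restrict[OF dX2 r2 M(1,3)]]) (fact P)+
  define t where "t = (\<lambda>w. (r2 w, tensor_class V2 W2 (r2 w) (sum_list (map (\<lambda>q. gen (q w)) qs'))))"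
  have "sum_of_tensors_on X2 V2 W2 n t M"
    unfolding sum_of_tensors_on_def using D by (auto simp: t_def)
  then have "plot (tensor_space X2 V2 W2) n M t"
    unfolding plot_tensor_space_iff[OF V2 W2] by (rule locally_in_whole[OF M(1)])
  moreover have "tensor_map i A B a b (t w) =
      (i (r2 w), tensor_class A B (i (r2 w)) (sum_list (map (\<lambda>q. gen (q w)) qs)))" if w: "w \<in> M" for w
  proof -
    have x: "r2 w \<in> carrier X2" using plot_carrier[OF dX2 r2] w M(3) by blast
    have "map (\<lambda>q. q w) qs = map (map_prod a b) (map (\<lambda>q. q w) qs')"
      using all by (induction rule: list_all2_induct) (use w in \<open>auto simp: P_def\<close>)
    then have "sum_list (map gen (map (\<lambda>q. q w) qs)) =
        free_map (map_prod a b) (sum_list (map gen (map (\<lambda>q. q w) qs')))"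
      by (simp only: free_map_sum_list_gen)
    then have "sum_list (map (\<lambda>q. gen (q w)) qs) = free_map (map_prod a b) (sum_list (map (\<lambda>q. gen (q w)) qs'))"
      by (simp add: comp_def)
    then show ?thesis
      unfolding t_def
      using tensor_map_class[of V2 "r2 w" A i, OF lin(1)[OF x] lin(2)[OF x] plots_over_free_vs[OF D w]] by simp
  qed
  ultimately show ?thesis using that[OF M] by blast
qed

text \<open>
The two factors of a term lift on different neighbourhoods. On the intersection the pair of lifts is a
plot of the fibre product, because both lie over \<open>r\<close>.
\<close>

lemma fibre_product_lift:
  assumes V: "diffeological_space (total V)" and W: "diffeological_space (total W)"
    and M: "openin (Euclidean_space n) M" "u \<in> M" "M \<subseteq> N" and v: "plot (total V) n M v"
      "\<forall>w\<in>M. fst (q w) = a (v w)" "\<forall>w\<in>M. proj V (v w) = r w"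
    and M': "openin (Euclidean_space n) M'" "u \<in> M'" "M' \<subseteq> N" and v': "plot (total W) n M' v'"
      "\<forall>w\<in>M'. snd (q w) = b (v' w)" "\<forall>w\<in>M'. proj W (v' w) = r w"
  shows "\<exists>M q'. openin (Euclidean_space n) M \<and> u \<in> M \<and> M \<subseteq> N \<and>
      plot (fibre_product V W) n M q' \<and> (\<forall>w\<in>M. q w = map_prod a b (q' w) \<and> proj V (fst (q' w)) = r w)"
proof (intro exI conjI ballI)
  show op: "openin (Euclidean_space n) (M \<inter> M')" using M(1) M'(1) by (rule openin_Int)
  show "u \<in> M \<inter> M'" "M \<inter> M' \<subseteq> N" using M M' by auto
  show "plot (fibre_product V W) n (M \<inter> M') (\<lambda>w. (v w, v' w))"
  proof (rule plot_fibre_productI[OF _ _ V W])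
    show "plot (total V) n (M \<inter> M') (fst \<circ> (\<lambda>w. (v w, v' w)))"
      using plot_restrict[OF V v(1) op] by (simp add: comp_def)
    show "plot (total W) n (M \<inter> M') (snd \<circ> (\<lambda>w. (v w, v' w)))"
      using plot_restrict[OF W v'(1) op] by (simp add: comp_def)
  qed (use v(3) v'(3) in auto)
  show "q w = map_prod a b (v w, v' w)" "proj V (fst (v w, v' w)) = r w" if "w \<in> M \<inter> M'" for w
    using that v(2,3) v'(2) by (auto simp: prod_eq_iff)
qed

section \<open>Glued spaces\<close>

lemma mem_Plus_simps [simp]:
  "Inl a \<in> A <+> B \<longleftrightarrow> a \<in> A" "Inr b \<in> A <+> B \<longleftrightarrow> b \<in> B"
  by auto

text \<open>
Gluing identifies each point of \<open>Y\<close> with its image, so each class has a normal form: its point in the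
second space if there is one, else its only point. Sending a point to its normal form is a retraction
of the disjoint union, and two points are identified iff they have the same normal form.
\<close>

definition glue_retract :: "'a set \<Rightarrow> ('a \<Rightarrow> 'b) \<Rightarrow> 'a + 'b \<Rightarrow> 'a + 'b" where
  "glue_retract Y f s = (case s of Inl a \<Rightarrow> if a \<in> Y then Inr (f a) else Inl a | Inr b \<Rightarrow> Inr b)"

lemma glue_retract_simps [simp]:
  "a \<in> Y \<Longrightarrow> glue_retract Y f (Inl a) = Inr (f a)"
  "a \<notin> Y \<Longrightarrow> glue_retract Y f (Inl a) = Inl a"
  "glue_retract Y f (Inr b) = Inr b"
  by (simp_all add: glue_retract_def)

lemma glue_retract_idem [simp]: "glue_retract Y f (glue_retract Y f s) = glue_retract Y f s"
  by (cases s; cases "projl s \<in> Y") auto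

lemma glue_retract_cases:
  obtains a where "s = Inl a" "a \<notin> Y" "glue_retract Y f s = Inl a"
  | a where "s = Inl a" "a \<in> Y" "glue_retract Y f s = Inr (f a)"
  | b where "s = Inr b" "glue_retract Y f s = Inr b"
  by (cases s) (auto simp: glue_retract_def split: if_splits)

lemma glue_retract_closed:
  assumes "f ` Y \<subseteq> B" "s \<in> A <+> B"
  shows "glue_retract Y f s \<in> A <+> B"
  using assms by (cases rule: glue_retract_cases[where s=s and Y=Y and f=f]) auto

text \<open>
The kernel of the retraction is an equivalence relation that contains the generating pairs. Conversely,
every equivalence relation that contains them relates each point to its normal form.
\<close>

lemma glue_rel_eq_kernel:
  assumes Y: "Y \<subseteq> carrier X1" and f: "f ` Y \<subseteq> carrier X2"
  shows "glue_rel X1 Y f X2 =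
    {(s, t). s \<in> carrier X1 <+> carrier X2 \<and> t \<in> carrier X1 <+> carrier X2 \<and>
      glue_retract Y f s = glue_retract Y f t}" (is "_ = ?K")
proof
  let ?S = "carrier X1 <+> carrier X2" and ?R = "{(Inl y, Inr (f y)) | y. y \<in> Y}"
  have "equiv ?S ?K"
    by (rule equivI) (auto simp: refl_on_def sym_def trans_def)
  moreover have "?R \<subseteq> ?K" using Y f by auto
  ultimately show "glue_rel X1 Y f X2 \<subseteq> ?K"
    unfolding glue_rel_def equiv_gen_def by blast
  show "?K \<subseteq> glue_rel X1 Y f X2"
    unfolding glue_rel_def equiv_gen_def
  proof (intro subsetI InterI)
    fix z r assume "r \<in> {r. equiv ?S r \<and> ?R \<subseteq> r}" and "z \<in> ?K"
    then have r: "equiv ?S r" "?R \<subseteq> r" by simp_all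
    from \<open>z \<in> ?K\<close> obtain s t where z: "z = (s, t)" "s \<in> ?S" "t \<in> ?S" "glue_retract Y f s = glue_retract Y f t"
      by blast
    have to_retract: "(a, glue_retract Y f a) \<in> r" if "a \<in> ?S" for a
      by (cases rule: glue_retract_cases[where s=a and Y=Y and f=f]) (use r that in \<open>auto simp: equiv_def refl_on_def\<close>)
    have "(s, glue_retract Y f t) \<in> r" "(glue_retract Y f t, t) \<in> r"
      using to_retract[OF z(2)] to_retract[OF z(3)] z(4) r(1) by (auto simp: equiv_def dest: symD)
    then show "z \<in> r"
      using r(1) z(1) by (auto simp: equiv_def dest: transD)
  qed
qed

definition glue_class :: "'a diff_space \<Rightarrow> 'a set \<Rightarrow> ('a \<Rightarrow> 'b) \<Rightarrow> 'b diff_space \<Rightarrow> 'a + 'b \<Rightarrow> ('a + 'b) set" where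
  "glue_class X1 Y f X2 s = glue_rel X1 Y f X2 `` {s}"

lemma carrier_glue_space:
  "carrier (glue_space X1 Y f X2) = glue_class X1 Y f X2 ` (carrier X1 <+> carrier X2)"
  by (auto simp: glue_space_def quotient_space_def quotient_def sum_space_def glue_class_def)

lemma diffeological_glue_space:
  "diffeological_space X1 \<Longrightarrow> diffeological_space X2 \<Longrightarrow> diffeological_space (glue_space X1 Y f X2)"
  unfolding glue_space_def by (intro diffeological_quotient_space diffeological_sum_space)

lemma plot_glue_space_iff:
  assumes X1: "diffeological_space X1" and X2: "diffeological_space X2"
  shows "plot (glue_space X1 Y f X2) n U p \<longleftrightarrow>
    locally_in n U (\<lambda>N. (\<exists>q. plot X1 n N q \<and> (\<forall>w\<in>N. p w = glue_class X1 Y f X2 (Inl (q w)))) \<or>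
      (\<exists>q. plot X2 n N q \<and> (\<forall>w\<in>N. p w = glue_class X1 Y f X2 (Inr (q w)))))"
    (is "_ \<longleftrightarrow> locally_in n U ?P")
proof
  assume "plot (glue_space X1 Y f X2) n U p"
  then have "locally_in n U (\<lambda>N. \<exists>s. plot (sum_space X1 X2) n N s \<and> (\<forall>w\<in>N. p w = glue_class X1 Y f X2 (s w)))"
    by (simp add: glue_space_def quotient_space_def glue_class_def)
  then have "locally_in n U (\<lambda>N. locally_in n N ?P)"
  proof (rule locally_in_mono, elim exE conjE)
    fix N s assume "plot (sum_space X1 X2) n N s" and p: "\<forall>w\<in>N. p w = glue_class X1 Y f X2 (s w)"
    then have "locally_in n N (\<lambda>W. (\<exists>q. plot X1 n W q \<and> (\<forall>w\<in>W. s w = Inl (q w))) \<or>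
        (\<exists>q. plot X2 n W q \<and> (\<forall>w\<in>W. s w = Inr (q w))))"
      by (simp add: sum_space_def)
    then show "locally_in n N ?P"
    proof (rule locally_in_mono)
      fix M assume M: "M \<subseteq> N" and "(\<exists>q. plot X1 n M q \<and> (\<forall>w\<in>M. s w = Inl (q w))) \<or>
        (\<exists>q. plot X2 n M q \<and> (\<forall>w\<in>M. s w = Inr (q w)))"
      then show "?P M"
      proof (elim disjE exE conjE)
        fix q assume "plot X1 n M q" "\<forall>w\<in>M. s w = Inl (q w)"
        then show "?P M" using p M by (intro disjI1 exI[of _ q]) (auto simp: subset_iff)
      next
        fix q assume "plot X2 n M q" "\<forall>w\<in>M. s w = Inr (q w)"
        then show "?P M" using p M by (intro disjI2 exI[of _ q]) (auto simp: subset_iff)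
      qed
    qed
  qed
  then show "locally_in n U ?P" by (rule locally_in_idem)
next
  assume "locally_in n U ?P"
  then have "locally_in n U (\<lambda>N. \<exists>s. plot (sum_space X1 X2) n N s \<and> (\<forall>w\<in>N. p w = glue_class X1 Y f X2 (s w)))"
  proof (rule locally_in_mono, elim disjE exE conjE)
    fix N q assume q: "plot X1 n N q" "\<forall>w\<in>N. p w = glue_class X1 Y f X2 (Inl (q w))"
    then have "plot (sum_space X1 X2) n N (\<lambda>w. Inl (q w))"
      using plot_open[OF X1 q(1)] by (auto simp: sum_space_def intro!: locally_in_whole)
    then show "\<exists>s. plot (sum_space X1 X2) n N s \<and> (\<forall>w\<in>N. p w = glue_class X1 Y f X2 (s w))"
      using q(2) by (intro exI[of _ "\<lambda>w. Inl (q w)"]) simp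
  next
    fix N q assume q: "plot X2 n N q" "\<forall>w\<in>N. p w = glue_class X1 Y f X2 (Inr (q w))"
    then have "plot (sum_space X1 X2) n N (\<lambda>w. Inr (q w))"
      using plot_open[OF X2 q(1)] by (auto simp: sum_space_def intro!: locally_in_whole)
    then show "\<exists>s. plot (sum_space X1 X2) n N s \<and> (\<forall>w\<in>N. p w = glue_class X1 Y f X2 (s w))"
      using q(2) by (intro exI[of _ "\<lambda>w. Inr (q w)"]) simp
  qed
  then show "plot (glue_space X1 Y f X2) n U p"
    by (simp add: glue_space_def quotient_space_def glue_class_def)
qed

lemma smooth_glue_Inl:
  assumes "diffeological_space X1" "diffeological_space X2"
  shows "smooth X1 (glue_space X1 Y f X2) (\<lambda>x. glue_class X1 Y f X2 (Inl x))"
  unfolding smooth_def plot_glue_space_iff[OF assms] carrier_glue_space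
proof (intro conjI allI impI)
  fix n U p assume p: "plot X1 n U p"
  show "locally_in n U (\<lambda>N. (\<exists>q. plot X1 n N q \<and>
      (\<forall>w\<in>N. ((\<lambda>x. glue_class X1 Y f X2 (Inl x)) \<circ> p) w = glue_class X1 Y f X2 (Inl (q w)))) \<or>
    (\<exists>q. plot X2 n N q \<and>
      (\<forall>w\<in>N. ((\<lambda>x. glue_class X1 Y f X2 (Inl x)) \<circ> p) w = glue_class X1 Y f X2 (Inr (q w)))))"
    by (rule locally_in_whole[OF plot_open[OF assms(1) p]]) (use p in \<open>auto intro: exI[of _ p]\<close>)
qed auto

lemma smooth_glue_Inr:
  assumes "diffeological_space X1" "diffeological_space X2"
  shows "smooth X2 (glue_space X1 Y f X2) (\<lambda>x. glue_class X1 Y f X2 (Inr x))"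
  unfolding smooth_def plot_glue_space_iff[OF assms] carrier_glue_space
proof (intro conjI allI impI)
  fix n U p assume p: "plot X2 n U p"
  show "locally_in n U (\<lambda>N. (\<exists>q. plot X1 n N q \<and>
      (\<forall>w\<in>N. ((\<lambda>x. glue_class X1 Y f X2 (Inr x)) \<circ> p) w = glue_class X1 Y f X2 (Inl (q w)))) \<or>
    (\<exists>q. plot X2 n N q \<and>
      (\<forall>w\<in>N. ((\<lambda>x. glue_class X1 Y f X2 (Inr x)) \<circ> p) w = glue_class X1 Y f X2 (Inr (q w)))))"
    by (rule locally_in_whole[OF plot_open[OF assms(2) p]]) (use p in \<open>auto intro: exI[of _ p]\<close>)
qed auto

lemma smooth_case_sum:
  assumes Z: "diffeological_space Z" and a: "smooth X Z a" and b: "smooth Y Z b"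
  shows "smooth (sum_space X Y) Z (case_sum a b)"
  unfolding smooth_def
proof (intro conjI allI impI)
  show "case_sum a b ` carrier (sum_space X Y) \<subseteq> carrier Z"
    using smooth_carrier[OF a] smooth_carrier[OF b] by (auto simp: sum_space_def)
  fix n U p assume "plot (sum_space X Y) n U p"
  then have L: "locally_in n U (\<lambda>W. (\<exists>q. plot X n W q \<and> (\<forall>w\<in>W. p w = Inl (q w))) \<or>
        (\<exists>q. plot Y n W q \<and> (\<forall>w\<in>W. p w = Inr (q w))))"
    by (simp add: sum_space_def)
  show "plot Z n U (case_sum a b \<circ> p)"
  proof (rule plot_local[OF Z locally_in_mono[OF L]], elim disjE exE conjE)
    fix N q assume q: "plot X n N q" "\<forall>w\<in>N. p w = Inl (q w)"
    show "plot Z n N (case_sum a b \<circ> p)"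
      by (rule plot_cong[OF Z smooth_plot[OF a q(1)]]) (simp add: q(2))
  next
    fix N q assume q: "plot Y n N q" "\<forall>w\<in>N. p w = Inr (q w)"
    show "plot Z n N (case_sum a b \<circ> p)"
      by (rule plot_cong[OF Z smooth_plot[OF b q(1)]]) (simp add: q(2))
  qed
qed

context
  fixes X1 :: "'a diff_space" and Y :: "'a set" and f :: "'a \<Rightarrow> 'b" and X2 :: "'b diff_space"
  assumes Y: "Y \<subseteq> carrier X1" and f: "f ` Y \<subseteq> carrier X2"
begin

lemma mem_glue_class_iff:
  assumes "s \<in> carrier X1 <+> carrier X2"
  shows "t \<in> glue_class X1 Y f X2 s \<longleftrightarrow>
    t \<in> carrier X1 <+> carrier X2 \<and> glue_retract Y f s = glue_retract Y f t"
  using assms by (simp add: glue_class_def glue_rel_eq_kernel[OF Y f])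

lemma glue_class_eq_iff:
  assumes "s \<in> carrier X1 <+> carrier X2" "t \<in> carrier X1 <+> carrier X2"
  shows "glue_class X1 Y f X2 s = glue_class X1 Y f X2 t \<longleftrightarrow> glue_retract Y f s = glue_retract Y f t"
  using mem_glue_class_iff[OF assms(1)] mem_glue_class_iff[OF assms(2)] assms by auto

lemma glue_class_retract:
  assumes "s \<in> carrier X1 <+> carrier X2"
  shows "glue_class X1 Y f X2 (glue_retract Y f s) = glue_class X1 Y f X2 s"
  using glue_class_eq_iff[OF glue_retract_closed[OF f assms] assms] by simp

lemma glue_rep_class:
  assumes s: "s \<in> carrier X1 <+> carrier X2"
  shows "glue_rep (glue_class X1 Y f X2 s) = glue_retract Y f s"
proof -
  have ret: "glue_retract Y f s \<in> glue_class X1 Y f X2 s"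
    using glue_retract_closed[OF f s] by (simp add: mem_glue_class_iff[OF s])
  have retr: "Inr b \<in> glue_class X1 Y f X2 s \<Longrightarrow> glue_retract Y f s = Inr b" for b
    by (simp add: mem_glue_class_iff[OF s])
  show ?thesis
  proof (cases "glue_retract Y f s")
    case (Inr b)
    then have "Inr b' \<in> glue_class X1 Y f X2 s \<longleftrightarrow> b' = b" for b'
      using ret retr[of b'] by auto
    then show ?thesis by (simp add: glue_rep_def Inr)
  next
    case (Inl a)
    have no: "\<not> (\<exists>b. Inr b \<in> glue_class X1 Y f X2 s)" using retr Inl by auto
    have "Inl a' \<in> glue_class X1 Y f X2 s \<longleftrightarrow> a' = a" for a'
    proof
      assume "Inl a' \<in> glue_class X1 Y f X2 s"
      then have "glue_retract Y f (Inl a') = Inl a" by (simp add: mem_glue_class_iff[OF s] Inl)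
      then show "a' = a" by (cases "a' \<in> Y") auto
    qed (use ret Inl in auto)
    then show ?thesis using no by (simp add: glue_rep_def Inl)
  qed
qed

text \<open>
The projection of a glued bundle is defined by applying the gluing relation to a whole set; any subset
of a class that contains a given point yields the class of this point.
\<close>

lemma glue_image_class:
  assumes "Z \<subseteq> glue_class X1 Y f X2 s" "s \<in> Z" "s \<in> carrier X1 <+> carrier X2"
  shows "glue_rel X1 Y f X2 `` Z = glue_class X1 Y f X2 s"
proof -
  have "glue_rel X1 Y f X2 `` {z} = glue_class X1 Y f X2 s" if "z \<in> Z" for z
    using that assms(1) glue_class_eq_iff[OF assms(3), of z] mem_glue_class_iff[OF assms(3), of z]
    unfolding glue_class_def[symmetric] by blast
  then show ?thesis using assms(2) by blast
qed

end

section \<open>Glued bundles\<close>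

text \<open>
Since \<open>h\<close> is defined on all of the points over \<open>Y\<close> and covers \<open>f\<close>, a point of the disjoint union of the
total spaces is moved by the retraction iff its projection is.
\<close>

lemma glue_retract_proj:
  assumes "\<And>v. v \<in> points_over V1 Y \<Longrightarrow> proj V2 (h v) = f (proj V1 v)"
    and "s \<in> carrier (total V1) <+> carrier (total V2)"
  shows "glue_retract Y f (map_sum (proj V1) (proj V2) s) =
    map_sum (proj V1) (proj V2) (glue_retract (points_over V1 Y) h s)"
proof (cases s)
  case (Inl v)
  then show ?thesis using assms by (cases "v \<in> points_over V1 Y") (auto simp: points_over_def)
qed simp

lemma proj_glue_class:
  assumes Y: "Y \<subseteq> carrier X1" and fY: "f ` Y \<subseteq> carrier X2"
    and pr: "proj V1 ` carrier (total V1) \<subseteq> carrier X1" "proj V2 ` carrier (total V2) \<subseteq> carrier X2"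
    and h: "h ` points_over V1 Y \<subseteq> carrier (total V2)"
    and lift: "\<And>v. v \<in> points_over V1 Y \<Longrightarrow> proj V2 (h v) = f (proj V1 v)"
    and s: "s \<in> carrier (total V1) <+> carrier (total V2)"
  shows "proj (glue_bundle X1 Y f X2 V1 h V2) (glue_class (total V1) (points_over V1 Y) h (total V2) s) =
    glue_class X1 Y f X2 (map_sum (proj V1) (proj V2) s)"
proof -
  have V1Y: "points_over V1 Y \<subseteq> carrier (total V1)" by (auto simp: points_over_def)
  let ?c = "glue_class (total V1) (points_over V1 Y) h (total V2)" and ?pr = "map_sum (proj V1) (proj V2)"
  have closed: "?pr t \<in> carrier X1 <+> carrier X2" if "t \<in> carrier (total V1) <+> carrier (total V2)" for t
    using that pr by auto
  have "glue_rel X1 Y f X2 `` (?pr ` ?c s) = glue_class X1 Y f X2 (?pr s)"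
  proof (rule glue_image_class[OF Y fY])
    show "?pr ` ?c s \<subseteq> glue_class X1 Y f X2 (?pr s)"
    proof (rule image_subsetI)
      fix t assume "t \<in> ?c s"
      then have t: "t \<in> carrier (total V1) <+> carrier (total V2)"
        "glue_retract (points_over V1 Y) h s = glue_retract (points_over V1 Y) h t"
        by (simp_all add: mem_glue_class_iff[OF V1Y h s])
      then show "?pr t \<in> glue_class X1 Y f X2 (?pr s)"
        unfolding mem_glue_class_iff[OF Y fY closed[OF s]]
        using closed glue_retract_proj[of V1 Y V2 h f, OF lift] s by simp
    qed
    show "?pr s \<in> ?pr ` ?c s" by (simp add: mem_glue_class_iff[OF V1Y h s] s)
  qed (rule closed[OF s])
  then show ?thesis by (simp add: glue_bundle_def Let_def)
qed

text \<open>
Injectivity of \<open>f\<close> makes the map from \<open>X1\<close> to the glued base injective. So a plot of the glued bundle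
that lifts to \<open>V1\<close> lies there over any given lift of its base plot to \<open>X1\<close>; this keeps the factors of a
tensor product over a common base plot.
\<close>

locale bundle_gluing =
  fixes X1 :: "'x diff_space" and Y :: "'x set" and f :: "'x \<Rightarrow> 'y" and X2 :: "'y diff_space"
    and V1 :: "('x, 'v) vbundle" and h :: "'v \<Rightarrow> 'w" and V2 :: "('y, 'w) vbundle"
  assumes V1: "pseudo_bundle X1 V1" and V2: "pseudo_bundle X2 V2"
    and Y: "Y \<subseteq> carrier X1" and fY: "f ` Y \<subseteq> carrier X2" and inj: "inj_on f Y"
    and h: "smooth_linear_lift V1 Y f V2 h"
begin

abbreviation "base \<equiv> glue_space X1 Y f X2"
abbreviation "bundle \<equiv> glue_bundle X1 Y f X2 V1 h V2"
abbreviation "base_class \<equiv> glue_class X1 Y f X2"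
abbreviation "total_class \<equiv> glue_class (total V1) (points_over V1 Y) h (total V2)"
abbreviation "base_left x \<equiv> base_class (Inl x)"
abbreviation "base_right x \<equiv> base_class (Inr x)"
abbreviation "left v \<equiv> total_class (Inl v)"
abbreviation "right v \<equiv> total_class (Inr v)"

lemma diffeological: "diffeological_space X1" "diffeological_space X2"
    "diffeological_space (total V1)" "diffeological_space (total V2)"
  using V1 V2 by (auto simp: pseudo_bundle_def)

lemma scalable: "scalable_bundle X1 V1" "scalable_bundle X2 V2"
  using V1 V2 by (auto intro: pseudo_bundle_scalable)

lemma proj_closed: "v \<in> carrier (total V1) \<Longrightarrow> proj V1 v \<in> carrier X1"
    "w \<in> carrier (total V2) \<Longrightarrow> proj V2 w \<in> carrier X2"
  using V1 V2 smooth_carrier unfolding pseudo_bundle_def by blast+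

lemma over_Y_subset: "points_over V1 Y \<subseteq> carrier (total V1)"
  by (auto simp: points_over_def)

lemma lift_closed: "v \<in> points_over V1 Y \<Longrightarrow> h v \<in> carrier (total V2)"
  using h by (auto simp: smooth_linear_lift_def smooth_def subset_space_def points_over_def)

lemma lift_image: "h ` points_over V1 Y \<subseteq> carrier (total V2)"
  using lift_closed by blast

lemma proj_lift: "v \<in> points_over V1 Y \<Longrightarrow> proj V2 (h v) = f (proj V1 v)"
  using h by (auto simp: smooth_linear_lift_def)

lemma lift_plot:
  assumes "plot (total V1) n N q" "\<And>w. w \<in> N \<Longrightarrow> q w \<in> points_over V1 Y"
  shows "plot (total V2) n N (h \<circ> q)"
proof -
  have "plot (subset_space (total V1) (points_over V1 Y)) n N q"
    using assms by (auto simp: subset_space_def)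
  moreover have "smooth (subset_space (total V1) (points_over V1 Y)) (subset_space (total V2) (points_over V2 (f ` Y))) h"
    using h by (simp add: smooth_linear_lift_def)
  ultimately have "plot (subset_space (total V2) (points_over V2 (f ` Y))) n N (h \<circ> q)"
    by (rule smooth_plot[rotated])
  then show ?thesis by (simp add: subset_space_def)
qed

lemma fibre_linear_lift: "x \<in> Y \<Longrightarrow> fibre_linear V1 x V2 (f x) h"
  using h lift_closed proj_lift
  by (auto simp: smooth_linear_lift_def linear_on_fibres_def fibre_linear_def points_over_def)

lemma total_class_eq_iff:
  assumes "s \<in> carrier (total V1) <+> carrier (total V2)" "t \<in> carrier (total V1) <+> carrier (total V2)"
  shows "total_class s = total_class t \<longleftrightarrow> glue_retract (points_over V1 Y) h s = glue_retract (points_over V1 Y) h t"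
  by (rule glue_class_eq_iff[OF over_Y_subset lift_image assms])

lemma base_class_eq_iff:
  assumes "s \<in> carrier X1 <+> carrier X2" "t \<in> carrier X1 <+> carrier X2"
  shows "base_class s = base_class t \<longleftrightarrow> glue_retract Y f s = glue_retract Y f t"
  by (rule glue_class_eq_iff[OF Y fY assms])

text \<open>
This moves computations over \<open>Y\<close> to \<open>V2\<close>, where the glued bundle carries them out.
\<close>

lemma left_eq_right: "v \<in> points_over V1 Y \<Longrightarrow> left v = right (h v)"
  using over_Y_subset lift_closed by (subst total_class_eq_iff) auto

lemma base_left_eq_right: "x \<in> Y \<Longrightarrow> base_left x = base_right (f x)"
  using Y fY by (subst base_class_eq_iff) auto

lemma total_bundle: "total bundle = glue_space (total V1) (points_over V1 Y) h (total V2)"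
  by (simp add: glue_bundle_def Let_def)

lemma carrier_bundle: "carrier (total bundle) = total_class ` (carrier (total V1) <+> carrier (total V2))"
  by (simp add: total_bundle carrier_glue_space)

lemma carrier_left: "v \<in> carrier (total V1) \<Longrightarrow> left v \<in> carrier (total bundle)"
  and carrier_right: "w \<in> carrier (total V2) \<Longrightarrow> right w \<in> carrier (total bundle)"
  by (auto simp: carrier_bundle)

lemma smooth_base_left: "smooth X1 base base_left"
  and smooth_base_right: "smooth X2 base base_right"
  and smooth_left: "smooth (total V1) (total bundle) left"
  and smooth_right: "smooth (total V2) (total bundle) right"
  unfolding total_bundle using diffeological by (auto intro: smooth_glue_Inl smooth_glue_Inr)


lemma proj_class:
  assumes "s \<in> carrier (total V1) <+> carrier (total V2)"
  shows "proj bundle (total_class s) = base_class (map_sum (proj V1) (proj V2) s)"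
  using proj_closed by (intro proj_glue_class Y fY lift_image proj_lift assms) auto

lemma proj_left: "v \<in> carrier (total V1) \<Longrightarrow> proj bundle (left v) = base_left (proj V1 v)"
  and proj_right: "w \<in> carrier (total V2) \<Longrightarrow> proj bundle (right w) = base_right (proj V2 w)"
  by (simp_all add: proj_class)

lemma rep_class:
  assumes "s \<in> carrier (total V1) <+> carrier (total V2)"
  shows "glue_rep (total_class s) = glue_retract (points_over V1 Y) h s"
  by (rule glue_rep_class[OF over_Y_subset lift_image assms])

lemma vscale_left: 
  assumes v: "v \<in> carrier (total V1)"
  shows "vscale bundle c (left v) = left (vscale V1 c v)"
proof (cases "v \<in> points_over V1 Y")
  case True
  then have x: "proj V1 v \<in> Y" "v \<in> points_over V1 {proj V1 v}" by (auto simp: points_over_def)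
  have "vscale V1 c v \<in> points_over V1 {proj V1 v}"
    by (rule scalable_bundle_vscale_closed[OF scalable(1) x(2)])
  then have "vscale V1 c v \<in> points_over V1 Y" using x(1) by (auto simp: points_over_def)
  moreover have "h (vscale V1 c v) = vscale V2 c (h v)"
    using fibre_linear_lift[OF x(1)] x(2) by (auto simp: fibre_linear_def linear_on_fibres_def)
  ultimately show ?thesis
    using True v left_eq_right[of "vscale V1 c v"]
    by (simp add: glue_bundle_def Let_def rep_class glue_class_def[symmetric])
next
  case False
  then show ?thesis
    using v by (simp add: glue_bundle_def Let_def rep_class glue_class_def[symmetric])
qed

lemma vscale_right:
  assumes "w \<in> carrier (total V2)"
  shows "vscale bundle c (right w) = right (vscale V2 c w)"
  using assms by (simp add: glue_bundle_def Let_def rep_class glue_class_def[symmetric])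

lemma vadd_right:
  assumes "v \<in> carrier (total V2)" "w \<in> carrier (total V2)"
  shows "vadd bundle (right v) (right w) = right (vadd V2 v w)"
  using assms by (simp add: glue_bundle_def Let_def rep_class glue_class_def[symmetric])

text \<open>
Over \<open>Y\<close> the sum in the glued bundle is computed in \<open>V2\<close>, after applying \<open>h\<close> to both summands. It is
still the class of the sum in \<open>V1\<close> because \<open>h\<close> is additive.
\<close>

lemma vadd_left:
  assumes v: "v \<in> points_over V1 {x}" and w: "w \<in> points_over V1 {x}"
  shows "vadd bundle (left v) (left w) = left (vadd V1 v w)"
proof (cases "x \<in> Y")
  case True
  have "vadd V1 v w \<in> points_over V1 {x}" by (rule pseudo_bundle_vadd_closed[OF V1 v w])
  then have over: "v \<in> points_over V1 Y" "w \<in> points_over V1 Y" "vadd V1 v w \<in> points_over V1 Y"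
    using True v w by (auto simp: points_over_def)
  have "h (vadd V1 v w) = vadd V2 (h v) (h w)"
    using fibre_linear_lift[OF True] v w by (auto simp: fibre_linear_def linear_on_fibres_def)
  then show ?thesis
    using vadd_right[of "h v" "h w"] over by (simp add: left_eq_right lift_closed)
next
  case False
  then have "v \<notin> points_over V1 Y" "w \<notin> points_over V1 Y" using v w by (auto simp: points_over_def)
  moreover have "v \<in> carrier (total V1)" "w \<in> carrier (total V1)" using v w by (auto simp: points_over_def)
  ultimately show ?thesis
    by (simp add: glue_bundle_def Let_def rep_class glue_class_def[symmetric])
qed

lemma fibre_linear_left: "fibre_linear V1 x bundle (base_left x) left"
proof -
  have "left v \<in> points_over bundle {base_left x}" if "v \<in> points_over V1 {x}" for v
    using that carrier_left proj_left[of v] by (auto simp: points_over_def)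
  then show ?thesis
    using vadd_left vscale_left by (auto simp: fibre_linear_def linear_on_fibres_def points_over_def)
qed

lemma fibre_linear_right: "fibre_linear V2 x bundle (base_right x) right"
proof -
  have "right v \<in> points_over bundle {base_right x}" if "v \<in> points_over V2 {x}" for v
    using that carrier_right proj_right[of v] by (auto simp: points_over_def)
  then show ?thesis
    using vadd_right vscale_right by (auto simp: fibre_linear_def linear_on_fibres_def points_over_def)
qed

text \<open>
The normal form of a point over the class of \<open>x \<in> X2\<close> projects to the normal form of that class, which
is \<open>x\<close> itself, so it lies in \<open>V2\<close>.
\<close>

lemma fibre_over_base_right:
  assumes x: "x \<in> carrier X2" and a: "a \<in> points_over bundle {base_right x}"
  obtains w where "w \<in> points_over V2 {x}" "a = right w"
proof -
  obtain s where s: "s \<in> carrier (total V1) <+> carrier (total V2)" "a = total_class s"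
    and "proj bundle a = base_right x"
    using a by (auto simp: points_over_def carrier_bundle)
  let ?r = "glue_retract (points_over V1 Y) h s"
  have r: "?r \<in> carrier (total V1) <+> carrier (total V2)" by (rule glue_retract_closed[OF lift_image s(1)])
  have "base_class (map_sum (proj V1) (proj V2) s) = base_class (Inr x)"
    using \<open>proj bundle a = base_right x\<close> s by (simp add: proj_class)
  moreover have "map_sum (proj V1) (proj V2) s \<in> carrier X1 <+> carrier X2"
    using s(1) proj_closed by auto
  ultimately have "map_sum (proj V1) (proj V2) ?r = Inr x"
    using x base_class_eq_iff glue_retract_proj[of V1 Y V2 h f, OF proj_lift s(1)] by simp
  then obtain w where w: "?r = Inr w" "proj V2 w = x"
    by (cases ?r) auto
  moreover have "total_class ?r = total_class s"
    by (rule glue_class_retract[OF over_Y_subset lift_image s(1)])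
  ultimately show ?thesis
    using that[of w] r s(2) by (auto simp: points_over_def)
qed

lemma fibre_over_base_left:
  assumes x: "x \<in> carrier X1" "x \<notin> Y" and a: "a \<in> points_over bundle {base_left x}"
  obtains v where "v \<in> points_over V1 {x}" "a = left v"
proof -
  obtain s where s: "s \<in> carrier (total V1) <+> carrier (total V2)" "a = total_class s"
    and "proj bundle a = base_left x"
    using a by (auto simp: points_over_def carrier_bundle)
  let ?r = "glue_retract (points_over V1 Y) h s"
  have r: "?r \<in> carrier (total V1) <+> carrier (total V2)" by (rule glue_retract_closed[OF lift_image s(1)])
  have "base_class (map_sum (proj V1) (proj V2) s) = base_class (Inl x)"
    using \<open>proj bundle a = base_left x\<close> s by (simp add: proj_class)
  moreover have "map_sum (proj V1) (proj V2) s \<in> carrier X1 <+> carrier X2"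
    using s(1) proj_closed by auto
  ultimately have "map_sum (proj V1) (proj V2) ?r = Inl x"
    using x base_class_eq_iff glue_retract_proj[of V1 Y V2 h f, OF proj_lift s(1)] by simp
  then obtain v where v: "?r = Inl v" "proj V1 v = x"
    by (cases ?r) auto
  moreover have "total_class ?r = total_class s"
    by (rule glue_class_retract[OF over_Y_subset lift_image s(1)])
  ultimately show ?thesis
    using that[of v] r s(2) by (auto simp: points_over_def)
qed

lemma bij_right:
  assumes x: "x \<in> carrier X2"
  shows "bij_betw right (points_over V2 {x}) (points_over bundle {base_right x})"
proof -
  have "inj_on right (points_over V2 {x})"
  proof (rule inj_onI)
    fix v w assume "v \<in> points_over V2 {x}" "w \<in> points_over V2 {x}" and eq: "right v = right w"
    then have "Inr v \<in> carrier (total V1) <+> carrier (total V2)" "Inr w \<in> carrier (total V1) <+> carrier (total V2)"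
      by (simp_all add: points_over_def)
    from eq[unfolded total_class_eq_iff[OF this]] show "v = w" by simp
  qed
  moreover have "right ` points_over V2 {x} = points_over bundle {base_right x}"
  proof
    show "right ` points_over V2 {x} \<subseteq> points_over bundle {base_right x}"
      using fibre_linear_right[of x] by (simp add: fibre_linear_def)
    show "points_over bundle {base_right x} \<subseteq> right ` points_over V2 {x}"
    proof
      fix a assume "a \<in> points_over bundle {base_right x}"
      from fibre_over_base_right[OF x this] show "a \<in> right ` points_over V2 {x}" by (metis imageI)
    qed
  qed
  ultimately show ?thesis by (simp add: bij_betw_def)
qed

text \<open>
Over \<open>Y\<close> the fibre of the glued bundle is that of \<open>V2\<close> and \<open>left = right \<circ> h\<close>, so \<open>left\<close> is bijective there
only where \<open>h\<close> is; hence the restriction to \<open>x \<notin> Y\<close>.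
\<close>

lemma bij_left:
  assumes x: "x \<in> carrier X1" "x \<notin> Y"
  shows "bij_betw left (points_over V1 {x}) (points_over bundle {base_left x})"
proof -
  have "inj_on left (points_over V1 {x})"
  proof (rule inj_onI)
    fix v w assume v: "v \<in> points_over V1 {x}" and w: "w \<in> points_over V1 {x}" and eq: "left v = left w"
    then have "Inl v \<in> carrier (total V1) <+> carrier (total V2)" "Inl w \<in> carrier (total V1) <+> carrier (total V2)"
      by (simp_all add: points_over_def)
    note eq = eq[unfolded total_class_eq_iff[OF this]]
    have "v \<notin> points_over V1 Y" "w \<notin> points_over V1 Y"
      using v w x(2) by (auto simp: points_over_def)
    with eq show "v = w" by simp
  qed
  moreover have "left ` points_over V1 {x} = points_over bundle {base_left x}"
  proof
    show "left ` points_over V1 {x} \<subseteq> points_over bundle {base_left x}"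
      using fibre_linear_left[of x] by (simp add: fibre_linear_def)
    show "points_over bundle {base_left x} \<subseteq> left ` points_over V1 {x}"
    proof
      fix a assume "a \<in> points_over bundle {base_left x}"
      from fibre_over_base_left[OF x this] show "a \<in> left ` points_over V1 {x}" by (metis imageI)
    qed
  qed
  ultimately show ?thesis by (simp add: bij_betw_def)
qed

lemma plot_bundle_iff:
  "plot (total bundle) n U p \<longleftrightarrow>
    locally_in n U (\<lambda>N. (\<exists>q. plot (total V1) n N q \<and> (\<forall>w\<in>N. p w = left (q w))) \<or>
      (\<exists>q. plot (total V2) n N q \<and> (\<forall>w\<in>N. p w = right (q w))))"
  unfolding total_bundle by (rule plot_glue_space_iff[OF diffeological(3,4)])

lemma plot_base_iff:
  "plot base n U p \<longleftrightarrow>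
    locally_in n U (\<lambda>N. (\<exists>q. plot X1 n N q \<and> (\<forall>w\<in>N. p w = base_left (q w))) \<or>
      (\<exists>q. plot X2 n N q \<and> (\<forall>w\<in>N. p w = base_right (q w))))"
  by (rule plot_glue_space_iff[OF diffeological(1,2)])

lemma diffeological_base: "diffeological_space base"
  and diffeological_bundle: "diffeological_space (total bundle)"
  unfolding total_bundle using diffeological by (auto intro: diffeological_glue_space)

lemma proj_smooth: "smooth (total V1) X1 (proj V1)" "smooth (total V2) X2 (proj V2)"
  using V1 V2 by (auto simp: pseudo_bundle_def)

lemma smooth_proj_bundle: "smooth (total bundle) base (proj bundle)"
  unfolding smooth_def
proof (intro conjI allI impI)
  show "proj bundle ` carrier (total bundle) \<subseteq> carrier base"
    unfolding carrier_bundle carrier_glue_space using proj_class proj_closed by auto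
  fix n U p assume "plot (total bundle) n U p"
  then have L: "locally_in n U (\<lambda>N. (\<exists>q. plot (total V1) n N q \<and> (\<forall>w\<in>N. p w = left (q w))) \<or>
      (\<exists>q. plot (total V2) n N q \<and> (\<forall>w\<in>N. p w = right (q w))))"
    by (simp add: plot_bundle_iff)
  show "plot base n U (proj bundle \<circ> p)"
  proof (rule plot_local[OF diffeological_base locally_in_mono[OF L]], elim disjE exE conjE)
    fix N q assume q: "plot (total V1) n N q" "\<forall>w\<in>N. p w = left (q w)"
    show "plot base n N (proj bundle \<circ> p)"
      by (rule plot_cong[OF diffeological_base smooth_plot[OF smooth_base_left smooth_plot[OF proj_smooth(1) q(1)]]])
        (use q proj_left plot_carrier[OF diffeological(3) q(1)] in auto)
  next
    fix N q assume q: "plot (total V2) n N q" "\<forall>w\<in>N. p w = right (q w)"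
    show "plot base n N (proj bundle \<circ> p)"
      by (rule plot_cong[OF diffeological_base smooth_plot[OF smooth_base_right smooth_plot[OF proj_smooth(2) q(1)]]])
        (use q proj_right plot_carrier[OF diffeological(4) q(1)] in auto)
  qed
qed

lemma vscale_closed: "v \<in> carrier (total V1) \<Longrightarrow> vscale V1 c v \<in> carrier (total V1)"
    "w \<in> carrier (total V2) \<Longrightarrow> vscale V2 c w \<in> carrier (total V2)"
  using scalable_bundle_vscale_closed[OF scalable(1), of v "proj V1 v"]
    scalable_bundle_vscale_closed[OF scalable(2), of w "proj V2 w"] by (auto simp: points_over_def)

lemma proj_vscale: "v \<in> carrier (total V1) \<Longrightarrow> proj V1 (vscale V1 c v) = proj V1 v"
    "w \<in> carrier (total V2) \<Longrightarrow> proj V2 (vscale V2 c w) = proj V2 w"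
  using scalable by (auto simp: scalable_bundle_def)

lemma scalable_glue: "scalable_bundle base bundle"
  unfolding scalable_bundle_def
proof (intro conjI allI ballI)
  have cases: "(\<exists>v\<in>carrier (total V1). a = left v) \<or> (\<exists>w\<in>carrier (total V2). a = right w)"
    if "a \<in> carrier (total bundle)" for a
    using that by (auto simp: carrier_bundle)
  fix c a assume "a \<in> carrier (total bundle)"
  from cases[OF this] show "proj bundle (vscale bundle c a) = proj bundle a"
    by (auto simp: vscale_left vscale_right vscale_closed proj_left proj_right proj_vscale)
next
  show "smooth (prod_space real_space (total bundle)) (total bundle) (\<lambda>(c, v). vscale bundle c v)"
    unfolding smooth_def
  proof (intro conjI allI impI)
    show "(\<lambda>(c, v). vscale bundle c v) ` carrier (prod_space real_space (total bundle)) \<subseteq> carrier (total bundle)"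
      by (auto simp: prod_space_def carrier_bundle vscale_left vscale_right vscale_closed)
    fix n U p assume "plot (prod_space real_space (total bundle)) n U p"
    then have c: "openin (Euclidean_space n) U" "Cinf_on n U (fst \<circ> p)" and "plot (total bundle) n U (snd \<circ> p)"
      by (auto simp: prod_space_def real_space_def)
    then have L: "locally_in n U (\<lambda>N. (\<exists>q. plot (total V1) n N q \<and> (\<forall>w\<in>N. snd (p w) = left (q w))) \<or>
      (\<exists>q. plot (total V2) n N q \<and> (\<forall>w\<in>N. snd (p w) = right (q w))))"
      by (simp add: plot_bundle_iff)
    show "plot (total bundle) n U ((\<lambda>(c, v). vscale bundle c v) \<circ> p)"
      unfolding plot_bundle_iff
    proof (rule locally_in_mono[OF L], elim disjE exE conjE)
      fix N q assume N: "N \<subseteq> U" and q: "plot (total V1) n N q" "\<forall>w\<in>N. snd (p w) = left (q w)"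
      have "plot real_space n N (fst \<circ> p)"
        using Cinf_on_subset[OF c(2) N] plot_open[OF diffeological(3) q(1)] by (simp add: real_space_def)
      from plot_vscale[OF scalable(1) this q(1)] q
      show "(\<exists>q. plot (total V1) n N q \<and> (\<forall>w\<in>N. ((\<lambda>(c, v). vscale bundle c v) \<circ> p) w = left (q w))) \<or>
        (\<exists>q. plot (total V2) n N q \<and> (\<forall>w\<in>N. ((\<lambda>(c, v). vscale bundle c v) \<circ> p) w = right (q w)))"
        using plot_carrier[OF diffeological(3) q(1)]
        by (intro disjI1 exI[of _ "\<lambda>w. vscale V1 ((fst \<circ> p) w) (q w)"]) (simp add: case_prod_beta vscale_left)
    next
      fix N q assume N: "N \<subseteq> U" and q: "plot (total V2) n N q" "\<forall>w\<in>N. snd (p w) = right (q w)"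
      have "plot real_space n N (fst \<circ> p)"
        using Cinf_on_subset[OF c(2) N] plot_open[OF diffeological(4) q(1)] by (simp add: real_space_def)
      from plot_vscale[OF scalable(2) this q(1)] q
      show "(\<exists>q. plot (total V1) n N q \<and> (\<forall>w\<in>N. ((\<lambda>(c, v). vscale bundle c v) \<circ> p) w = left (q w))) \<or>
        (\<exists>q. plot (total V2) n N q \<and> (\<forall>w\<in>N. ((\<lambda>(c, v). vscale bundle c v) \<circ> p) w = right (q w)))"
        using plot_carrier[OF diffeological(4) q(1)]
        by (intro disjI2 exI[of _ "\<lambda>w. vscale V2 ((fst \<circ> p) w) (q w)"]) (simp add: case_prod_beta vscale_right)
    qed
  qed
qed (rule diffeological_base diffeological_bundle smooth_proj_bundle)+

lemma base_right_inject:
  "x \<in> carrier X2 \<Longrightarrow> y \<in> carrier X2 \<Longrightarrow> base_right x = base_right y \<Longrightarrow> x = y"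
  by (simp add: base_class_eq_iff)

lemma base_left_eq_right_iff:
  assumes "x \<in> carrier X1" "y \<in> carrier X2"
  shows "base_left x = base_right y \<longleftrightarrow> x \<in> Y \<and> f x = y"
  using assms by (cases "x \<in> Y") (auto simp: base_class_eq_iff)

lemma base_left_inject:
  assumes "x \<in> carrier X1" "y \<in> carrier X1" "base_left x = base_left y"
  shows "x = y"
  using assms inj by (cases "x \<in> Y"; cases "y \<in> Y") (auto simp: base_class_eq_iff inj_on_def)

text \<open>
Where the base plot lifts to \<open>X2\<close>, a local lift of \<open>q\<close> to \<open>V1\<close> lies over \<open>Y\<close>, and composing it with
\<open>h\<close> gives a lift to \<open>V2\<close>.
\<close>

lemma lift_plot_right:
  assumes q: "plot (total bundle) n N q" and r: "\<And>w. w \<in> N \<Longrightarrow> r w \<in> carrier X2"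
    and qr: "\<And>w. w \<in> N \<Longrightarrow> proj bundle (q w) = base_right (r w)" and u: "u \<in> N"
  obtains M q' where "openin (Euclidean_space n) M" "u \<in> M" "M \<subseteq> N" "plot (total V2) n M q'"
    "\<forall>w\<in>M. q w = right (q' w)" "\<forall>w\<in>M. proj V2 (q' w) = r w"
proof -
  from locally_inE[OF q[unfolded plot_bundle_iff] u] obtain M
    where M: "openin (Euclidean_space n) M" "u \<in> M" "M \<subseteq> N"
    and lift: "(\<exists>p. plot (total V1) n M p \<and> (\<forall>w\<in>M. q w = left (p w))) \<or>
      (\<exists>p. plot (total V2) n M p \<and> (\<forall>w\<in>M. q w = right (p w)))" .
  have "\<exists>p. plot (total V2) n M p \<and> (\<forall>w\<in>M. q w = right (p w))"
    using lift
  proof (elim disjE exE conjE)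
    fix p assume p: "plot (total V1) n M p" "\<forall>w\<in>M. q w = left (p w)"
    have over: "p w \<in> points_over V1 Y" if w: "w \<in> M" for w
    proof -
      have pw: "p w \<in> carrier (total V1)" by (rule plot_carrier[OF diffeological(3) p(1) w])
      then have "base_left (proj V1 (p w)) = base_right (r w)"
        using qr[of w] p(2) w M(3) by (auto simp: proj_left)
      then show ?thesis
        using base_left_eq_right_iff[of "proj V1 (p w)" "r w"] proj_closed(1)[OF pw] r[of w] w M(3) pw
        by (auto simp: points_over_def)
    qed
    have "plot (total V2) n M (h \<circ> p)" by (rule lift_plot[OF p(1) over])
    then show ?thesis
      using p(2) over left_eq_right by (intro exI[of _ "h \<circ> p"]) simp
  qed blast
  then obtain p where p: "plot (total V2) n M p" "\<forall>w\<in>M. q w = right (p w)" by blast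
  have "proj V2 (p w) = r w" if w: "w \<in> M" for w
  proof -
    have pw: "p w \<in> carrier (total V2)" by (rule plot_carrier[OF diffeological(4) p(1) w])
    show ?thesis
      by (rule base_right_inject[OF proj_closed(2)[OF pw]])
        (use r[of w] qr[of w] p(2) w M(3) proj_right[OF pw] in auto)
  qed
  then show ?thesis using that[OF M p(1)] p(2) by blast
qed

text \<open>
A local lift of \<open>q\<close> to \<open>V2\<close> would, by projection, lift the base plot to \<open>X2\<close>; this is excluded, so
the local lift of \<open>q\<close> takes its values in \<open>V1\<close>. It lies over \<open>r\<close> because \<open>f\<close> is injective.
\<close>

lemma lift_plot_left:
  assumes q: "plot (total bundle) n N q" and r: "\<And>w. w \<in> N \<Longrightarrow> r w \<in> carrier X1"
    and qr: "\<And>w. w \<in> N \<Longrightarrow> proj bundle (q w) = base_left (r w)" and u: "u \<in> N"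
    and not_right: "\<And>M r'. openin (Euclidean_space n) M \<Longrightarrow> u \<in> M \<Longrightarrow> M \<subseteq> N \<Longrightarrow> plot X2 n M r' \<Longrightarrow>
      (\<forall>w\<in>M. base_left (r w) = base_right (r' w)) \<Longrightarrow> False"
  obtains M q' where "openin (Euclidean_space n) M" "u \<in> M" "M \<subseteq> N" "plot (total V1) n M q'"
    "\<forall>w\<in>M. q w = left (q' w)" "\<forall>w\<in>M. proj V1 (q' w) = r w"
proof -
  from locally_inE[OF q[unfolded plot_bundle_iff] u] obtain M
    where M: "openin (Euclidean_space n) M" "u \<in> M" "M \<subseteq> N"
    and lift: "(\<exists>p. plot (total V1) n M p \<and> (\<forall>w\<in>M. q w = left (p w))) \<or>
      (\<exists>p. plot (total V2) n M p \<and> (\<forall>w\<in>M. q w = right (p w)))" .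
  have "\<exists>p. plot (total V1) n M p \<and> (\<forall>w\<in>M. q w = left (p w))"
    using lift
  proof (elim disjE exE conjE)
    fix p assume p: "plot (total V2) n M p" "\<forall>w\<in>M. q w = right (p w)"
    have "base_left (r w) = base_right ((proj V2 \<circ> p) w)" if w: "w \<in> M" for w
      using qr[of w] p(2) w M(3) proj_right[OF plot_carrier[OF diffeological(4) p(1) w]] by auto
    then show ?thesis
      using not_right[OF M smooth_plot[OF proj_smooth(2) p(1)]] by blast
  qed blast
  then obtain p where p: "plot (total V1) n M p" "\<forall>w\<in>M. q w = left (p w)" by blast
  have "proj V1 (p w) = r w" if w: "w \<in> M" for w
  proof -
    have pw: "p w \<in> carrier (total V1)" by (rule plot_carrier[OF diffeological(3) p(1) w])
    show ?thesis
      by (rule base_left_inject[OF proj_closed(1)[OF pw]])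
        (use r[of w] qr[of w] p(2) w M(3) proj_left[OF pw] in auto)
  qed
  then show ?thesis using that[OF M p(1)] p(2) by blast
qed

end

section \<open>Gluing commutes with the tensor product\<close>

text \<open>
Both gluings have the same base data, hence the same glued base: \<open>A.base\<close> and \<open>B.base\<close> are the same term.
\<close>

locale bundle_pair_gluing =
  A: bundle_gluing X1 Y f X2 V1 h V2 + B: bundle_gluing X1 Y f X2 V1' h' V2'
  for X1 :: "'x1 diff_space" and Y :: "'x1 set" and f :: "'x1 \<Rightarrow> 'x2" and X2 :: "'x2 diff_space"
    and V1 :: "('x1, 'v1) vbundle" and h :: "'v1 \<Rightarrow> 'v2" and V2 :: "('x2, 'v2) vbundle"
    and V1' :: "('x1, 'w1) vbundle" and h' :: "'w1 \<Rightarrow> 'w2" and V2' :: "('x2, 'w2) vbundle"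
begin

abbreviation "tensor1 \<equiv> tensor_space X1 V1 V1'"
abbreviation "tensor2 \<equiv> tensor_space X2 V2 V2'"
abbreviation "tensor_glued \<equiv> tensor_space A.base A.bundle B.bundle"
abbreviation "tensor_lift \<equiv> tensor_map f V2 V2' h h'"
abbreviation "over_Y \<equiv> points_over (tensor_bundle X1 V1 V1') Y"
abbreviation "tensors \<equiv> tensor_points X1 V1 V1' <+> tensor_points X2 V2 V2'"

definition "tensor_left = tensor_map A.base_left A.bundle B.bundle A.left B.left"
definition "tensor_right = tensor_map A.base_right A.bundle B.bundle A.right B.right"
text \<open>
The map \<open>\<Phi>\<close> of the introduction.
\<close>

definition "glue_tensors = case_sum tensor_left tensor_right"

lemma glue_tensors_simps [simp]: "glue_tensors (Inl t) = tensor_left t" "glue_tensors (Inr t') = tensor_right t'"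
  by (simp_all add: glue_tensors_def)

lemmas scalable1 = A.scalable(1) B.scalable(1)
  and scalable2 = A.scalable(2) B.scalable(2)
  and scalable_glued = A.scalable_glue B.scalable_glue

lemma diffeological_tensors:
  "diffeological_space tensor1" "diffeological_space tensor2" "diffeological_space tensor_glued"
  using diffeological_tensor_space[OF scalable1] diffeological_tensor_space[OF scalable2]
    diffeological_tensor_space[OF scalable_glued] .

lemma carrier_tensors:
  "carrier tensor1 = tensor_points X1 V1 V1'" "carrier tensor2 = tensor_points X2 V2 V2'"
  "carrier tensor_glued = tensor_points A.base A.bundle B.bundle"
  "carrier (sum_space tensor1 tensor2) = tensors"
  by (simp_all add: tensor_space_def sum_space_def)

lemma mem_over_Y_iff: "t \<in> over_Y \<longleftrightarrow> (\<exists>x\<in>Y. t \<in> tensor_fibre V1 V1' x)"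
  using A.Y by (auto simp: points_over_def tensor_bundle_def tensor_space_def tensor_points_eq_Union tensor_fibre_def)

lemma tensor_lift_fibre:
  assumes "x \<in> Y" "t \<in> tensor_fibre V1 V1' x"
  shows "tensor_lift t \<in> tensor_fibre V2 V2' (f x)"
  using tensor_map_fibre[of V1 x V2 f, OF A.fibre_linear_lift[OF assms(1)] B.fibre_linear_lift[OF assms(1)]]
    imageI[OF assms(2)] by (rule subsetD)

lemma tensor_lift_closed: "tensor_lift ` over_Y \<subseteq> tensor_points X2 V2 V2'"
proof (rule image_subsetI)
  fix t assume "t \<in> over_Y"
  then obtain x where x: "x \<in> Y" "t \<in> tensor_fibre V1 V1' x" unfolding mem_over_Y_iff by blast
  then have "f x \<in> carrier X2" using A.fY by blast
  then show "tensor_lift t \<in> tensor_points X2 V2 V2'"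
    unfolding tensor_points_eq_Union using tensor_lift_fibre[OF x] by (rule UN_I)
qed

lemma over_Y_closed: "over_Y \<subseteq> tensor_points X1 V1 V1'"
  by (auto simp: points_over_def tensor_bundle_def tensor_space_def)

lemma tensor_left_fibre:
  assumes "t \<in> tensor_fibre V1 V1' x"
  shows "tensor_left t \<in> tensor_fibre A.bundle B.bundle (A.base_left x)"
  unfolding tensor_left_def
  using tensor_map_fibre[of V1 x A.bundle A.base_left, OF A.fibre_linear_left B.fibre_linear_left]
    imageI[OF assms] by (rule subsetD)

lemma tensor_right_fibre:
  assumes "t \<in> tensor_fibre V2 V2' x"
  shows "tensor_right t \<in> tensor_fibre A.bundle B.bundle (A.base_right x)"
  unfolding tensor_right_def
  using tensor_map_fibre[of V2 x A.bundle A.base_right, OF A.fibre_linear_right B.fibre_linear_right]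
    imageI[OF assms] by (rule subsetD)

text \<open>
Functoriality of the tensor product applied to \<open>left = right \<circ> h\<close> and \<open>left = right \<circ> h'\<close> over \<open>Y\<close>.
\<close>

lemma tensor_left_eq_right:
  assumes "t \<in> over_Y"
  shows "tensor_left t = tensor_right (tensor_lift t)"
proof -
  obtain x where x: "x \<in> Y" "t \<in> tensor_fibre V1 V1' x" using assms unfolding mem_over_Y_iff by blast
  have over: "v \<in> points_over V1 Y" if "v \<in> points_over V1 {x}" for v
    using x(1) that by (simp add: points_over_def)
  have over': "v \<in> points_over V1' Y" if "v \<in> points_over V1' {x}" for v
    using x(1) that by (simp add: points_over_def)
  have "tensor_map A.base_right A.bundle B.bundle A.right B.right (tensor_lift t) =
      tensor_map A.base_left A.bundle B.bundle A.left B.left t"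
    by (rule tensor_map_comp[where x=x and V=V1 and W=V1'])
      (fact A.fibre_linear_lift[OF x(1)] B.fibre_linear_lift[OF x(1)] A.fibre_linear_right B.fibre_linear_right
        A.fibre_linear_left B.fibre_linear_left A.base_left_eq_right[OF x(1)]
        A.left_eq_right[OF over] B.left_eq_right[OF over'] x(2))+
  then show ?thesis by (simp add: tensor_left_def tensor_right_def)
qed

lemma bij_tensor_left:
  assumes "x \<in> carrier X1" "x \<notin> Y"
  shows "bij_betw tensor_left (tensor_fibre V1 V1' x) (tensor_fibre A.bundle B.bundle (A.base_left x))"
  unfolding tensor_left_def
  using tensor_map_bij[of X1 V1 V1' x A.bundle A.base_left, OF A.V1 B.V1 A.fibre_linear_left
      B.fibre_linear_left A.bij_left[OF assms] B.bij_left[OF assms]] .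

lemma bij_tensor_right:
  assumes "x \<in> carrier X2"
  shows "bij_betw tensor_right (tensor_fibre V2 V2' x) (tensor_fibre A.bundle B.bundle (A.base_right x))"
  unfolding tensor_right_def
  using tensor_map_bij[of X2 V2 V2' x A.bundle A.base_right, OF A.V2 B.V2 A.fibre_linear_right
      B.fibre_linear_right A.bij_right[OF assms] B.bij_right[OF assms]] .

lemma tensors_cases:
  assumes "s \<in> tensors"
  obtains x t where "s = Inl t" "x \<in> carrier X1" "t \<in> tensor_fibre V1 V1' x"
  | x t where "s = Inr t" "x \<in> carrier X2" "t \<in> tensor_fibre V2 V2' x"
  using assms unfolding tensor_points_eq_Union by (cases s) auto

lemma glue_tensors_fibre:
  assumes "s \<in> tensors"
  shows "glue_tensors s \<in> tensor_points A.base A.bundle B.bundle" "fst (glue_tensors s) = A.base_class (map_sum fst fst s)"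
proof -
  from assms show "glue_tensors s \<in> tensor_points A.base A.bundle B.bundle"
  proof (cases rule: tensors_cases)
    case (1 x t)
    show ?thesis
      unfolding 1(1) glue_tensors_simps tensor_points_eq_Union
      using smooth_carrier[OF A.smooth_base_left 1(2)] tensor_left_fibre[OF 1(3)] by (rule UN_I)
  next
    case (2 x t)
    show ?thesis
      unfolding 2(1) glue_tensors_simps tensor_points_eq_Union
      using smooth_carrier[OF A.smooth_base_right 2(2)] tensor_right_fibre[OF 2(3)] by (rule UN_I)
  qed
  from assms show "fst (glue_tensors s) = A.base_class (map_sum fst fst s)"
    by (cases rule: tensors_cases)
      (simp_all add: fst_tensor_fibre[OF tensor_left_fibre] fst_tensor_fibre[OF tensor_right_fibre] fst_tensor_fibre)
qed

lemma glue_tensors_retract: "glue_tensors (glue_retract over_Y tensor_lift s) = glue_tensors s"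
proof (cases rule: glue_retract_cases[where s=s and Y=over_Y and f=tensor_lift])
  case (2 t)
  have "glue_tensors (glue_retract over_Y tensor_lift s) = tensor_right (tensor_lift t)"
    unfolding 2(3) by (rule glue_tensors_simps)
  also have "\<dots> = glue_tensors s"
    unfolding 2(1) glue_tensors_simps using tensor_left_eq_right[OF 2(2)] by (rule sym)
  finally show ?thesis .
qed (simp_all only:)

text \<open>
In normal form a point of the disjoint union lies over \<open>X1 - Y\<close> or over \<open>X2\<close>, and there \<open>\<Phi>\<close> is
bijective on fibres.
\<close>

lemma retract_tensors_cases:
  assumes s: "s \<in> tensors"
  obtains x t where "glue_retract over_Y tensor_lift s = Inl t" "x \<in> carrier X1" "x \<notin> Y" "t \<in> tensor_fibre V1 V1' x"
  | x t where "glue_retract over_Y tensor_lift s = Inr t" "x \<in> carrier X2" "t \<in> tensor_fibre V2 V2' x"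
  using s
proof (cases rule: tensors_cases)
  case (1 x t)
  show ?thesis
  proof (cases "x \<in> Y")
    case True
    then have "t \<in> over_Y" using 1(3) unfolding mem_over_Y_iff by blast
    then have "glue_retract over_Y tensor_lift s = Inr (tensor_lift t)" by (simp add: 1(1))
    moreover have "f x \<in> carrier X2" using True A.fY by blast
    ultimately show ?thesis using tensor_lift_fibre[OF True 1(3)] by (rule that(2))
  next
    case False
    have "t \<notin> over_Y"
    proof
      assume "t \<in> over_Y"
      then obtain y where y: "y \<in> Y" "t \<in> tensor_fibre V1 V1' y" unfolding mem_over_Y_iff by blast
      then show False using False fst_tensor_fibre[OF y(2)] fst_tensor_fibre[OF 1(3)] by simp
    qed
    then have "glue_retract over_Y tensor_lift s = Inl t" by (simp add: 1(1))
    then show ?thesis using 1(2) False 1(3) by (rule that(1))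
  qed
next
  case (2 x t)
  then have "glue_retract over_Y tensor_lift s = Inr t" by simp
  then show ?thesis using 2(2,3) by (rule that(2))
qed

lemma glue_tensors_left_neq_right:
  assumes "x \<in> carrier X1" "x \<notin> Y" "t \<in> tensor_fibre V1 V1' x" "x' \<in> carrier X2" "t' \<in> tensor_fibre V2 V2' x'"
  shows "tensor_left t \<noteq> tensor_right t'"
proof
  assume "tensor_left t = tensor_right t'"
  then have "A.base_left x = A.base_right x'"
    using fst_tensor_fibre[OF tensor_left_fibre[OF assms(3)]] fst_tensor_fibre[OF tensor_right_fibre[OF assms(5)]] by simp
  then show False using A.base_left_eq_right_iff[OF assms(1,4)] assms(2) by blast
qed

text \<open>
Two normal forms with the same image lie over the same point of the glued base, hence over the same point
of \<open>X1 - Y\<close> or of \<open>X2\<close>, and \<open>\<Phi>\<close> is injective on the fibre there.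
\<close>

lemma glue_tensors_eq_imp_retract_eq:
  assumes s: "s \<in> tensors" and s': "s' \<in> tensors" and eq: "glue_tensors s = glue_tensors s'"
  shows "glue_retract over_Y tensor_lift s = glue_retract over_Y tensor_lift s'"
proof -
  have eq': "glue_tensors (glue_retract over_Y tensor_lift s) = glue_tensors (glue_retract over_Y tensor_lift s')"
    using eq by (simp only: glue_tensors_retract)
  show ?thesis
    using s
  proof (cases rule: retract_tensors_cases)
    case t: (1 x t)
    show ?thesis
      using s'
    proof (cases rule: retract_tensors_cases)
      case t': (1 x' t')
      have e: "tensor_left t = tensor_left t'" using eq' by (simp only: t(1) t'(1) glue_tensors_simps)
      then have "A.base_left x = A.base_left x'"
        using fst_tensor_fibre[OF tensor_left_fibre[OF t(4)]] fst_tensor_fibre[OF tensor_left_fibre[OF t'(4)]] by simp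
      then have "x = x'" by (rule A.base_left_inject[OF t(2) t'(2)])
      then have "t = t'"
        using inj_onD[OF bij_betw_imp_inj_on[OF bij_tensor_left[OF t(2,3)]] e t(4)] t'(4) by simp
      then show ?thesis by (simp only: t(1) t'(1))
    next
      case t': (2 x' t')
      have "tensor_left t = tensor_right t'" using eq' by (simp only: t(1) t'(1) glue_tensors_simps)
      then show ?thesis using glue_tensors_left_neq_right[OF t(2-4) t'(2,3)] by simp
    qed
  next
    case t: (2 x t)
    show ?thesis
      using s'
    proof (cases rule: retract_tensors_cases)
      case t': (1 x' t')
      have "tensor_left t' = tensor_right t" using eq' by (simp only: t(1) t'(1) glue_tensors_simps)
      then show ?thesis using glue_tensors_left_neq_right[OF t'(2-4) t(2,3)] by simp
    next
      case t': (2 x' t')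
      have e: "tensor_right t = tensor_right t'" using eq' by (simp only: t(1) t'(1) glue_tensors_simps)
      then have "A.base_right x = A.base_right x'"
        using fst_tensor_fibre[OF tensor_right_fibre[OF t(3)]] fst_tensor_fibre[OF tensor_right_fibre[OF t'(3)]] by simp
      then have "x = x'" by (rule A.base_right_inject[OF t(2) t'(2)])
      then have "t = t'"
        using inj_onD[OF bij_betw_imp_inj_on[OF bij_tensor_right[OF t(2)]] e t(3)] t'(3) by simp
      then show ?thesis by (simp only: t(1) t'(1))
    qed
  qed
qed

lemma glue_tensors_onto: "glue_tensors ` tensors = tensor_points A.base A.bundle B.bundle"
proof
  show "glue_tensors ` tensors \<subseteq> tensor_points A.base A.bundle B.bundle"
    using glue_tensors_fibre(1) by (rule image_subsetI)
  show "tensor_points A.base A.bundle B.bundle \<subseteq> glue_tensors ` tensors"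
  proof
    fix t assume "t \<in> tensor_points A.base A.bundle B.bundle"
    then obtain c where c: "c \<in> carrier X1 <+> carrier X2" and t: "t \<in> tensor_fibre A.bundle B.bundle (A.base_class c)"
      unfolding tensor_points_eq_Union carrier_glue_space by blast
    have t: "t \<in> tensor_fibre A.bundle B.bundle (A.base_class (glue_retract Y f c))"
      using t by (simp only: glue_class_retract[OF A.Y A.fY c])
    have rc: "glue_retract Y f c \<in> carrier X1 <+> carrier X2" by (rule glue_retract_closed[OF A.fY c])
    show "t \<in> glue_tensors ` tensors"
    proof (cases "glue_retract Y f c")
      case (Inl x)
      then have x: "x \<in> carrier X1" "x \<notin> Y"
        using rc glue_retract_idem[of Y f c] by (auto simp: glue_retract_def split: if_splits)
      obtain t' where t': "t' \<in> tensor_fibre V1 V1' x" "t = tensor_left t'"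
        using bij_tensor_left[OF x] t unfolding Inl bij_betw_def by blast
      then have "Inl t' \<in> tensors" using x(1) by (auto simp: tensor_points_eq_Union)
      then show ?thesis by (intro image_eqI[of _ _ "Inl t'"]) (simp_all only: glue_tensors_simps t'(2))
    next
      case (Inr x)
      then have x: "x \<in> carrier X2" using rc by simp
      obtain t' where t': "t' \<in> tensor_fibre V2 V2' x" "t = tensor_right t'"
        using bij_tensor_right[OF x] t unfolding Inr bij_betw_def by blast
      then have "Inr t' \<in> tensors" using x by (auto simp: tensor_points_eq_Union)
      then show ?thesis by (intro image_eqI[of _ _ "Inr t'"]) (simp_all only: glue_tensors_simps t'(2))
    qed
  qed
qed

lemma glue_rel_eq_kernel_glue_tensors:
  "glue_rel tensor1 over_Y tensor_lift tensor2 = {(s, t). s \<in> tensors \<and> t \<in> tensors \<and> glue_tensors s = glue_tensors t}"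
proof -
  have "glue_tensors s = glue_tensors t" if "glue_retract over_Y tensor_lift s = glue_retract over_Y tensor_lift t" for s t
    using glue_tensors_retract[of s] glue_tensors_retract[of t] that by simp
  then show ?thesis
    unfolding glue_rel_eq_kernel[of over_Y tensor1 tensor_lift tensor2, unfolded carrier_tensors, OF over_Y_closed tensor_lift_closed]
    using glue_tensors_eq_imp_retract_eq by blast
qed

lemma smooth_tensor_left: "smooth tensor1 tensor_glued tensor_left"
  unfolding tensor_left_def
proof (rule smooth_tensor_map)
  show "fibre_linear V1 x A.bundle (A.base_left x) A.left" for x
    by (rule A.fibre_linear_left)
  show "fibre_linear V1' x B.bundle (A.base_left x) B.left" for x
    by (rule B.fibre_linear_left)
qed (rule scalable1 scalable_glued A.smooth_base_left A.smooth_left B.smooth_left)+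

lemma smooth_tensor_right: "smooth tensor2 tensor_glued tensor_right"
  unfolding tensor_right_def
proof (rule smooth_tensor_map)
  show "fibre_linear V2 x A.bundle (A.base_right x) A.right" for x
    by (rule A.fibre_linear_right)
  show "fibre_linear V2' x B.bundle (A.base_right x) B.right" for x
    by (rule B.fibre_linear_right)
qed (rule scalable2 scalable_glued A.smooth_base_right A.smooth_right B.smooth_right)+

lemma smooth_glue_tensors: "smooth (sum_space tensor1 tensor2) tensor_glued glue_tensors"
  unfolding glue_tensors_def
  by (rule smooth_case_sum[OF diffeological_tensors(3) smooth_tensor_left smooth_tensor_right])

lemma restricted_components:
  assumes D: "plots_over A.base A.bundle B.bundle n N r qs"
    and M: "openin (Euclidean_space n) M" "M \<subseteq> N" and q: "q \<in> set qs"
  shows "plot (total A.bundle) n M (fst \<circ> q)" "plot (total B.bundle) n M (snd \<circ> q)"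
    and "w \<in> M \<Longrightarrow> proj A.bundle ((fst \<circ> q) w) = r w" "w \<in> M \<Longrightarrow> proj B.bundle ((snd \<circ> q) w) = r w"
proof -
  note fq = plot_fibre_productD(1,2)[OF plots_overD(2)[OF D q]]
  show "plot (total A.bundle) n M (fst \<circ> q)" "plot (total B.bundle) n M (snd \<circ> q)"
    using plot_restrict[OF A.diffeological_bundle fq(1) M] plot_restrict[OF B.diffeological_bundle fq(2) M] .
  show "proj A.bundle ((fst \<circ> q) w) = r w" "proj B.bundle ((snd \<circ> q) w) = r w" if "w \<in> M"
    using plots_overD(4)[OF D q, of w] that M(2) by (auto simp: points_over_def mem_Times_iff)
qed

lemma sum_of_tensors_lift_right:
  assumes D: "plots_over A.base A.bundle B.bundle n N r qs"
    and M: "openin (Euclidean_space n) M" "u \<in> M" "M \<subseteq> N" and r2: "plot X2 n M r2"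
    and r: "\<forall>w\<in>M. r w = A.base_right (r2 w)"
  obtains M' t where "openin (Euclidean_space n) M'" "u \<in> M'" "M' \<subseteq> M" "plot tensor2 n M' t"
    "\<forall>w\<in>M'. tensor_right (t w) = (r w, tensor_class A.bundle B.bundle (r w) (sum_list (map (\<lambda>q. gen (q w)) qs)))"
proof -
  note r2X = plot_carrier[OF A.diffeological(2) r2]
  have lift: "\<exists>M' q'. openin (Euclidean_space n) M' \<and> u \<in> M' \<and> M' \<subseteq> M \<and> plot (fibre_product V2 V2') n M' q' \<and>
      (\<forall>w\<in>M'. q w = map_prod A.right B.right (q' w) \<and> proj V2 (fst (q' w)) = r2 w)" if q: "q \<in> set qs" for q
  proof -
    note fq = restricted_components[OF D M(1,3) q]
    have projs: "proj A.bundle ((fst \<circ> q) w) = A.base_right (r2 w)" "proj B.bundle ((snd \<circ> q) w) = A.base_right (r2 w)"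
      if "w \<in> M" for w
      using fq(3,4)[OF that] r[rule_format, OF that] by (simp_all only:)
    from A.lift_plot_right[OF fq(1) r2X projs(1) M(2)] obtain M1 q1
      where q1: "openin (Euclidean_space n) M1" "u \<in> M1" "M1 \<subseteq> M" "plot (total V2) n M1 q1"
        "\<forall>w\<in>M1. (fst \<circ> q) w = A.right (q1 w)" "\<forall>w\<in>M1. proj V2 (q1 w) = r2 w" .
    from B.lift_plot_right[OF fq(2) r2X projs(2) M(2)] obtain M2 q2
      where q2: "openin (Euclidean_space n) M2" "u \<in> M2" "M2 \<subseteq> M" "plot (total V2') n M2 q2"
        "\<forall>w\<in>M2. (snd \<circ> q) w = B.right (q2 w)" "\<forall>w\<in>M2. proj V2' (q2 w) = r2 w" .
    show ?thesis
      using fibre_product_lift[OF A.diffeological(4) B.diffeological(4) q1(1-4) q1(5)[unfolded comp_def] q1(6)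
          q2(1-4) q2(5)[unfolded comp_def] q2(6)] .
  qed
  obtain M' t where t: "openin (Euclidean_space n) M'" "u \<in> M'" "M' \<subseteq> M" "plot tensor2 n M' t"
    "\<forall>w\<in>M'. tensor_map A.base_right A.bundle B.bundle A.right B.right (t w) =
      (A.base_right (r2 w), tensor_class A.bundle B.bundle (A.base_right (r2 w)) (sum_list (map (\<lambda>q. gen (q w)) qs)))"
    by (rule lift_sum_of_tensors[OF scalable2 r2 M(2) A.fibre_linear_right B.fibre_linear_right lift])
  have "\<forall>w\<in>M'. tensor_right (t w) = (r w, tensor_class A.bundle B.bundle (r w) (sum_list (map (\<lambda>q. gen (q w)) qs)))"
  proof
    fix w assume w: "w \<in> M'"
    then have "r w = A.base_right (r2 w)" using r t(3) by blast
    then show "tensor_right (t w) = (r w, tensor_class A.bundle B.bundle (r w) (sum_list (map (\<lambda>q. gen (q w)) qs)))"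
      using t(5)[rule_format, OF w] by (simp only: tensor_right_def)
  qed
  then show ?thesis by (rule that[OF t(1-4)])
qed

lemma sum_of_tensors_lift_left:
  assumes D: "plots_over A.base A.bundle B.bundle n N r qs"
    and M: "openin (Euclidean_space n) M" "u \<in> M" "M \<subseteq> N" and r1: "plot X1 n M r1"
    and r: "\<forall>w\<in>M. r w = A.base_left (r1 w)"
    and not_right: "\<And>M' r2. openin (Euclidean_space n) M' \<Longrightarrow> u \<in> M' \<Longrightarrow> M' \<subseteq> M \<Longrightarrow> plot X2 n M' r2 \<Longrightarrow>
      \<forall>w\<in>M'. r w = A.base_right (r2 w) \<Longrightarrow> False"
  obtains M' t where "openin (Euclidean_space n) M'" "u \<in> M'" "M' \<subseteq> M" "plot tensor1 n M' t"
    "\<forall>w\<in>M'. tensor_left (t w) = (r w, tensor_class A.bundle B.bundle (r w) (sum_list (map (\<lambda>q. gen (q w)) qs)))"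
proof -
  note r1X = plot_carrier[OF A.diffeological(1) r1]
  have not_right': False if "openin (Euclidean_space n) M'" "u \<in> M'" "M' \<subseteq> M" "plot X2 n M' r2"
    "\<forall>w\<in>M'. A.base_left (r1 w) = A.base_right (r2 w)" for M' r2
  proof (rule not_right[OF that(1-4)])
    show "\<forall>w\<in>M'. r w = A.base_right (r2 w)"
    proof
      fix w assume w: "w \<in> M'"
      have "r w = A.base_left (r1 w)" using r subsetD[OF that(3) w] by (rule bspec)
      also have "\<dots> = A.base_right (r2 w)" using that(5) w by (rule bspec)
      finally show "r w = A.base_right (r2 w)" .
    qed
  qed
  have lift: "\<exists>M' q'. openin (Euclidean_space n) M' \<and> u \<in> M' \<and> M' \<subseteq> M \<and> plot (fibre_product V1 V1') n M' q' \<and>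
      (\<forall>w\<in>M'. q w = map_prod A.left B.left (q' w) \<and> proj V1 (fst (q' w)) = r1 w)" if q: "q \<in> set qs" for q
  proof -
    note fq = restricted_components[OF D M(1,3) q]
    have projs: "proj A.bundle ((fst \<circ> q) w) = A.base_left (r1 w)" "proj B.bundle ((snd \<circ> q) w) = A.base_left (r1 w)"
      if "w \<in> M" for w
      using fq(3,4)[OF that] r[rule_format, OF that] by (simp_all only:)
    from A.lift_plot_left[OF fq(1) r1X projs(1) M(2) not_right'] obtain M1 q1
      where q1: "openin (Euclidean_space n) M1" "u \<in> M1" "M1 \<subseteq> M" "plot (total V1) n M1 q1"
        "\<forall>w\<in>M1. (fst \<circ> q) w = A.left (q1 w)" "\<forall>w\<in>M1. proj V1 (q1 w) = r1 w" .
    from B.lift_plot_left[OF fq(2) r1X projs(2) M(2) not_right'] obtain M2 q2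
      where q2: "openin (Euclidean_space n) M2" "u \<in> M2" "M2 \<subseteq> M" "plot (total V1') n M2 q2"
        "\<forall>w\<in>M2. (snd \<circ> q) w = B.left (q2 w)" "\<forall>w\<in>M2. proj V1' (q2 w) = r1 w" .
    show ?thesis
      using fibre_product_lift[OF A.diffeological(3) B.diffeological(3) q1(1-4) q1(5)[unfolded comp_def] q1(6)
          q2(1-4) q2(5)[unfolded comp_def] q2(6)] .
  qed
  obtain M' t where t: "openin (Euclidean_space n) M'" "u \<in> M'" "M' \<subseteq> M" "plot tensor1 n M' t"
    "\<forall>w\<in>M'. tensor_map A.base_left A.bundle B.bundle A.left B.left (t w) =
      (A.base_left (r1 w), tensor_class A.bundle B.bundle (A.base_left (r1 w)) (sum_list (map (\<lambda>q. gen (q w)) qs)))"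
    by (rule lift_sum_of_tensors[OF scalable1 r1 M(2) A.fibre_linear_left B.fibre_linear_left lift])
  have "\<forall>w\<in>M'. tensor_left (t w) = (r w, tensor_class A.bundle B.bundle (r w) (sum_list (map (\<lambda>q. gen (q w)) qs)))"
  proof
    fix w assume w: "w \<in> M'"
    then have "r w = A.base_left (r1 w)" using r t(3) by blast
    then show "tensor_left (t w) = (r w, tensor_class A.bundle B.bundle (r w) (sum_list (map (\<lambda>q. gen (q w)) qs)))"
      using t(5)[rule_format, OF w] by (simp only: tensor_left_def)
  qed
  then show ?thesis by (rule that[OF t(1-4)])
qed

text \<open>
The smoothness of \<open>\<Psi>\<close>. The case distinction is on the base plot, so that all terms of the sum are lifted
to the same piece.
\<close>

lemma plot_lifts_through_glue_tensors:
  assumes "plot tensor_glued n U p"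
  shows "locally_in n U (\<lambda>N. \<exists>q. plot (sum_space tensor1 tensor2) n N q \<and> (\<forall>w\<in>N. p w = glue_tensors (q w)))"
proof -
  have L: "locally_in n U (sum_of_tensors_on A.base A.bundle B.bundle n p)"
    using assms by (rule plot_tensor_space_iff[OF scalable_glued, THEN iffD1])
  show ?thesis
  proof (rule locally_inI[OF locally_in_open[OF L]])
    fix u assume u: "u \<in> U"
    let ?goal = "\<exists>N. openin (Euclidean_space n) N \<and> u \<in> N \<and> N \<subseteq> U \<and>
        (\<exists>q. plot (sum_space tensor1 tensor2) n N q \<and> (\<forall>w\<in>N. p w = glue_tensors (q w)))"
    from locally_inE[OF L u] obtain N where N: "openin (Euclidean_space n) N" "u \<in> N" "N \<subseteq> U"
      "sum_of_tensors_on A.base A.bundle B.bundle n p N" .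
    from N(4) obtain r qs where D: "plots_over A.base A.bundle B.bundle n N r qs"
      and p: "\<forall>w\<in>N. p w = (r w, tensor_class A.bundle B.bundle (r w) (sum_list (map (\<lambda>q. gen (q w)) qs)))"
      by (rule sum_of_tensors_onE)
    show ?goal
    proof (cases "\<exists>M r2. openin (Euclidean_space n) M \<and> u \<in> M \<and> M \<subseteq> N \<and> plot X2 n M r2 \<and> (\<forall>w\<in>M. r w = A.base_right (r2 w))")
      case True
      then obtain M r2 where M: "openin (Euclidean_space n) M" "u \<in> M" "M \<subseteq> N" and r2: "plot X2 n M r2"
        and r: "\<forall>w\<in>M. r w = A.base_right (r2 w)" by blast
      from sum_of_tensors_lift_right[OF D M r2 r] obtain M' t where t: "openin (Euclidean_space n) M'" "u \<in> M'" "M' \<subseteq> M" "plot tensor2 n M' t"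
        "\<forall>w\<in>M'. tensor_right (t w) = (r w, tensor_class A.bundle B.bundle (r w) (sum_list (map (\<lambda>q. gen (q w)) qs)))" .
      have plot: "plot (sum_space tensor1 tensor2) n M' (\<lambda>w. Inr (t w))"
        using t(1,4) by (auto simp: sum_space_def intro!: locally_in_whole)
      have eq: "p w = glue_tensors (Inr (t w))" if w: "w \<in> M'" for w
        using p t(3,5) M(3) w by (simp add: subset_iff)
      have "M' \<subseteq> U" using t(3) M(3) N(3) by blast
      then show ?thesis
        using t(1,2) plot eq by (intro exI[of _ M'] conjI exI[of _ "\<lambda>w. Inr (t w)"] ballI)
    next
      case False
      have "locally_in n N (\<lambda>N. (\<exists>q. plot X1 n N q \<and> (\<forall>w\<in>N. r w = A.base_left (q w))) \<or>
          (\<exists>q. plot X2 n N q \<and> (\<forall>w\<in>N. r w = A.base_right (q w))))"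
        using plots_overD(1)[OF D] unfolding A.plot_base_iff .
      from locally_inE[OF this N(2)] obtain M where M: "openin (Euclidean_space n) M" "u \<in> M" "M \<subseteq> N"
        and "(\<exists>q. plot X1 n M q \<and> (\<forall>w\<in>M. r w = A.base_left (q w))) \<or>
          (\<exists>q. plot X2 n M q \<and> (\<forall>w\<in>M. r w = A.base_right (q w)))" .
      \<comment> \<open>A local lift of \<open>r\<close> to \<open>X2\<close> near \<open>u\<close> is excluded in this case.\<close>
      then obtain r1 where r1: "plot X1 n M r1" and r: "\<forall>w\<in>M. r w = A.base_left (r1 w)"
        using False M by blast
      have not_right: False if "openin (Euclidean_space n) M'" "u \<in> M'" "M' \<subseteq> M" "plot X2 n M' r2"
        "\<forall>w\<in>M'. r w = A.base_right (r2 w)" for M' r2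
      proof -
        have "M' \<subseteq> N" using that(3) M(3) by (rule order.trans)
        then show False using False that(1,2,4,5) by blast
      qed
      from sum_of_tensors_lift_left[OF D M r1 r not_right] obtain M' t where t: "openin (Euclidean_space n) M'" "u \<in> M'" "M' \<subseteq> M"
        "plot tensor1 n M' t"
        "\<forall>w\<in>M'. tensor_left (t w) = (r w, tensor_class A.bundle B.bundle (r w) (sum_list (map (\<lambda>q. gen (q w)) qs)))" .
      have plot: "plot (sum_space tensor1 tensor2) n M' (\<lambda>w. Inl (t w))"
        using t(1,4) by (auto simp: sum_space_def intro!: locally_in_whole)
      have eq: "p w = glue_tensors (Inl (t w))" if w: "w \<in> M'" for w
        using p t(3,5) M(3) w by (simp add: subset_iff)
      have "M' \<subseteq> U" using t(3) M(3) N(3) by blast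
      then show ?thesis
        using t(1,2) plot eq by (intro exI[of _ M'] conjI exI[of _ "\<lambda>w. Inl (t w)"] ballI)
    qed
  qed
qed

lemma proj_glue_tensor_bundle:
  assumes s: "s \<in> tensors"
  shows "proj (glue_bundle X1 Y f X2 (tensor_bundle X1 V1 V1') tensor_lift (tensor_bundle X2 V2 V2'))
    (glue_class tensor1 over_Y tensor_lift tensor2 s) = A.base_class (map_sum fst fst s)"
proof -
  let ?T1 = "tensor_bundle X1 V1 V1'" and ?T2 = "tensor_bundle X2 V2 V2'"
  have simps: "total ?T1 = tensor1" "total ?T2 = tensor2" "proj ?T1 = fst" "proj ?T2 = fst"
    by (simp_all add: tensor_bundle_def)
  have pr: "fst ` tensor_points X1 V1 V1' \<subseteq> carrier X1" "fst ` tensor_points X2 V2 V2' \<subseteq> carrier X2"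
    by (auto simp: mem_tensor_points_iff)
  have "fst (tensor_lift t) = f (fst t)" if t: "t \<in> over_Y" for t
  proof -
    obtain x where x: "x \<in> Y" "t \<in> tensor_fibre V1 V1' x" using t unfolding mem_over_Y_iff by blast
    show ?thesis using fst_tensor_fibre[OF tensor_lift_fibre[OF x]] fst_tensor_fibre[OF x(2)] by simp
  qed
  note lift = this
  show ?thesis
    using proj_glue_class[where ?V1.0 = ?T1 and ?V2.0 = ?T2 and h = tensor_lift and s = s, unfolded simps carrier_tensors,
        OF A.Y A.fY pr tensor_lift_closed lift s] .
qed

end

theorem theorem2p3:
  fixes X1 :: "'x1 diff_space" and X2 :: "'x2 diff_space"
    and V1 :: "('x1, 'v1) vbundle" and V1' :: "('x1, 'w1) vbundle"
    and V2 :: "('x2, 'v2) vbundle" and V2' :: "('x2, 'w2) vbundle"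
    and Y :: "'x1 set" and f :: "'x1 \<Rightarrow> 'x2"
    and ft :: "'v1 \<Rightarrow> 'v2" and ft' :: "'w1 \<Rightarrow> 'w2"
  assumes "fd_pseudo_bundle X1 V1" and "fd_pseudo_bundle X1 V1'"
    and "fd_pseudo_bundle X2 V2" and "fd_pseudo_bundle X2 V2'"
    and "Y \<subseteq> carrier X1"
    and "smooth (subset_space X1 Y) X2 f"
    and "diffeomorphism (subset_space X1 Y) (subset_space X2 (f ` Y)) f"
    and "smooth_linear_lift V1 Y f V2 ft"
    and "smooth_linear_lift V1' Y f V2' ft'"
  defines "L \<equiv> tensor_bundle (glue_space X1 Y f X2)
                 (glue_bundle X1 Y f X2 V1 ft V2) (glue_bundle X1 Y f X2 V1' ft' V2')"
    and "R \<equiv> glue_bundle X1 Y f X2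
               (tensor_bundle X1 V1 V1') (tensor_map f V2 V2' ft ft') (tensor_bundle X2 V2 V2')"
  shows "\<exists>\<Psi>. diffeomorphism (total L) (total R) \<Psi> \<and>
             (\<forall>t\<in>carrier (total L). proj L t = proj R (\<Psi> t))"
proof -
  have pb: "pseudo_bundle X1 V1" "pseudo_bundle X1 V1'" "pseudo_bundle X2 V2" "pseudo_bundle X2 V2'"
    using assms(1-4) by (auto simp: fd_pseudo_bundle_def)
  have fY: "f ` Y \<subseteq> carrier X2"
    using assms(6) by (auto simp: smooth_def subset_space_def)
  have inj: "inj_on f Y"
    using assms(7) by (auto simp: diffeomorphism_def bij_betw_def subset_space_def)
  interpret bundle_pair_gluing X1 Y f X2 V1 ft V2 V1' ft' V2'
    by unfold_locales (fact pb assms(5) fY inj assms(8,9))+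
  let ?\<Psi> = "\<lambda>z. {s \<in> carrier (sum_space tensor1 tensor2). glue_tensors s = z}"
  have "diffeomorphism tensor_glued (quotient_space (sum_space tensor1 tensor2) (glue_rel tensor1 over_Y tensor_lift tensor2)) ?\<Psi>"
    by (rule quotient_by_kernel_diffeomorphism[OF _ diffeological_tensors(3) smooth_glue_tensors _ plot_lifts_through_glue_tensors])
      (simp_all only: diffeological_sum_space diffeological_tensors carrier_tensors glue_tensors_onto glue_rel_eq_kernel_glue_tensors)
  then have diffeo: "diffeomorphism (total L) (total R) ?\<Psi>"
    by (simp add: L_def R_def tensor_bundle_def glue_bundle_def Let_def glue_space_def)
  have "proj L t = proj R (?\<Psi> t)" if t: "t \<in> carrier (total L)" for t
  proof -
    have "t \<in> glue_tensors ` tensors" using t by (simp add: L_def tensor_bundle_def carrier_tensors glue_tensors_onto)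
    then obtain s where s: "s \<in> tensors" "t = glue_tensors s" by blast
    have "?\<Psi> t = glue_class tensor1 over_Y tensor_lift tensor2 s"
      unfolding glue_class_def glue_rel_eq_kernel_glue_tensors carrier_tensors using s by auto
    then have "proj R (?\<Psi> t) = A.base_class (map_sum fst fst s)"
      using proj_glue_tensor_bundle[OF s(1)] by (simp add: R_def)
    also have "\<dots> = proj L t"
      using glue_tensors_fibre(2)[OF s(1)] s(2) by (simp add: L_def tensor_bundle_def)
    finally show ?thesis by simp
  qed
  with diffeo show ?thesis by blast
qed

end
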